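(* (In ZF.) Let $n$ be a natural number. For any infinite set $A$ that admits a linear order, $|S_{\leq n}(A)| < |\textup{Part}_{\textup{fin}}(A)|$; that is, there is an injection from $S_{\leq n}(A)$ into $\textup{Part}_{\textup{fin}}(A)$ but there is no bijection between them.
   Context: Work in ZF (no Axiom of Choice). For sets $X,Y$, $|X|\le|Y|$ means there is an injection from $X$ into $Y$, and $|X|<|Y|$ means $|X|\le|Y|$ and $|X|\ne|Y|$. For a set $A$, $\textup{Part}_{\textup{fin}}(A)$ is the set of partitions of $A$ all of whose blocks are finite, and $S_{\leq n}(A)$ is the set of permutations $\phi$ of $A$ with at most $n$ non-fixed points, i.e. $|\{x\in A:\phi(x)\neq x\}|\le n$. *)

theory Defs
  imports Main
begin

text \<open>
  Isabelle/HOL has a global choice operator, so a choice-free theorem has to be stated about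
  the models of ZF: a type \<open>'v\<close> with a membership relation that satisfies the first-order
  axioms of ZF. Separation and Replacement are restricted to first-order formulas with
  parameters; with arbitrary HOL predicates in their place, the choice operator of HOL would
  make every model satisfy the Axiom of Choice.
\<close>

datatype fm = Mem nat nat | Eql nat nat | Neg fm | And fm fm | All nat fm

text \<open>
  The definitions in the following locale spell out notions of the language of set theory. All
  quantifiers range over the elements of the model, so functions, orders, partitions and
  natural numbers are those of the model.
\<close>

locale set_language =
  fixes mem :: "'v \<Rightarrow> 'v \<Rightarrow> bool"  (infix \<open>\<^bold>\<in>\<close> 50)
begin

primrec sat :: "(nat \<Rightarrow> 'v) \<Rightarrow> fm \<Rightarrow> bool" where
  "sat e (Mem i j) \<longleftrightarrow> e i \<^bold>\<in> e j"
| "sat e (Eql i j) \<longleftrightarrow> e i = e j"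
| "sat e (Neg p) \<longleftrightarrow> \<not> sat e p"
| "sat e (And p q) \<longleftrightarrow> sat e p \<and> sat e q"
| "sat e (All i p) \<longleftrightarrow> (\<forall>x. sat (e(i := x)) p)"

definition subset :: "'v \<Rightarrow> 'v \<Rightarrow> bool" where
  "subset x y \<longleftrightarrow> (\<forall>z. z \<^bold>\<in> x \<longrightarrow> z \<^bold>\<in> y)"

definition is_empty :: "'v \<Rightarrow> bool" where
  "is_empty x \<longleftrightarrow> (\<forall>z. \<not> z \<^bold>\<in> x)"

definition is_succ :: "'v \<Rightarrow> 'v \<Rightarrow> bool" where
  "is_succ s x \<longleftrightarrow> (\<forall>z. z \<^bold>\<in> s \<longleftrightarrow> z \<^bold>\<in> x \<or> z = x)"

definition is_inductive :: "'v \<Rightarrow> bool" where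
  "is_inductive I \<longleftrightarrow>
     (\<exists>x. is_empty x \<and> x \<^bold>\<in> I) \<and>
     (\<forall>x. x \<^bold>\<in> I \<longrightarrow> (\<exists>s. is_succ s x \<and> s \<^bold>\<in> I))"

text \<open>The von Neumann natural numbers of the model, that is, the elements of its \<open>\<omega>\<close>.\<close>

definition natural :: "'v \<Rightarrow> bool" where
  "natural n \<longleftrightarrow> (\<forall>I. is_inductive I \<longrightarrow> n \<^bold>\<in> I)"

definition is_upair :: "'v \<Rightarrow> 'v \<Rightarrow> 'v \<Rightarrow> bool" where
  "is_upair u x y \<longleftrightarrow> (\<forall>z. z \<^bold>\<in> u \<longleftrightarrow> z = x \<or> z = y)"

text \<open>\<open>p\<close> is the Kuratowski pair \<open>{{x}, {x, y}}\<close>.\<close>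

definition is_pair :: "'v \<Rightarrow> 'v \<Rightarrow> 'v \<Rightarrow> bool" where
  "is_pair p x y \<longleftrightarrow> (\<forall>z. z \<^bold>\<in> p \<longleftrightarrow> is_upair z x x \<or> is_upair z x y)"

definition related :: "'v \<Rightarrow> 'v \<Rightarrow> 'v \<Rightarrow> bool" where
  "related r x y \<longleftrightarrow> (\<exists>p. is_pair p x y \<and> p \<^bold>\<in> r)"

definition relation_between :: "'v \<Rightarrow> 'v \<Rightarrow> 'v \<Rightarrow> bool" where
  "relation_between r X Y \<longleftrightarrow>
     (\<forall>p. p \<^bold>\<in> r \<longrightarrow> (\<exists>x y. x \<^bold>\<in> X \<and> y \<^bold>\<in> Y \<and> is_pair p x y))"

definition is_function :: "'v \<Rightarrow> 'v \<Rightarrow> 'v \<Rightarrow> bool" where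
  "is_function f X Y \<longleftrightarrow>
     relation_between f X Y \<and> (\<forall>x. x \<^bold>\<in> X \<longrightarrow> (\<exists>!y. related f x y))"

definition injection :: "'v \<Rightarrow> 'v \<Rightarrow> 'v \<Rightarrow> bool" where
  "injection f X Y \<longleftrightarrow>
     is_function f X Y \<and> (\<forall>x x' y. related f x y \<and> related f x' y \<longrightarrow> x = x')"

definition bijection :: "'v \<Rightarrow> 'v \<Rightarrow> 'v \<Rightarrow> bool" where
  "bijection f X Y \<longleftrightarrow>
     injection f X Y \<and> (\<forall>y. y \<^bold>\<in> Y \<longrightarrow> (\<exists>x. related f x y))"

definition card_le :: "'v \<Rightarrow> 'v \<Rightarrow> bool" where
  "card_le X Y \<longleftrightarrow> (\<exists>f. injection f X Y)"

definition card_eq :: "'v \<Rightarrow> 'v \<Rightarrow> bool" where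
  "card_eq X Y \<longleftrightarrow> (\<exists>f. bijection f X Y)"

definition card_less :: "'v \<Rightarrow> 'v \<Rightarrow> bool" where
  "card_less X Y \<longleftrightarrow> card_le X Y \<and> \<not> card_eq X Y"

definition finite_set :: "'v \<Rightarrow> bool" where
  "finite_set X \<longleftrightarrow> (\<exists>n. natural n \<and> card_eq X n)"

definition linear_order :: "'v \<Rightarrow> 'v \<Rightarrow> bool" where
  "linear_order R A \<longleftrightarrow>
     relation_between R A A \<and>
     (\<forall>x. x \<^bold>\<in> A \<longrightarrow> related R x x) \<and>
     (\<forall>x y. related R x y \<and> related R y x \<longrightarrow> x = y) \<and>
     (\<forall>x y z. related R x y \<and> related R y z \<longrightarrow> related R x z) \<and>
     (\<forall>x y. x \<^bold>\<in> A \<and> y \<^bold>\<in> A \<longrightarrow> related R x y \<or> related R y x)"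

definition partition :: "'v \<Rightarrow> 'v \<Rightarrow> bool" where
  "partition P A \<longleftrightarrow>
     (\<forall>b. b \<^bold>\<in> P \<longrightarrow> \<not> is_empty b \<and> subset b A) \<and>
     (\<forall>b c x. b \<^bold>\<in> P \<and> c \<^bold>\<in> P \<and> x \<^bold>\<in> b \<and> x \<^bold>\<in> c \<longrightarrow> b = c) \<and>
     (\<forall>x. x \<^bold>\<in> A \<longrightarrow> (\<exists>b. b \<^bold>\<in> P \<and> x \<^bold>\<in> b))"

definition is_Part_fin :: "'v \<Rightarrow> 'v \<Rightarrow> bool" where
  "is_Part_fin Q A \<longleftrightarrow>
     (\<forall>P. P \<^bold>\<in> Q \<longleftrightarrow> partition P A \<and> (\<forall>b. b \<^bold>\<in> P \<longrightarrow> finite_set b))"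

text \<open>\<open>D\<close> is the set of non-fixed points of the permutation \<open>f\<close> of \<open>A\<close>.\<close>

definition is_moved :: "'v \<Rightarrow> 'v \<Rightarrow> 'v \<Rightarrow> bool" where
  "is_moved D f A \<longleftrightarrow>
     (\<forall>x. x \<^bold>\<in> D \<longleftrightarrow> x \<^bold>\<in> A \<and> (\<exists>y. related f x y \<and> y \<noteq> x))"

text \<open>
  \<open>S\<close> is \<open>S\<^sub>\<le>\<^sub>n(A)\<close>. Having at most \<open>n\<close> elements means having an injection into the von Neumann
  numeral \<open>n\<close>.
\<close>

definition is_S_le :: "'v \<Rightarrow> 'v \<Rightarrow> 'v \<Rightarrow> bool" where
  "is_S_le S n A \<longleftrightarrow>
     (\<forall>f. f \<^bold>\<in> S \<longleftrightarrow> bijection f A A \<and> (\<exists>D. is_moved D f A \<and> card_le D n))"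

end

locale ZF_model = set_language mem
  for mem :: "'v \<Rightarrow> 'v \<Rightarrow> bool"  (infix \<open>\<^bold>\<in>\<close> 50) +
  assumes extensionality: "(\<forall>z. z \<^bold>\<in> x \<longleftrightarrow> z \<^bold>\<in> y) \<Longrightarrow> x = y"
    and foundation: "\<not> is_empty x \<Longrightarrow> \<exists>y. y \<^bold>\<in> x \<and> \<not> (\<exists>z. z \<^bold>\<in> x \<and> z \<^bold>\<in> y)"
    and pairing: "\<exists>u. is_upair u x y"
    and union: "\<exists>U. \<forall>z. z \<^bold>\<in> U \<longleftrightarrow> (\<exists>y. y \<^bold>\<in> x \<and> z \<^bold>\<in> y)"
    and power_set: "\<exists>P. \<forall>z. z \<^bold>\<in> P \<longleftrightarrow> subset z x"
    and infinity: "\<exists>I. is_inductive I"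
    and separation: "\<exists>Y. \<forall>x. x \<^bold>\<in> Y \<longleftrightarrow> x \<^bold>\<in> X \<and> sat (e(0 := x)) \<phi>"
    and replacement:
      "(\<forall>x y y'. x \<^bold>\<in> X \<and> sat (e(0 := x, 1 := y)) \<phi> \<and> sat (e(0 := x, 1 := y')) \<phi> \<longrightarrow> y = y')
       \<Longrightarrow> \<exists>Y. \<forall>y. y \<^bold>\<in> Y \<longleftrightarrow> (\<exists>x. x \<^bold>\<in> X \<and> sat (e(0 := x, 1 := y)) \<phi>)"

end

theory Submission
  imports Defs
begin

text \<open>
  A permutation \<open>f\<close> with support \<open>D\<close> is determined by \<open>D\<close> and by its pattern, the relation it
  induces on the ranks of the elements of \<open>D\<close> in the linear order. Both are recorded in a finitary
  partition with two nontrivial blocks: the symmetric difference of \<open>D\<close> and a fixed finite marker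
  set, and a pair of points, disjoint from \<open>D\<close> and the marker, that names the pattern. This injection
  is not surjective.

  A bijection would yield, by transfinite recursion, an injection of all ordinals into \<open>A\<close>. Suppose
  the values below \<open>\<alpha>\<close> form the set \<open>W\<close>. If \<open>\<alpha>\<close> is finite, then by pigeonhole the nonsurjective
  injection of the permutations into themselves leads out of the finitely many permutations supported
  in \<open>W\<close>. If \<open>\<alpha>\<close> is infinite, then the permutations supported in \<open>W\<close> embed into \<open>\<alpha>\<close>, while the
  subsets of \<open>\<alpha>\<close> embed into the finitary partitions, so Cantor's diagonal argument exhibits a
  permutation that is not supported in \<open>W\<close>. Either way finitely many points outside \<open>W\<close> arise, and
  the least of them is the next value. No choice is involved, provided that the finite subsets of
  infinite ordinals \<open>\<alpha>\<close> are embedded into \<open>\<alpha>\<close> by injections that are uniform in \<open>\<alpha>\<close>.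
\<close>

section \<open>Definability\<close>

text \<open>Separation, replacement, induction and recursion inside the model apply to formulas
  only. Whatever enters them must be definable with parameters, so every operation is a total term
  built from definite descriptions, and mere existence of an object at each stage is not enough. The
  order serves twice. Ranks make a finite support rigid, so finitely many patterns describe all
  permutations on it. Least elements turn a nonempty finite set of new points into a single one;
  this is why the search for new points goes through permutations, which move at most
  \<open>n\<close> points, and not through partitions, which may have infinitely many nontrivial
  blocks. For a single infinite \<alpha> an injection of its finite subsets into it is easy to find,
  but a recursion along all ordinals would have to select one at every stage. The remedy is to use
  the canonical well-order of finite sets of ordinals where it has type \<alpha> already, and to
  reduce any other \<alpha> to a smaller infinite ordinal. An injection of all ordinals into a set
  is absurd by replacement along its inverse.\<close>

named_theorems dfn

primrec rename :: "(nat \<Rightarrow> nat) \<Rightarrow> fm \<Rightarrow> fm" where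
  "rename r (Mem i j) = Mem (r i) (r j)"
| "rename r (Eql i j) = Eql (r i) (r j)"
| "rename r (Neg p) = Neg (rename r p)"
| "rename r (And p q) = And (rename r p) (rename r q)"
| "rename r (All i p) = All (r i) (rename r p)"

definition interleave :: "(nat \<Rightarrow> 'v) \<Rightarrow> (nat \<Rightarrow> 'v) \<Rightarrow> nat \<Rightarrow> 'v" where
  "interleave e c i = (if even i then e (i div 2) else c (i div 2))"

lemma interleave_simps [simp]:
  "interleave e c (2 * i) = e i" "interleave e c (Suc (2 * i)) = c i"
  "interleave e c 0 = e 0"
  by (auto simp: interleave_def)

lemma interleave_eqI:
  assumes "\<And>i. g (2 * i) = e i" "\<And>i. g (Suc (2 * i)) = c i"
  shows "g = interleave e c"
proof
  fix i show "g i = interleave e c i"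
    using assms by (cases "even i") (auto elim!: evenE oddE)
qed

context set_language
begin

text \<open>Bound variables are renamed together with the free ones, so injectivity of
  \<open>r\<close> suffices: it keeps the update at \<open>r i\<close> from disturbing another
  renamed variable.\<close>

lemma sat_rename: "inj r \<Longrightarrow> sat e (rename r p) = sat (e \<circ> r) p"
proof (induction p arbitrary: e)
  case (All i p)
  have *: "(e(r i := x)) \<circ> r = (e \<circ> r)(i := x)" for x
    using All.prems by (auto simp: fun_eq_iff inj_eq)
  show ?case using All by (simp only: sat.simps rename.simps *)
qed auto

text \<open>
  A predicate on environments is definable if it is given by a formula; the formula reads the
  environment at the even variables and its finitely many parameters at the odd ones.
\<close>

definition dfn :: "((nat \<Rightarrow> 'v) \<Rightarrow> bool) \<Rightarrow> bool" where
  "dfn P \<longleftrightarrow> (\<exists>\<phi> c. \<forall>e. P e = sat (interleave e c) \<phi>)"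

text \<open>The language has no function symbols, so a term counts as definable when its graph is.
  Entry 0 is reserved for the value and the arguments move up by one.\<close>

definition trm :: "((nat \<Rightarrow> 'v) \<Rightarrow> 'v) \<Rightarrow> bool" where
  "trm f \<longleftrightarrow> dfn (\<lambda>e. e 0 = f (\<lambda>i. e (Suc i)))"

lemma dfn_const [dfn]: "dfn (\<lambda>e. Q)"
proof (cases Q)
  case True
  have "\<forall>e. Q = sat (interleave e c) (Eql 0 0)" for c :: "nat \<Rightarrow> 'v" using True by simp
  then show ?thesis unfolding dfn_def by blast
next
  case False
  have "\<forall>e. Q = sat (interleave e c) (Neg (Eql 0 0))" for c :: "nat \<Rightarrow> 'v" using False by simp
  then show ?thesis unfolding dfn_def by blast
qed

lemma dfn_not [dfn]: "dfn P \<Longrightarrow> dfn (\<lambda>e. \<not> P e)"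
  unfolding dfn_def by (metis sat.simps(3))

lemma dfn_and [dfn]:
  assumes "dfn P" "dfn Q"
  shows "dfn (\<lambda>e. P e \<and> Q e)"
proof -
  obtain p c q d where p: "\<And>e. P e = sat (interleave e c) p" and q: "\<And>e. Q e = sat (interleave e d) q"
    using assms unfolding dfn_def by blast
  \<comment> \<open>Even variables stay. The k-th parameter of \<open>p\<close> goes to slot 2k and
    that of \<open>q\<close> to slot 2k + 1 of the merged list
    \<open>interleave c d\<close>.\<close>
  define r1 :: "nat \<Rightarrow> nat" where "r1 i = (if even i then i else 2 * i - 1)" for i
  define r2 :: "nat \<Rightarrow> nat" where "r2 i = (if even i then i else 2 * i + 1)" for i
  have inj: "inj r1" "inj r2"
    by (rule injI, auto simp: r1_def split: if_splits; presburger)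
       (rule injI, auto simp: r2_def split: if_splits; presburger)
  have "interleave e (interleave c d) \<circ> r1 = interleave e c" for e
    by (rule interleave_eqI) (auto simp: r1_def interleave_def)
  moreover have "interleave e (interleave c d) \<circ> r2 = interleave e d" for e
    by (rule interleave_eqI) (auto simp: r2_def interleave_def)
  ultimately have "\<forall>e. (P e \<and> Q e) = sat (interleave e (interleave c d)) (And (rename r1 p) (rename r2 q))"
    using inj by (simp add: sat_rename p q)
  then show ?thesis unfolding dfn_def by blast
qed

lemma dfn_reindex:
  assumes "dfn P" "inj r"
  shows "dfn (\<lambda>e. P (\<lambda>i. e (r i)))"
proof -
  obtain p c where p: "\<And>e. P e = sat (interleave e c) p"
    using assms unfolding dfn_def by blast
  define s where "s i = (if even i then 2 * r (i div 2) else i)" for i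
  have "inj s"
    using assms(2) by (auto intro!: injI simp: s_def inj_eq split: if_splits elim!: evenE; presburger)
  moreover have "interleave e c \<circ> s = interleave (\<lambda>i. e (r i)) c" for e
    by (rule interleave_eqI) (auto simp: s_def)
  ultimately have "\<forall>e. P (\<lambda>i. e (r i)) = sat (interleave e c) (rename s p)"
    by (simp add: sat_rename p)
  then show ?thesis unfolding dfn_def by blast
qed

text \<open>Under a quantifier the bound variable becomes entry 0 of the environment.\<close>

lemma dfn_all [dfn]:
  assumes "dfn (\<lambda>e. P (e 0) (\<lambda>i. e (Suc i)))"
  shows "dfn (\<lambda>e. \<forall>x. P x e)"
proof -
  obtain p c where p: "\<And>e. P (e 0) (\<lambda>i. e (Suc i)) = sat (interleave e c) p"
    using assms unfolding dfn_def by blast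
  \<comment> \<open>Variable 0, the entry to be bound, becomes variable 1; the other entries move
    down to close the gap and the parameters move up past variable 1. The dummy head of
    \<open>d\<close> sits there and is overwritten by the quantifier.\<close>
  define s :: "nat \<Rightarrow> nat" where "s i = (if i = 0 then 1 else if even i then i - 2 else i + 2)" for i
  have inj: "inj s"
    by (rule injI, auto simp: s_def split: if_splits; presburger)
  define d where "d = case_nat undefined c"
  have "(interleave e d)(1 := x) \<circ> s = interleave (case_nat x e) c" for e x
  proof (rule interleave_eqI)
    fix i
    show "((interleave e d)(1 := x) \<circ> s) (2 * i) = case_nat x e i"
      by (cases i) (auto simp: s_def)
    show "((interleave e d)(1 := x) \<circ> s) (Suc (2 * i)) = c i"
      by (auto simp: s_def d_def interleave_def)
  qed
  then have "(\<forall>x. P x e) = sat (interleave e d) (All 1 (rename s p))" for e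
    using p[of "case_nat x e" for x] inj by (simp add: sat_rename)
  then show ?thesis unfolding dfn_def by blast
qed

lemma dfn_imp [dfn]: "dfn P \<Longrightarrow> dfn Q \<Longrightarrow> dfn (\<lambda>e. P e \<longrightarrow> Q e)"
  using dfn_not[OF dfn_and[of P "\<lambda>e. \<not> Q e"]] dfn_not[of Q] by simp

lemma dfn_or [dfn]: "dfn P \<Longrightarrow> dfn Q \<Longrightarrow> dfn (\<lambda>e. P e \<or> Q e)"
  using dfn_imp[of "\<lambda>e. \<not> P e" Q] dfn_not[of P] by (simp add: disj_imp)

lemma dfn_iff [dfn]: "dfn P \<Longrightarrow> dfn Q \<Longrightarrow> dfn (\<lambda>e. P e \<longleftrightarrow> Q e)"
  using dfn_and[OF dfn_imp[of P Q] dfn_imp[of Q P]] by (simp add: iff_conv_conj_imp)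

lemma dfn_ex [dfn]: "dfn (\<lambda>e. P (e 0) (\<lambda>i. e (Suc i))) \<Longrightarrow> dfn (\<lambda>e. \<exists>x. P x e)"
  using dfn_not[OF dfn_all[of "\<lambda>x e. \<not> P x e"]] dfn_not by simp

lemma trm_var [dfn]: "trm (\<lambda>e. e i)"
proof -
  have "\<forall>e. (e 0 = e (Suc i)) = sat (interleave e c) (Eql 0 (2 * Suc i))" for c :: "nat \<Rightarrow> 'v"
    by (auto simp del: mult_Suc_right)
  then show ?thesis unfolding trm_def dfn_def by blast
qed

lemma trm_const [dfn]: "trm (\<lambda>e. c)"
proof -
  have "\<forall>e. (e 0 = c) = sat (interleave e (\<lambda>i. c)) (Eql 0 (Suc (2 * 0)))"
    by (auto simp: interleave_def)
  then show ?thesis unfolding trm_def dfn_def by blast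
qed

lemma trm_shift: "trm s \<Longrightarrow> trm (\<lambda>e. s (\<lambda>i. e (Suc i)))"
  unfolding trm_def
  using dfn_reindex[of "\<lambda>e. e 0 = s (\<lambda>i. e (Suc i))" "\<lambda>i. if i = 0 then 0 else Suc i"]
  by (auto simp: inj_def)

text \<open>The term is eliminated by an existential quantifier that names its value.\<close>

lemma dfn_sub:
  assumes "dfn (\<lambda>e. P (e 0) (\<lambda>i. e (Suc i)))" "trm s"
  shows "dfn (\<lambda>e. P (s e) e)"
proof -
  have "dfn (\<lambda>e. \<exists>x. x = s e \<and> P x e)"
    using assms unfolding trm_def by (intro dfn_ex dfn_and)
  then show ?thesis by simp
qed

text \<open>\<open>dfn1\<close> to \<open>dfn4\<close> and \<open>trm1\<close> to
  \<open>trm3\<close> reduce definability at arbitrary terms to definability at variables, so that a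
  new notion is unfolded only once.\<close>

lemma dfn1: "dfn (\<lambda>e. P (e 0)) \<Longrightarrow> trm s \<Longrightarrow> dfn (\<lambda>e. P (s e))"
  by (rule dfn_sub)

text \<open>Substituting the terms one after the other leaves the first argument in the highest
  entry, hence the reversal of the entries, here and for more arguments.\<close>

lemma dfn2:
  assumes "dfn (\<lambda>e. P (e 0) (e 1))" "trm s" "trm t"
  shows "dfn (\<lambda>e. P (s e) (t e))"
proof (rule dfn_sub[OF _ \<open>trm s\<close>], rule dfn_sub[OF _ trm_shift[OF \<open>trm t\<close>]])
  show "dfn (\<lambda>e. P (e (Suc 0)) (e 0))"
    using dfn_reindex[OF assms(1), of "\<lambda>i. if i = 0 then 1 else if i = 1 then 0 else i"]
    by (auto simp: inj_def split: if_splits)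
qed

lemma dfn3:
  assumes "dfn (\<lambda>e. P (e 0) (e 1) (e 2))" "trm s" "trm t" "trm u"
  shows "dfn (\<lambda>e. P (s e) (t e) (u e))"
proof (rule dfn_sub[OF _ \<open>trm s\<close>], rule dfn_sub[OF _ trm_shift[OF \<open>trm t\<close>]],
    rule dfn_sub[OF _ trm_shift[OF trm_shift[OF \<open>trm u\<close>]]])
  show "dfn (\<lambda>e. P (e (Suc (Suc 0))) (e (Suc 0)) (e 0))"
    using dfn_reindex[OF assms(1), of "\<lambda>i. if i = 0 then 2 else if i = 2 then 0 else i"]
    by (simp add: inj_def numeral_2_eq_2)
qed

lemma dfn4:
  assumes "dfn (\<lambda>e. P (e 0) (e 1) (e 2) (e 3))" "trm s" "trm t" "trm u" "trm v"
  shows "dfn (\<lambda>e. P (s e) (t e) (u e) (v e))"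
proof (rule dfn_sub[OF _ \<open>trm s\<close>], rule dfn_sub[OF _ trm_shift[OF \<open>trm t\<close>]],
    rule dfn_sub[OF _ trm_shift[OF trm_shift[OF \<open>trm u\<close>]]],
    rule dfn_sub[OF _ trm_shift[OF trm_shift[OF trm_shift[OF \<open>trm v\<close>]]]])
  have inj: "inj (\<lambda>i::nat. if i \<le> 3 then 3 - i else i)"
    by (auto simp: inj_def)
  show "dfn (\<lambda>e. P (e (Suc (Suc (Suc 0)))) (e (Suc (Suc 0))) (e (Suc 0)) (e 0))"
    using dfn_reindex[OF assms(1) inj] by (simp add: numeral_2_eq_2 numeral_3_eq_3)
qed

lemma trm1:
  assumes "trm (\<lambda>e. F (e 0))" "trm s"
  shows "trm (\<lambda>e. F (s e))"
  unfolding trm_def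
proof (rule dfn2[OF _ trm_var trm_shift[OF assms(2)]])
  show "dfn (\<lambda>e. e 0 = F (e 1))" using assms(1) by (simp add: trm_def)
qed

lemma trm2:
  assumes "trm (\<lambda>e. F (e 0) (e 1))" "trm s" "trm t"
  shows "trm (\<lambda>e. F (s e) (t e))"
  unfolding trm_def
proof (rule dfn3[OF _ trm_var trm_shift[OF assms(2)] trm_shift[OF assms(3)]])
  show "dfn (\<lambda>e. e 0 = F (e 1) (e 2))" using assms(1) by (simp add: trm_def numeral_2_eq_2)
qed

lemma trm3:
  assumes "trm (\<lambda>e. F (e 0) (e 1) (e 2))" "trm s" "trm t" "trm u"
  shows "trm (\<lambda>e. F (s e) (t e) (u e))"
  unfolding trm_def
proof (rule dfn4[OF _ trm_var trm_shift[OF assms(2)] trm_shift[OF assms(3)] trm_shift[OF assms(4)]])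
  show "dfn (\<lambda>e. e 0 = F (e 1) (e 2) (e 3))"
    using assms(1) by (simp add: trm_def numeral_2_eq_2 numeral_3_eq_3)
qed

lemma dfn_eq [dfn]: "trm s \<Longrightarrow> trm t \<Longrightarrow> dfn (\<lambda>e. s e = t e)"
proof (rule dfn2)
  have "dfn (\<lambda>e. e 0 = e (Suc 0))" using trm_var[of 0] unfolding trm_def .
  then show "dfn (\<lambda>e. e 0 = e 1)" by simp
qed

lemma dfn_mem [dfn]: "trm s \<Longrightarrow> trm t \<Longrightarrow> dfn (\<lambda>e. s e \<^bold>\<in> t e)"
proof (rule dfn2)
  have "\<forall>e. (e 0 \<^bold>\<in> e 1) = sat (interleave e c) (Mem 0 2)" for c :: "nat \<Rightarrow> 'v"
    by (simp add: interleave_def)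
  then show "dfn (\<lambda>e. e 0 \<^bold>\<in> e 1)" unfolding dfn_def by blast
qed

text \<open>One binder further in, entry 1 belongs to the outer bound variable and has to be
  skipped.\<close>

lemma dfn_shift2: 
  "dfn (\<lambda>e. P (e 0) (\<lambda>i. e (Suc i))) \<Longrightarrow> dfn (\<lambda>e. P (e 0) (\<lambda>i. e (Suc (Suc i))))"
  using dfn_reindex[of "\<lambda>e. P (e 0) (\<lambda>i. e (Suc i))" "\<lambda>i. if i = 0 then 0 else Suc i"]
  by (auto simp: inj_def)

lemma dfn_ex1 [dfn]:
  assumes "dfn (\<lambda>e. P (e 0) (\<lambda>i. e (Suc i)))"
  shows "dfn (\<lambda>e. \<exists>!x. P x e)"
  unfolding Ex1_def by (intro dfn assms dfn_shift2[OF assms])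

text \<open>\<open>THE\<close> with a fixed default value, so that it preserves definability.\<close>

definition the_v :: "('v \<Rightarrow> bool) \<Rightarrow> 'v" where
  "the_v P = (if \<exists>!x. P x then THE x. P x else undefined)"

lemma the_v_eq: "P x \<Longrightarrow> (\<And>y. P y \<Longrightarrow> y = x) \<Longrightarrow> the_v P = x"
  unfolding the_v_def by (metis the_equality)

lemma the_vI: "\<exists>!x. P x \<Longrightarrow> P (the_v P)"
  unfolding the_v_def by (auto intro: theI')

lemma trm_the [dfn]:
  assumes "dfn (\<lambda>e. P (e 0) (\<lambda>i. e (Suc i)))"
  shows "trm (\<lambda>e. the_v (\<lambda>x. P x e))"
proof -
  have "(z = the_v (\<lambda>x. P x e)) \<longleftrightarrow> (\<exists>!x. P x e) \<and> P z e \<or> \<not> (\<exists>!x. P x e) \<and> z = undefined" for z e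
    using the_vI[of "\<lambda>x. P x e"] by (auto simp: the_v_def)
  then show ?thesis unfolding trm_def
    by (simp only:) (intro dfn assms dfn_shift2[OF assms])
qed

lemma trm_if [dfn]:
  assumes "dfn P" "trm s" "trm t"
  shows "trm (\<lambda>e. if P e then s e else t e)"
proof -
  have "dfn (\<lambda>e. P (\<lambda>i. e (Suc i)))"
    using dfn_reindex[OF assms(1), of Suc] by simp
  then have "dfn (\<lambda>e. P (\<lambda>i. e (Suc i)) \<and> e 0 = s (\<lambda>i. e (Suc i)) \<or> \<not> P (\<lambda>i. e (Suc i)) \<and> e 0 = t (\<lambda>i. e (Suc i)))"
    using assms(2,3)[unfolded trm_def] by (intro dfn_or dfn_and dfn_not)
  then show ?thesis unfolding trm_def by (rule back_subst[of dfn]) auto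
qed

text \<open>Class abstraction as a total function: a class that is not a set yields a fixed default.
  Set operations can thus be shown definable without any axiom, before their existence is
  proved.\<close>

definition coll :: "('v \<Rightarrow> bool) \<Rightarrow> 'v" where
  "coll P = the_v (\<lambda>Y. \<forall>x. x \<^bold>\<in> Y \<longleftrightarrow> P x)"

lemma trm_coll [dfn]:
  assumes "dfn (\<lambda>e. P (e 0) (\<lambda>i. e (Suc i)))"
  shows "trm (\<lambda>e. coll (\<lambda>x. P x e))"
  unfolding coll_def by (intro dfn dfn_shift2[OF assms])

end

context ZF_model
begin

lemma mem_coll_gen:
  assumes "\<exists>Y. \<forall>x. x \<^bold>\<in> Y \<longleftrightarrow> P x"
  shows "x \<^bold>\<in> coll P \<longleftrightarrow> P x"
proof -
  have "\<exists>!Y. \<forall>x. x \<^bold>\<in> Y \<longleftrightarrow> P x"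
    using assms by (metis extensionality)
  from the_vI[OF this] show ?thesis unfolding coll_def by blast
qed

lemma mem_coll:
  assumes "dfn (\<lambda>e. P (e 0))" "\<And>x. P x \<Longrightarrow> x \<^bold>\<in> B"
  shows "x \<^bold>\<in> coll P \<longleftrightarrow> P x"
proof (rule mem_coll_gen)
  obtain p c where p: "\<And>e. P (e 0) = sat (interleave e c) p"
    using assms(1) unfolding dfn_def by blast
  obtain Y where Y: "\<forall>x. x \<^bold>\<in> Y \<longleftrightarrow> x \<^bold>\<in> B \<and> sat ((interleave (\<lambda>i. undefined) c)(0 := x)) p"
    using separation by blast
  have "(interleave (\<lambda>i. undefined) c)(0 := x) = interleave (\<lambda>i. if i = 0 then x else undefined) c" for x
    by (rule interleave_eqI) auto
  then have "\<forall>x. x \<^bold>\<in> Y \<longleftrightarrow> P x"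
    using Y assms(2) p[of "\<lambda>i. if i = 0 then x else undefined" for x] by auto
  then show "\<exists>Y. \<forall>x. x \<^bold>\<in> Y \<longleftrightarrow> P x" by blast
qed

lemma repl_ex:
  assumes "trm (\<lambda>e. F (e 0))"
  shows "\<exists>Y. \<forall>y. y \<^bold>\<in> Y \<longleftrightarrow> (\<exists>x. x \<^bold>\<in> X \<and> y = F x)"
proof -
  have "dfn (\<lambda>e. e 1 = F (e 0))" by (intro dfn trm1[OF assms])
  then obtain p c where p: "\<And>e. (e 1 = F (e 0)) = sat (interleave e c) p"
    unfolding dfn_def by blast
  \<comment> \<open>Entry 1 of an environment sits at variable 2, whereas \<open>replacement\<close>
    expects the value at variable 1; \<open>r\<close> exchanges the two.\<close>
  define r where "r i = (if i = 1 then 2 else if i = 2 then 1 else i)" for i :: nat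
  have r: "inj r" by (auto simp: inj_def r_def)
  define g where "g = interleave (\<lambda>i. undefined) c \<circ> r"
  have "g(0 := x, 1 := y) \<circ> r = interleave (\<lambda>i. if i = 0 then x else if i = 1 then y else undefined) c" for x y
    by (rule interleave_eqI; auto simp: g_def r_def interleave_def; presburger)
  then have *: "sat (g(0 := x, 1 := y)) (rename r p) \<longleftrightarrow> y = F x" for x y
    using p[of "\<lambda>i. if i = 0 then x else if i = 1 then y else undefined"] by (simp add: sat_rename r)
  show ?thesis using replacement[of X g "rename r p"] unfolding * by auto
qed

end

section \<open>Sets and ordinals in a model of ZF\<close>

context set_language
begin

lemma trm_reindex:
  assumes "trm f" "inj r"
  shows "trm (\<lambda>e. f (\<lambda>i. e (r i)))"
proof -
  have "inj (case_nat 0 (\<lambda>i. Suc (r i)))"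
    using assms(2) by (auto intro!: injI simp: inj_eq split: nat.splits)
  from dfn_reindex[OF assms(1)[unfolded trm_def] this] show ?thesis
    unfolding trm_def by simp
qed

lemma trm_shift2:
  "trm (\<lambda>e. F (e 0) (\<lambda>i. e (Suc i))) \<Longrightarrow> trm (\<lambda>e. F (e 0) (\<lambda>i. e (Suc (Suc i))))"
  using trm_reindex[of "\<lambda>e. F (e 0) (\<lambda>i. e (Suc i))" "\<lambda>i. if i = 0 then 0 else Suc i"]
  by (simp add: inj_def)

lemma dfn_subset [dfn]: "trm s \<Longrightarrow> trm t \<Longrightarrow> dfn (\<lambda>e. subset (s e) (t e))"
  by (rule dfn2) (unfold subset_def, intro dfn)

lemma dfn_is_empty [dfn]: "trm s \<Longrightarrow> dfn (\<lambda>e. is_empty (s e))"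
  by (rule dfn1) (unfold is_empty_def, intro dfn)

lemma dfn_is_succ [dfn]: "trm s \<Longrightarrow> trm t \<Longrightarrow> dfn (\<lambda>e. is_succ (s e) (t e))"
  by (rule dfn2) (unfold is_succ_def, intro dfn)

lemma dfn_is_inductive [dfn]: "trm s \<Longrightarrow> dfn (\<lambda>e. is_inductive (s e))"
  by (rule dfn1) (unfold is_inductive_def, intro dfn)

lemma dfn_natural [dfn]: "trm s \<Longrightarrow> dfn (\<lambda>e. natural (s e))"
  by (rule dfn1) (unfold natural_def, intro dfn)

lemma dfn_is_upair [dfn]: "trm s \<Longrightarrow> trm t \<Longrightarrow> trm u \<Longrightarrow> dfn (\<lambda>e. is_upair (s e) (t e) (u e))"
  by (rule dfn3) (unfold is_upair_def, intro dfn)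

lemma dfn_is_pair [dfn]: "trm s \<Longrightarrow> trm t \<Longrightarrow> trm u \<Longrightarrow> dfn (\<lambda>e. is_pair (s e) (t e) (u e))"
  by (rule dfn3) (unfold is_pair_def, intro dfn)

lemma dfn_related [dfn]: "trm s \<Longrightarrow> trm t \<Longrightarrow> trm u \<Longrightarrow> dfn (\<lambda>e. related (s e) (t e) (u e))"
  by (rule dfn3) (unfold related_def, intro dfn)

lemma dfn_relation_between [dfn]:
  "trm s \<Longrightarrow> trm t \<Longrightarrow> trm u \<Longrightarrow> dfn (\<lambda>e. relation_between (s e) (t e) (u e))"
  by (rule dfn3) (unfold relation_between_def, intro dfn)

lemma dfn_is_function [dfn]:
  "trm s \<Longrightarrow> trm t \<Longrightarrow> trm u \<Longrightarrow> dfn (\<lambda>e. is_function (s e) (t e) (u e))"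
  by (rule dfn3) (unfold is_function_def, intro dfn)

lemma dfn_injection [dfn]:
  "trm s \<Longrightarrow> trm t \<Longrightarrow> trm u \<Longrightarrow> dfn (\<lambda>e. injection (s e) (t e) (u e))"
  by (rule dfn3) (unfold injection_def, intro dfn)

lemma dfn_bijection [dfn]:
  "trm s \<Longrightarrow> trm t \<Longrightarrow> trm u \<Longrightarrow> dfn (\<lambda>e. bijection (s e) (t e) (u e))"
  by (rule dfn3) (unfold bijection_def, intro dfn)

lemma dfn_card_le [dfn]: "trm s \<Longrightarrow> trm t \<Longrightarrow> dfn (\<lambda>e. card_le (s e) (t e))"
  by (rule dfn2) (unfold card_le_def, intro dfn)

lemma dfn_card_eq [dfn]: "trm s \<Longrightarrow> trm t \<Longrightarrow> dfn (\<lambda>e. card_eq (s e) (t e))"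
  by (rule dfn2) (unfold card_eq_def, intro dfn)

lemma dfn_finite_set [dfn]: "trm s \<Longrightarrow> dfn (\<lambda>e. finite_set (s e))"
  by (rule dfn1) (unfold finite_set_def, intro dfn)

lemma dfn_partition [dfn]: "trm s \<Longrightarrow> trm t \<Longrightarrow> dfn (\<lambda>e. partition (s e) (t e))"
  by (rule dfn2) (unfold partition_def, intro dfn)

section \<open>Set operations as definable terms\<close>

definition emp :: 'v where "emp = coll (\<lambda>z. False)"
definition ins :: "'v \<Rightarrow> 'v \<Rightarrow> 'v" where "ins x X = coll (\<lambda>z. z = x \<or> z \<^bold>\<in> X)"
definition Uni :: "'v \<Rightarrow> 'v" where "Uni X = coll (\<lambda>z. \<exists>y. y \<^bold>\<in> X \<and> z \<^bold>\<in> y)"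
definition un :: "'v \<Rightarrow> 'v \<Rightarrow> 'v" where "un X Y = coll (\<lambda>z. z \<^bold>\<in> X \<or> z \<^bold>\<in> Y)"
definition diff :: "'v \<Rightarrow> 'v \<Rightarrow> 'v" where "diff X Y = coll (\<lambda>z. z \<^bold>\<in> X \<and> \<not> z \<^bold>\<in> Y)"
definition Pw :: "'v \<Rightarrow> 'v" where "Pw X = coll (\<lambda>z. subset z X)"
definition Sep :: "'v \<Rightarrow> ('v \<Rightarrow> bool) \<Rightarrow> 'v" where "Sep X P = coll (\<lambda>z. z \<^bold>\<in> X \<and> P z)"
definition Rep :: "'v \<Rightarrow> ('v \<Rightarrow> 'v) \<Rightarrow> 'v" where "Rep X F = coll (\<lambda>y. \<exists>x. x \<^bold>\<in> X \<and> y = F x)"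
definition pr :: "'v \<Rightarrow> 'v \<Rightarrow> 'v" where "pr x y = ins (ins x emp) (ins (ins x (ins y emp)) emp)"
definition Times :: "'v \<Rightarrow> 'v \<Rightarrow> 'v" where
  "Times X Y = coll (\<lambda>p. \<exists>x y. x \<^bold>\<in> X \<and> y \<^bold>\<in> Y \<and> p = pr x y)"
definition lam :: "'v \<Rightarrow> ('v \<Rightarrow> 'v) \<Rightarrow> 'v" where "lam X F = Rep X (\<lambda>x. pr x (F x))"
definition app :: "'v \<Rightarrow> 'v \<Rightarrow> 'v" where "app f x = the_v (\<lambda>y. pr x y \<^bold>\<in> f)"
definition suc :: "'v \<Rightarrow> 'v" where "suc x = ins x x"
definition omega :: 'v where "omega = coll natural"
definition trans :: "'v \<Rightarrow> bool" where "trans x \<longleftrightarrow> (\<forall>y z. y \<^bold>\<in> x \<and> z \<^bold>\<in> y \<longrightarrow> z \<^bold>\<in> x)"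
text \<open>Foundation makes a transitive set of transitive sets well-ordered by membership, so
  these are the von Neumann ordinals.\<close>

definition Ord :: "'v \<Rightarrow> bool" where "Ord x \<longleftrightarrow> trans x \<and> (\<forall>y. y \<^bold>\<in> x \<longrightarrow> trans y)"

lemma trm_ins [dfn]: "trm s \<Longrightarrow> trm t \<Longrightarrow> trm (\<lambda>e. ins (s e) (t e))"
  by (rule trm2) (unfold ins_def, intro dfn)
lemma trm_Uni [dfn]: "trm s \<Longrightarrow> trm (\<lambda>e. Uni (s e))"
  by (rule trm1) (unfold Uni_def, intro dfn)
lemma trm_un [dfn]: "trm s \<Longrightarrow> trm t \<Longrightarrow> trm (\<lambda>e. un (s e) (t e))"
  by (rule trm2) (unfold un_def, intro dfn)
lemma trm_diff [dfn]: "trm s \<Longrightarrow> trm t \<Longrightarrow> trm (\<lambda>e. diff (s e) (t e))"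
  by (rule trm2) (unfold diff_def, intro dfn)
lemma trm_Pw [dfn]: "trm s \<Longrightarrow> trm (\<lambda>e. Pw (s e))"
  by (rule trm1) (unfold Pw_def, intro dfn)
lemma trm_Sep [dfn]:
  assumes "trm X" "dfn (\<lambda>e. P (e 0) (\<lambda>i. e (Suc i)))"
  shows "trm (\<lambda>e. Sep (X e) (\<lambda>x. P x e))"
  unfolding Sep_def by (intro dfn trm_shift[OF assms(1)] assms(2))
lemma trm_Rep [dfn]:
  assumes "trm X" "trm (\<lambda>e. F (e 0) (\<lambda>i. e (Suc i)))"
  shows "trm (\<lambda>e. Rep (X e) (\<lambda>x. F x e))"
  unfolding Rep_def by (intro dfn trm_shift[OF trm_shift[OF assms(1)]] trm_shift2[OF assms(2)])
lemma trm_pr [dfn]: "trm s \<Longrightarrow> trm t \<Longrightarrow> trm (\<lambda>e. pr (s e) (t e))"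
  by (rule trm2) (unfold pr_def, intro dfn)
lemma trm_Times [dfn]: "trm s \<Longrightarrow> trm t \<Longrightarrow> trm (\<lambda>e. Times (s e) (t e))"
  by (rule trm2) (unfold Times_def, intro dfn)
lemma trm_lam [dfn]:
  assumes "trm X" "trm (\<lambda>e. F (e 0) (\<lambda>i. e (Suc i)))"
  shows "trm (\<lambda>e. lam (X e) (\<lambda>x. F x e))"
  unfolding lam_def by (intro dfn assms)
lemma trm_app [dfn]: "trm s \<Longrightarrow> trm t \<Longrightarrow> trm (\<lambda>e. app (s e) (t e))"
  by (rule trm2) (unfold app_def, intro dfn)
lemma trm_suc [dfn]: "trm s \<Longrightarrow> trm (\<lambda>e. suc (s e))"
  by (rule trm1) (unfold suc_def, intro dfn)
lemma dfn_Ord [dfn]: "trm s \<Longrightarrow> dfn (\<lambda>e. Ord (s e))"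
  by (rule dfn1) (unfold Ord_def trans_def, intro dfn)

end

context ZF_model
begin

section \<open>Set existence, pairs, functions and cardinal comparison\<close>

lemma ext: "(\<And>z. z \<^bold>\<in> x \<longleftrightarrow> z \<^bold>\<in> y) \<Longrightarrow> x = y"
  using extensionality by blast

lemma coll_bounded:
  assumes "dfn (\<lambda>e. P (e 0))" "\<exists>B. \<forall>x. P x \<longrightarrow> x \<^bold>\<in> B"
  shows "x \<^bold>\<in> coll P \<longleftrightarrow> P x"
  using assms mem_coll by blast

lemma mem_emp [simp]: "\<not> z \<^bold>\<in> emp"
  unfolding emp_def by (subst coll_bounded) (intro dfn, auto)

lemma mem_Uni [simp]: "z \<^bold>\<in> Uni X \<longleftrightarrow> (\<exists>y. y \<^bold>\<in> X \<and> z \<^bold>\<in> y)"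
  unfolding Uni_def by (rule mem_coll_gen) (rule union)

lemma upair_ex: "\<exists>u. \<forall>z. z \<^bold>\<in> u \<longleftrightarrow> z = x \<or> z = y"
  using pairing unfolding is_upair_def by blast

lemma union2_ex: "\<exists>B. \<forall>z. z \<^bold>\<in> X \<or> z \<^bold>\<in> Y \<longrightarrow> z \<^bold>\<in> B"
proof -
  obtain u where "\<forall>z. z \<^bold>\<in> u \<longleftrightarrow> z = X \<or> z = Y" using upair_ex by blast
  then show ?thesis using mem_Uni[of _ u] by blast
qed

lemma mem_un [simp]: "z \<^bold>\<in> un X Y \<longleftrightarrow> z \<^bold>\<in> X \<or> z \<^bold>\<in> Y"
  unfolding un_def by (rule coll_bounded) (intro dfn, rule union2_ex)

lemma mem_ins [simp]: "z \<^bold>\<in> ins x X \<longleftrightarrow> z = x \<or> z \<^bold>\<in> X"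
  unfolding ins_def
proof (rule coll_bounded, intro dfn)
  obtain u where "\<forall>z. z \<^bold>\<in> u \<longleftrightarrow> z = x \<or> z = x" using upair_ex by blast
  then show "\<exists>B. \<forall>z. z = x \<or> z \<^bold>\<in> X \<longrightarrow> z \<^bold>\<in> B" using union2_ex[of u X] by blast
qed

lemma mem_diff [simp]: "z \<^bold>\<in> diff X Y \<longleftrightarrow> z \<^bold>\<in> X \<and> \<not> z \<^bold>\<in> Y"
  unfolding diff_def by (rule coll_bounded) (intro dfn, blast)

lemma mem_Pw [simp]: "z \<^bold>\<in> Pw X \<longleftrightarrow> subset z X"
  unfolding Pw_def by (rule mem_coll_gen) (rule power_set)

lemma mem_Sep: "dfn (\<lambda>e. P (e 0)) \<Longrightarrow> z \<^bold>\<in> Sep X P \<longleftrightarrow> z \<^bold>\<in> X \<and> P z"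
  unfolding Sep_def by (rule coll_bounded) (intro dfn, assumption, blast)

lemma mem_Rep: "trm (\<lambda>e. F (e 0)) \<Longrightarrow> y \<^bold>\<in> Rep X F \<longleftrightarrow> (\<exists>x. x \<^bold>\<in> X \<and> y = F x)"
  unfolding Rep_def by (rule mem_coll_gen) (rule repl_ex)

lemma set_eq_iff: "x = y \<longleftrightarrow> (\<forall>z. z \<^bold>\<in> x \<longleftrightarrow> z \<^bold>\<in> y)"
  using extensionality by blast

lemma ins_eq_D: "ins a X = ins b Y \<Longrightarrow> a = b \<or> a \<^bold>\<in> Y"
  by (metis mem_ins)

lemma ins_ins_eq:
  "ins a emp = ins b emp \<longleftrightarrow> a = b"
  "ins a (ins b emp) = ins c emp \<longleftrightarrow> a = c \<and> b = c"
  "ins c emp = ins a (ins b emp) \<longleftrightarrow> a = c \<and> b = c"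
  "ins a (ins b emp) = ins c (ins d emp) \<longleftrightarrow> a = c \<and> b = d \<or> a = d \<and> b = c"
proof -
  have comm: "ins x (ins y X) = ins y (ins x X)" for x y X by (rule ext) auto
  have idem: "ins x (ins x X) = ins x X" for x X by (rule ext) auto
  show 4: "ins a (ins b emp) = ins c (ins d emp) \<longleftrightarrow> a = c \<and> b = d \<or> a = d \<and> b = c" for a b c d
  proof
    assume *: "ins a (ins b emp) = ins c (ins d emp)"
    then have "a = c \<or> a = d" "b = c \<or> b = d" "c = a \<or> c = b" "d = a \<or> d = b"
      using ins_eq_D[OF *] ins_eq_D[OF *[symmetric]] ins_eq_D[OF *[unfolded comm[of a b]]]
        ins_eq_D[OF *[symmetric, unfolded comm[of c d]]] by auto
    then show "a = c \<and> b = d \<or> a = d \<and> b = c" by blast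
  qed (auto simp: comm)
  show "ins a emp = ins b emp \<longleftrightarrow> a = b" using 4[of a a b b] by (auto simp: idem)
  show "ins a (ins b emp) = ins c emp \<longleftrightarrow> a = c \<and> b = c" using 4[of a b c c] by (auto simp: idem)
  show "ins c emp = ins a (ins b emp) \<longleftrightarrow> a = c \<and> b = c" using 4[of c c a b] by (auto simp: idem)
qed

lemma pr_iff [simp]: "pr x y = pr x' y' \<longleftrightarrow> x = x' \<and> y = y'"
  unfolding pr_def ins_ins_eq by blast

lemma is_upair_iff: "is_upair u x y \<longleftrightarrow> u = ins x (ins y emp)"
  unfolding is_upair_def by (auto intro: ext)

lemma is_pair_iff: "is_pair p x y \<longleftrightarrow> p = pr x y"
proof -
  have "ins x (ins x emp) = ins x emp" by (rule ext) auto
  then show ?thesis unfolding is_pair_def is_upair_iff pr_def by (auto intro: ext)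
qed

lemma related_iff: "related r x y \<longleftrightarrow> pr x y \<^bold>\<in> r"
  unfolding related_def is_pair_iff by blast

lemma pr_in_Times: "x \<^bold>\<in> X \<Longrightarrow> y \<^bold>\<in> Y \<Longrightarrow> pr x y \<^bold>\<in> Pw (Pw (un X Y))"
  unfolding pr_def by (auto simp: subset_def)

lemma mem_Times [simp]: "p \<^bold>\<in> Times X Y \<longleftrightarrow> (\<exists>x y. x \<^bold>\<in> X \<and> y \<^bold>\<in> Y \<and> p = pr x y)"
  unfolding Times_def by (rule coll_bounded) (intro dfn, use pr_in_Times in blast)

lemma mem_lam: "trm (\<lambda>e. F (e 0)) \<Longrightarrow> p \<^bold>\<in> lam X F \<longleftrightarrow> (\<exists>x. x \<^bold>\<in> X \<and> p = pr x (F x))"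
  unfolding lam_def by (subst mem_Rep) (intro dfn, assumption, blast)

lemma pr_mem_lam: "trm (\<lambda>e. F (e 0)) \<Longrightarrow> pr x y \<^bold>\<in> lam X F \<longleftrightarrow> x \<^bold>\<in> X \<and> y = F x"
  by (auto simp: mem_lam)

lemma app_eqI: "pr x y \<^bold>\<in> f \<Longrightarrow> (\<And>z. pr x z \<^bold>\<in> f \<Longrightarrow> z = y) \<Longrightarrow> app f x = y"
  unfolding app_def by (rule the_v_eq)

lemma app_lam: "trm (\<lambda>e. F (e 0)) \<Longrightarrow> x \<^bold>\<in> X \<Longrightarrow> app (lam X F) x = F x"
  by (rule app_eqI) (auto simp: pr_mem_lam)

lemma injection_lam:
  assumes "trm (\<lambda>e. F (e 0))" "\<And>x. x \<^bold>\<in> X \<Longrightarrow> F x \<^bold>\<in> Y"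
    "\<And>x y. x \<^bold>\<in> X \<Longrightarrow> y \<^bold>\<in> X \<Longrightarrow> F x = F y \<Longrightarrow> x = y"
  shows "injection (lam X F) X Y"
  unfolding injection_def is_function_def relation_between_def is_pair_iff related_iff
  using assms(2,3) by (auto simp: mem_lam[OF assms(1)])

lemma card_leI:
  assumes "trm (\<lambda>e. F (e 0))" "\<And>x. x \<^bold>\<in> X \<Longrightarrow> F x \<^bold>\<in> Y"
    "\<And>x y. x \<^bold>\<in> X \<Longrightarrow> y \<^bold>\<in> X \<Longrightarrow> F x = F y \<Longrightarrow> x = y"
  shows "card_le X Y"
  unfolding card_le_def using injection_lam assms by blast

lemma is_function_pr:
  assumes "is_function f X Y" "pr x y \<^bold>\<in> f"
  shows "x \<^bold>\<in> X" "y \<^bold>\<in> Y"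
proof -
  have "\<exists>x' y'. x' \<^bold>\<in> X \<and> y' \<^bold>\<in> Y \<and> pr x y = pr x' y'"
    using assms unfolding is_function_def relation_between_def is_pair_iff by blast
  then show "x \<^bold>\<in> X" "y \<^bold>\<in> Y" by auto
qed

lemma is_function_app:
  assumes "is_function f X Y" "x \<^bold>\<in> X"
  shows "pr x (app f x) \<^bold>\<in> f" "app f x \<^bold>\<in> Y" "pr x y \<^bold>\<in> f \<Longrightarrow> app f x = y"
proof -
  obtain z where z: "pr x z \<^bold>\<in> f" "\<And>w. pr x w \<^bold>\<in> f \<Longrightarrow> w = z"
    using assms unfolding is_function_def related_iff by blast
  have eq: "app f x = z" by (rule app_eqI[OF z])
  show "pr x (app f x) \<^bold>\<in> f" unfolding eq by (rule z(1))
  show "app f x \<^bold>\<in> Y" unfolding eq using is_function_pr[OF assms(1) z(1)] by blast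
  show "pr x y \<^bold>\<in> f \<Longrightarrow> app f x = y" unfolding eq using z(2) by blast
qed

lemma injection_app:
  assumes "injection f X Y"
  shows "x \<^bold>\<in> X \<Longrightarrow> app f x \<^bold>\<in> Y" "x \<^bold>\<in> X \<Longrightarrow> x' \<^bold>\<in> X \<Longrightarrow> app f x = app f x' \<Longrightarrow> x = x'"
  using assms is_function_app[of f X Y] unfolding injection_def related_iff by metis+

lemma pr_mem_function:
  assumes "is_function f X Y"
  shows "pr x y \<^bold>\<in> f \<longleftrightarrow> x \<^bold>\<in> X \<and> y = app f x"
proof
  assume *: "pr x y \<^bold>\<in> f"
  then have "x \<^bold>\<in> X" using is_function_pr[OF assms] by blast
  then show "x \<^bold>\<in> X \<and> y = app f x" using is_function_app[OF assms] * by metis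
qed (use is_function_app[OF assms] in metis)

lemma function_eq_lam:
  assumes "is_function f X Y"
  shows "f = lam X (app f)"
proof (rule ext)
  fix p
  have "p \<^bold>\<in> f \<Longrightarrow> \<exists>x y. p = pr x y"
    using assms unfolding is_function_def relation_between_def is_pair_iff by blast
  moreover have "trm (\<lambda>e. app f (e 0))" by (intro dfn)
  ultimately show "p \<^bold>\<in> f \<longleftrightarrow> p \<^bold>\<in> lam X (app f)"
    using pr_mem_function[OF assms] by (auto simp: mem_lam)
qed

lemma bijectionI:
  assumes "trm (\<lambda>e. F (e 0))" "\<And>x. x \<^bold>\<in> X \<Longrightarrow> F x \<^bold>\<in> Y"
    "\<And>x y. x \<^bold>\<in> X \<Longrightarrow> y \<^bold>\<in> X \<Longrightarrow> F x = F y \<Longrightarrow> x = y"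
    "\<And>y. y \<^bold>\<in> Y \<Longrightarrow> \<exists>x. x \<^bold>\<in> X \<and> F x = y"
  shows "bijection (lam X F) X Y"
  unfolding bijection_def related_iff pr_mem_lam[OF assms(1)]
  using injection_lam[OF assms(1-3)] assms(4) by metis

lemma bijection_injection: "bijection f X Y \<Longrightarrow> injection f X Y"
  unfolding bijection_def by blast

lemma bijection_app:
  assumes "bijection f X Y"
  shows "x \<^bold>\<in> X \<Longrightarrow> app f x \<^bold>\<in> Y" "x \<^bold>\<in> X \<Longrightarrow> x' \<^bold>\<in> X \<Longrightarrow> app f x = app f x' \<Longrightarrow> x = x'"
    "y \<^bold>\<in> Y \<Longrightarrow> \<exists>x. x \<^bold>\<in> X \<and> app f x = y"
proof -
  note inj = bijection_injection[OF assms]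
  show "x \<^bold>\<in> X \<Longrightarrow> app f x \<^bold>\<in> Y" by (rule injection_app(1)[OF inj])
  show "x \<^bold>\<in> X \<Longrightarrow> x' \<^bold>\<in> X \<Longrightarrow> app f x = app f x' \<Longrightarrow> x = x'"
    by (rule injection_app(2)[OF inj])
  have f: "is_function f X Y" using inj unfolding injection_def by blast
  show "\<exists>x. x \<^bold>\<in> X \<and> app f x = y" if y: "y \<^bold>\<in> Y"
  proof -
    obtain x where "pr x y \<^bold>\<in> f" using assms y unfolding bijection_def related_iff by blast
    then show ?thesis unfolding pr_mem_function[OF f] by blast
  qed
qed

lemma card_le_trans:
  assumes "card_le X Y" "card_le Y Z"
  shows "card_le X Z"
proof -
  obtain f g where "injection f X Y" "injection g Y Z" using assms unfolding card_le_def by blast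
  note f = injection_app[OF this(1)] and g = injection_app[OF this(2)]
  show "card_le X Z"
    by (rule card_leI[of "\<lambda>x. app g (app f x)"]) (intro dfn, use f g in blast, use f g in blast)
qed

lemma card_le_subset: "subset X Y \<Longrightarrow> card_le X Y"
  by (rule card_leI[of "\<lambda>x. x"]) (intro dfn, auto simp: subset_def)

lemma card_eqI:
  assumes "trm (\<lambda>e. F (e 0))" "\<And>x. x \<^bold>\<in> X \<Longrightarrow> F x \<^bold>\<in> Y"
    "\<And>x y. x \<^bold>\<in> X \<Longrightarrow> y \<^bold>\<in> X \<Longrightarrow> F x = F y \<Longrightarrow> x = y"
    "\<And>y. y \<^bold>\<in> Y \<Longrightarrow> \<exists>x. x \<^bold>\<in> X \<and> F x = y"
  shows "card_eq X Y"
  unfolding card_eq_def using bijectionI assms by blast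

lemma card_eq_sym:
  assumes "card_eq X Y"
  shows "card_eq Y X"
proof -
  obtain f where "bijection f X Y" using assms unfolding card_eq_def by blast
  note f = bijection_app[OF this]
  define g where "g = (\<lambda>y. the_v (\<lambda>x. x \<^bold>\<in> X \<and> app f x = y))"
  have g: "g (app f x) = x" if "x \<^bold>\<in> X" for x
    unfolding g_def by (rule the_v_eq) (use f that in auto)
  show "card_eq Y X"
  proof (rule card_eqI[of g])
    show "trm (\<lambda>e. g (e 0))" unfolding g_def by (intro dfn)
  qed (use f g in metis)+
qed

lemma card_eq_trans:
  assumes "card_eq X Y" "card_eq Y Z"
  shows "card_eq X Z"
proof -
  obtain f g where "bijection f X Y" "bijection g Y Z" using assms unfolding card_eq_def by blast
  note f = bijection_app[OF this(1)] and g = bijection_app[OF this(2)]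
  show "card_eq X Z"
    by (rule card_eqI[of "\<lambda>x. app g (app f x)"]) (intro dfn, (use f g in metis)+)
qed

lemma card_eq_le: "card_eq X Y \<Longrightarrow> card_le X Y"
  unfolding card_eq_def card_le_def bijection_def by blast

section \<open>Natural numbers and ordinals of the model\<close>

lemma mem_suc [simp]: "z \<^bold>\<in> suc x \<longleftrightarrow> z = x \<or> z \<^bold>\<in> x"
  unfolding suc_def by auto

lemma is_empty_iff: "is_empty x \<longleftrightarrow> x = emp"
  unfolding is_empty_def by (auto intro: ext)

lemma is_succ_iff: "is_succ s x \<longleftrightarrow> s = suc x"
  unfolding is_succ_def by (auto intro: ext)

lemma is_inductive_iff: "is_inductive I \<longleftrightarrow> emp \<^bold>\<in> I \<and> (\<forall>x. x \<^bold>\<in> I \<longrightarrow> suc x \<^bold>\<in> I)"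
  unfolding is_inductive_def is_empty_iff is_succ_iff by blast

lemma natural_emp [simp]: "natural emp" and natural_suc: "natural k \<Longrightarrow> natural (suc k)"
  unfolding natural_def is_inductive_iff by blast+

lemma mem_omega [simp]: "x \<^bold>\<in> omega \<longleftrightarrow> natural x"
  unfolding omega_def
  by (rule coll_bounded) (intro dfn, use infinity in \<open>auto simp: natural_def\<close>)

text \<open>The naturals satisfying \<open>P\<close> must form a set, by separation, before that set
  can be called inductive; hence the definability premise, which recurs in all later induction
  rules.\<close>

lemma natural_induct:
  assumes "natural k" "dfn (\<lambda>e. P (e 0))" "P emp" "\<And>k. natural k \<Longrightarrow> P k \<Longrightarrow> P (suc k)"
  shows "P k"
proof -
  have "is_inductive (Sep omega P)"
    using assms(3,4) natural_suc by (auto simp: is_inductive_iff mem_Sep[OF assms(2)])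
  then show ?thesis using assms(1) mem_Sep[OF assms(2)] unfolding natural_def by blast
qed

lemma not_mem_self [simp]: "\<not> x \<^bold>\<in> x"
  using foundation[of "ins x emp"] by (auto simp: is_empty_iff) (metis mem_emp mem_ins)

lemma Ord_trans: "Ord \<gamma> \<Longrightarrow> \<alpha> \<^bold>\<in> \<beta> \<Longrightarrow> \<beta> \<^bold>\<in> \<gamma> \<Longrightarrow> \<alpha> \<^bold>\<in> \<gamma>"
  unfolding Ord_def trans_def by blast

lemma Ord_in: "Ord \<alpha> \<Longrightarrow> \<beta> \<^bold>\<in> \<alpha> \<Longrightarrow> Ord \<beta>"
  unfolding Ord_def trans_def by blast

lemma Ord_emp [simp]: "Ord emp"
  unfolding Ord_def trans_def by simp

lemma Ord_suc [simp]: "Ord \<alpha> \<Longrightarrow> Ord (suc \<alpha>)"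
  unfolding Ord_def trans_def mem_suc by blast

lemma Ord_Uni: "(\<And>\<alpha>. \<alpha> \<^bold>\<in> X \<Longrightarrow> Ord \<alpha>) \<Longrightarrow> Ord (Uni X)"
  unfolding Ord_def trans_def mem_Uni by blast

text \<open>Foundation is applied to the part of \<open>suc \<alpha>\<close> where \<open>P\<close>
  holds; transitivity turns its membership-minimal element into the least one.\<close>

lemma Ord_least:
  assumes "dfn (\<lambda>e. P (e 0))" "Ord \<alpha>" "P \<alpha>"
  shows "\<exists>\<beta>. Ord \<beta> \<and> P \<beta> \<and> (\<forall>\<gamma>. \<gamma> \<^bold>\<in> \<beta> \<longrightarrow> \<not> P \<gamma>) \<and> (\<beta> = \<alpha> \<or> \<beta> \<^bold>\<in> \<alpha>)"
proof -
  let ?S = "Sep (suc \<alpha>) P"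
  have "\<alpha> \<^bold>\<in> ?S" using assms by (simp add: mem_Sep)
  then have "\<not> is_empty ?S" unfolding is_empty_def by blast
  from foundation[OF this] obtain \<beta> where \<beta>: "\<beta> \<^bold>\<in> ?S" "\<And>z. z \<^bold>\<in> ?S \<Longrightarrow> \<not> z \<^bold>\<in> \<beta>" by blast
  have "\<beta> \<^bold>\<in> suc \<alpha>" "P \<beta>" using \<beta>(1) by (simp_all add: mem_Sep[OF assms(1)])
  moreover have "\<not> P \<gamma>" if "\<gamma> \<^bold>\<in> \<beta>" for \<gamma>
  proof -
    have "\<gamma> \<^bold>\<in> suc \<alpha>" using Ord_trans[of "suc \<alpha>" \<gamma> \<beta>] that \<open>\<beta> \<^bold>\<in> suc \<alpha>\<close> assms(2) by auto
    then show ?thesis using \<beta>(2)[of \<gamma>] that by (auto simp: mem_Sep[OF assms(1)])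
  qed
  ultimately show ?thesis using assms(2) Ord_in by auto
qed

lemma Ord_induct:
  assumes "Ord \<alpha>" "dfn (\<lambda>e. P (e 0))" "\<And>\<alpha>. Ord \<alpha> \<Longrightarrow> (\<And>\<beta>. \<beta> \<^bold>\<in> \<alpha> \<Longrightarrow> P \<beta>) \<Longrightarrow> P \<alpha>"
  shows "P \<alpha>"
proof (rule ccontr)
  assume "\<not> P \<alpha>"
  from Ord_least[of "\<lambda>x. \<not> P x", OF dfn_not[OF assms(2)] assms(1) this] show False
    using assms(3) by blast
qed

lemma Ord_linear: "Ord \<alpha> \<Longrightarrow> Ord \<beta> \<Longrightarrow> \<alpha> \<^bold>\<in> \<beta> \<or> \<alpha> = \<beta> \<or> \<beta> \<^bold>\<in> \<alpha>"
proof -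
  assume "Ord \<alpha>" "Ord \<beta>"
  have "\<forall>\<beta>. Ord \<beta> \<longrightarrow> \<alpha> \<^bold>\<in> \<beta> \<or> \<alpha> = \<beta> \<or> \<beta> \<^bold>\<in> \<alpha>"
  proof (rule Ord_induct[OF \<open>Ord \<alpha>\<close>], intro dfn, intro allI impI)
    fix \<alpha> \<beta> assume \<alpha>: "Ord \<alpha>" and IH: "\<And>\<gamma>. \<gamma> \<^bold>\<in> \<alpha> \<Longrightarrow> \<forall>\<beta>. Ord \<beta> \<longrightarrow> \<gamma> \<^bold>\<in> \<beta> \<or> \<gamma> = \<beta> \<or> \<beta> \<^bold>\<in> \<gamma>"
      and \<beta>: "Ord \<beta>"
    show "\<alpha> \<^bold>\<in> \<beta> \<or> \<alpha> = \<beta> \<or> \<beta> \<^bold>\<in> \<alpha>"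
    proof (rule Ord_induct[OF \<beta>], intro dfn)
      fix \<beta> assume \<beta>: "Ord \<beta>" and IH2: "\<And>\<gamma>. \<gamma> \<^bold>\<in> \<beta> \<Longrightarrow> \<alpha> \<^bold>\<in> \<gamma> \<or> \<alpha> = \<gamma> \<or> \<gamma> \<^bold>\<in> \<alpha>"
      show "\<alpha> \<^bold>\<in> \<beta> \<or> \<alpha> = \<beta> \<or> \<beta> \<^bold>\<in> \<alpha>"
      proof (rule ccontr)
        assume *: "\<not> ?thesis"
        have "\<gamma> \<^bold>\<in> \<alpha>" if "\<gamma> \<^bold>\<in> \<beta>" for \<gamma>
          using IH2[OF that] * that \<beta> Ord_trans by blast
        moreover have "\<gamma> \<^bold>\<in> \<beta>" if "\<gamma> \<^bold>\<in> \<alpha>" for \<gamma>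
          using IH[OF that] * that \<alpha> \<beta> Ord_trans by blast
        ultimately have "\<alpha> = \<beta>" by (blast intro: ext)
        then show False using * by blast
      qed
    qed
  qed
  then show ?thesis using \<open>Ord \<beta>\<close> by blast
qed

lemma Ord_asym: "Ord \<beta> \<Longrightarrow> \<alpha> \<^bold>\<in> \<beta> \<Longrightarrow> \<not> \<beta> \<^bold>\<in> \<alpha>"
  using Ord_trans not_mem_self by blast

text \<open>Burali-Forti: otherwise the union of all ordinals is an ordinal whose successor is among
  them, so it belongs to itself. Every later argument that exhausts the ordinals ends here.\<close>

lemma Ord_proper_class: "\<exists>\<alpha>. Ord \<alpha> \<and> \<not> \<alpha> \<^bold>\<in> X"
proof (rule ccontr)
  assume *: "\<nexists>\<alpha>. Ord \<alpha> \<and> \<not> \<alpha> \<^bold>\<in> X"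
  have d: "dfn (\<lambda>e. Ord (e 0))" by (intro dfn)
  have "Ord (Uni (Sep X Ord))" by (rule Ord_Uni) (auto simp: mem_Sep[OF d])
  then have "suc (Uni (Sep X Ord)) \<^bold>\<in> Sep X Ord" using * by (auto simp: mem_Sep[OF d])
  then have "Uni (Sep X Ord) \<^bold>\<in> Uni (Sep X Ord)" unfolding mem_Uni using mem_suc by blast
  then show False by simp
qed

lemma natural_Ord: "natural k \<Longrightarrow> Ord k"
  by (rule natural_induct) (auto intro: dfn)

lemma natural_in: "natural k \<Longrightarrow> m \<^bold>\<in> k \<Longrightarrow> natural m"
proof -
  assume "natural k"
  then have "\<forall>m. m \<^bold>\<in> k \<longrightarrow> natural m" by (rule natural_induct) (intro dfn, auto)
  then show "m \<^bold>\<in> k \<Longrightarrow> natural m" by blast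
qed

lemma Ord_omega [simp]: "Ord omega"
  using natural_in natural_Ord unfolding Ord_def trans_def mem_omega by blast

lemma suc_inj [simp]: "suc x = suc y \<longleftrightarrow> x = y"
proof
  assume "suc x = suc y"
  then have *: "x = y \<or> x \<^bold>\<in> y" "y = x \<or> y \<^bold>\<in> x" using mem_suc by metis+
  have "\<not> (x \<^bold>\<in> y \<and> y \<^bold>\<in> x)"
    using foundation[of "ins x (ins y emp)"] by (auto simp: is_empty_def)
  then show "x = y" using * by blast
qed simp

lemma not_natural_Ord: "Ord \<alpha> \<Longrightarrow> \<not> natural \<alpha> \<Longrightarrow> subset omega \<alpha>"
  using Ord_linear[of \<alpha> omega] Ord_trans[of \<alpha> _ omega] unfolding subset_def
  by (metis Ord_omega mem_omega)

end

section \<open>Finite sets\<close>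

context ZF_model
begin

lemma subsetI: "(\<And>z. z \<^bold>\<in> x \<Longrightarrow> z \<^bold>\<in> y) \<Longrightarrow> subset x y"
  unfolding subset_def by blast

lemma subsetD: "subset x y \<Longrightarrow> z \<^bold>\<in> x \<Longrightarrow> z \<^bold>\<in> y"
  unfolding subset_def by blast

lemma finite_natural: "natural n \<Longrightarrow> finite_set n"
  unfolding finite_set_def using card_eqI[of "\<lambda>x. x" n n] trm_var[of 0] by blast

lemma finite_emp [simp]: "finite_set emp"
  by (simp add: finite_natural)

lemma finite_ins [simp]: "finite_set X \<Longrightarrow> finite_set (ins x X)"
proof (cases "x \<^bold>\<in> X")
  case True
  then have "ins x X = X" by (auto intro: ext)
  then show "finite_set X \<Longrightarrow> finite_set (ins x X)" by simp
next
  case False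
  assume "finite_set X"
  then obtain n f where n: "natural n" and "bijection f X n"
    unfolding finite_set_def card_eq_def by blast
  note f = bijection_app[OF this(2)]
  define F where "F = (\<lambda>y. if y = x then n else app f y)"
  have Fx: "F x = n" and FX: "\<And>y. y \<^bold>\<in> X \<Longrightarrow> F y = app f y" using False unfolding F_def by auto
  have nn: "\<And>y. y \<^bold>\<in> X \<Longrightarrow> F y \<noteq> n" using f(1) FX not_mem_self by metis
  have "card_eq (ins x X) (suc n)"
  proof (rule card_eqI[of F])
    show "trm (\<lambda>e. F (e 0))" unfolding F_def by (intro dfn)
    show "F y \<^bold>\<in> suc n" if "y \<^bold>\<in> ins x X" for y using that f(1) Fx FX by auto
    show "y = z" if "y \<^bold>\<in> ins x X" "z \<^bold>\<in> ins x X" "F y = F z" for y z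
      using that f(2) Fx FX nn unfolding mem_ins by metis
    show "\<exists>z. z \<^bold>\<in> ins x X \<and> F z = y" if "y \<^bold>\<in> suc n" for y
      using that f(3) Fx FX unfolding mem_ins mem_suc by metis
  qed
  then show "finite_set (ins x X)" unfolding finite_set_def using natural_suc[OF n] by blast
qed

lemma finite_induct:
  assumes "finite_set X" "dfn (\<lambda>e. P (e 0))" "P emp"
    "\<And>x X. finite_set X \<Longrightarrow> \<not> x \<^bold>\<in> X \<Longrightarrow> P X \<Longrightarrow> P (ins x X)"
  shows "P X"
proof -
  obtain n where n: "natural n" "card_eq X n" using assms(1) unfolding finite_set_def by blast
  have "\<forall>X. card_eq X n \<longrightarrow> P X"
  proof (rule natural_induct[OF n(1)], intro dfn dfn1[OF assms(2)], intro allI impI)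
    fix X assume "card_eq X emp"
    then have "\<not> x \<^bold>\<in> X" for x unfolding card_eq_def using bijection_app(1) mem_emp by blast
    then have "X = emp" by (auto intro: ext)
    then show "P X" using assms(3) by simp
  next
    fix k
    assume k: "natural k" and IH: "\<forall>X. card_eq X k \<longrightarrow> P X"
    show "\<forall>X. card_eq X (suc k) \<longrightarrow> P X"
    proof (intro allI impI)
      fix X assume "card_eq X (suc k)"
      then obtain f where "bijection f X (suc k)" unfolding card_eq_def by blast
      note f = bijection_app[OF this]
      \<comment> \<open>The point sent to the last number \<open>k\<close> is removed, so that the
        same \<open>f\<close> maps the rest onto \<open>k\<close>.\<close>
      obtain x where x: "x \<^bold>\<in> X" "app f x = k" using f(3)[of k] by auto
      let ?X = "diff X (ins x emp)"
      have "card_eq ?X k"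
      proof (rule card_eqI[of "app f"])
        show "trm (\<lambda>e. app f (e 0))" by (intro dfn)
        show "app f y \<^bold>\<in> k" if "y \<^bold>\<in> ?X" for y using that f(1)[of y] f(2)[of x y] x by auto
        show "y = z" if "y \<^bold>\<in> ?X" "z \<^bold>\<in> ?X" "app f y = app f z" for y z using that f(2)[of y z] by auto
        show "\<exists>z. z \<^bold>\<in> ?X \<and> app f z = y" if y: "y \<^bold>\<in> k" for y
        proof -
          obtain z where "z \<^bold>\<in> X" "app f z = y" using f(3) y mem_suc by blast
          moreover have "z \<noteq> x" using calculation x y not_mem_self by metis
          ultimately show ?thesis by auto
        qed
      qed
      then have "P ?X" "finite_set ?X" using IH k unfolding finite_set_def by auto
      then have "P (ins x ?X)" using assms(4) by auto
      moreover have "ins x ?X = X" using x(1) by (auto intro: ext)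
      ultimately show "P X" by simp
    qed
  qed
  then show ?thesis using n(2) by blast
qed

lemma finite_subset: "finite_set X \<Longrightarrow> subset Y X \<Longrightarrow> finite_set Y"
proof -
  assume "finite_set X"
  then have "\<forall>Y. subset Y X \<longrightarrow> finite_set Y"
  proof (rule finite_induct, intro dfn, intro allI impI)
    fix Y assume "subset Y emp"
    then have "Y = emp" unfolding subset_def by (auto intro: ext)
    then show "finite_set Y" by simp
  next
    fix x X assume IH: "\<forall>Y. subset Y X \<longrightarrow> finite_set Y"
    show "\<forall>Y. subset Y (ins x X) \<longrightarrow> finite_set Y"
    proof (intro allI impI)
      fix Y assume Y: "subset Y (ins x X)"
      then have "subset (diff Y (ins x emp)) X" by (auto simp: subset_def)
      then have "finite_set (diff Y (ins x emp))" using IH by blast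
      moreover have "Y = diff Y (ins x emp) \<or> Y = ins x (diff Y (ins x emp))"
        by (cases "x \<^bold>\<in> Y") (auto intro: ext)
      ultimately show "finite_set Y" using finite_ins by metis
    qed
  qed
  then show "subset Y X \<Longrightarrow> finite_set Y" by blast
qed

lemma un_ins: "un (ins x X) Y = ins x (un X Y)"
  by (rule ext) auto

lemma un_emp: "un emp Y = Y"
  by (rule ext) auto

lemma finite_un: "finite_set X \<Longrightarrow> finite_set Y \<Longrightarrow> finite_set (un X Y)"
  by (rule finite_induct, assumption) (intro dfn, auto simp: un_ins un_emp)

lemma finite_Rep:
  assumes "finite_set X" "trm (\<lambda>e. F (e 0))"
  shows "finite_set (Rep X F)"
proof (rule finite_induct[OF assms(1)])
  show "dfn (\<lambda>e. finite_set (Rep (e 0) F))" by (intro dfn trm1[OF assms(2)])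
  have "Rep emp F = emp" by (rule ext) (simp add: mem_Rep[OF assms(2)])
  then show "finite_set (Rep emp F)" by simp
  fix x X assume "finite_set (Rep X F)"
  moreover have "Rep (ins x X) F = ins (F x) (Rep X F)" 
    by (rule ext) (auto simp: mem_Rep[OF assms(2)])
  ultimately show "finite_set (Rep (ins x X) F)" by simp
qed

lemma finite_image:
  assumes "finite_set X" "trm (\<lambda>e. F (e 0))" "\<And>y. y \<^bold>\<in> Y \<Longrightarrow> \<exists>x. x \<^bold>\<in> X \<and> y = F x"
  shows "finite_set Y"
  by (rule finite_subset[OF finite_Rep[OF assms(1,2)]])
    (use assms(3) in \<open>simp add: subset_def mem_Rep[OF assms(2)]\<close>)

lemma finite_card_le:
  assumes Y: "finite_set Y" and "card_le X Y"
  shows "finite_set X"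
proof -
  obtain f where "injection f X Y" using assms(2) unfolding card_le_def by blast
  note f = injection_app[OF this]
  define g where "g = (\<lambda>y. the_v (\<lambda>x. x \<^bold>\<in> X \<and> app f x = y))"
  have g: "g (app f x) = x" if "x \<^bold>\<in> X" for x
    unfolding g_def by (rule the_v_eq) (use f that in auto)
  show "finite_set X"
  proof (rule finite_image[OF Y])
    show "trm (\<lambda>e. g (e 0))" unfolding g_def by (intro dfn)
    show "\<exists>y. y \<^bold>\<in> Y \<and> x = g y" if "x \<^bold>\<in> X" for x using that f(1) g by metis
  qed
qed

lemma finite_Uni: "finite_set X \<Longrightarrow> (\<And>y. y \<^bold>\<in> X \<Longrightarrow> finite_set y) \<Longrightarrow> finite_set (Uni X)"
proof -
  assume "finite_set X"
  then have "(\<forall>y. y \<^bold>\<in> X \<longrightarrow> finite_set y) \<longrightarrow> finite_set (Uni X)"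
  proof (rule finite_induct, intro dfn)
    have "Uni emp = emp" by (rule ext) simp
    then show "(\<forall>y. y \<^bold>\<in> emp \<longrightarrow> finite_set y) \<longrightarrow> finite_set (Uni emp)" by simp
    fix x X assume "(\<forall>y. y \<^bold>\<in> X \<longrightarrow> finite_set y) \<longrightarrow> finite_set (Uni X)"
    moreover have "Uni (ins x X) = un x (Uni X)" by (rule ext) auto
    ultimately show "(\<forall>y. y \<^bold>\<in> ins x X \<longrightarrow> finite_set y) \<longrightarrow> finite_set (Uni (ins x X))"
      using finite_un by simp
  qed
  then show "(\<And>y. y \<^bold>\<in> X \<Longrightarrow> finite_set y) \<Longrightarrow> finite_set (Uni X)" by blast
qed

lemma finite_Pw: "finite_set X \<Longrightarrow> finite_set (Pw X)"
proof (rule finite_induct, assumption, intro dfn)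
  have "Pw emp = ins emp emp"
    by (rule ext) (auto simp: subset_def intro: ext)
  then show "finite_set (Pw emp)" by simp
  fix x X assume X: "finite_set (Pw X)"
  have t: "trm (\<lambda>e. ins x (e 0))" by (intro dfn)
  have "subset (Pw (ins x X)) (un (Pw X) (Rep (Pw X) (ins x)))"
  proof (rule subsetI)
    fix Y assume Y: "Y \<^bold>\<in> Pw (ins x X)"
    then have "diff Y (ins x emp) \<^bold>\<in> Pw X" by (auto simp: subset_def)
    moreover have "Y = diff Y (ins x emp) \<or> Y = ins x (diff Y (ins x emp))"
      by (cases "x \<^bold>\<in> Y") (auto intro: ext)
    ultimately show "Y \<^bold>\<in> un (Pw X) (Rep (Pw X) (ins x))" unfolding mem_un mem_Rep[OF t] by metis
  qed
  then show "finite_set (Pw (ins x X))"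
    using finite_subset finite_un[OF X finite_Rep[OF X t]] by blast
qed

lemma finite_Times:
  assumes "finite_set X" and Y: "finite_set Y"
  shows "finite_set (Times X Y)"
proof (rule finite_induct[OF assms(1)], intro dfn)
  have "Times emp Y = emp" by (rule ext) simp
  then show "finite_set (Times emp Y)" by simp
  fix x X assume X: "finite_set (Times X Y)"
  have t: "trm (\<lambda>e. pr x (e 0))" by (intro dfn)
  have "Times (ins x X) Y = un (Times X Y) (Rep Y (pr x))"
    by (rule ext) (auto simp: mem_Rep[OF t])
  then show "finite_set (Times (ins x X) Y)" using finite_un[OF X finite_Rep[OF Y t]] by simp
qed

text \<open>The pigeonhole principle. In the induction step an injection of \<open>ins x X\<close>
  yields one of \<open>X\<close> that leaves out a point of \<open>Y\<close>.\<close>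

lemma finite_not_card_le_proper:
  assumes "finite_set X" "subset Y X" "card_le X Y"
  shows "Y = X"
proof -
  have "\<forall>Y. subset Y X \<and> card_le X Y \<longrightarrow> Y = X"
  proof (rule finite_induct[OF assms(1)], intro dfn, intro allI impI)
    fix Y assume "subset Y emp \<and> card_le emp Y"
    then show "Y = emp" unfolding subset_def by (auto intro: ext)
  next
    fix x X assume x: "\<not> x \<^bold>\<in> X" and IH: "\<forall>Y. subset Y X \<and> card_le X Y \<longrightarrow> Y = X"
    show "\<forall>Y. subset Y (ins x X) \<and> card_le (ins x X) Y \<longrightarrow> Y = ins x X"
    proof (intro allI impI, elim conjE)
      fix Y assume Y: "subset Y (ins x X)" and "card_le (ins x X) Y"
      then obtain f where "injection f (ins x X) Y" unfolding card_le_def by blast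
      note f = injection_app[OF this]
      have neq: "app f z \<noteq> app f x" if "z \<^bold>\<in> X" for z using f(2)[of z x] that x by auto
      show "Y = ins x X"
      proof (cases "x \<^bold>\<in> Y")
        case True
        \<comment> \<open>The point of \<open>X\<close> that is sent to \<open>x\<close>, if any,
          takes over the image of \<open>x\<close>, which has become free; now \<open>x\<close> is
          not a value.\<close>
        define g where "g = (\<lambda>z. if app f z = x then app f x else app f z)"
        have "card_le X (diff Y (ins x emp))"
        proof (rule card_leI[of g])
          show "trm (\<lambda>e. g (e 0))" unfolding g_def by (intro dfn)
          show "g z \<^bold>\<in> diff Y (ins x emp)" if "z \<^bold>\<in> X" for z
            using that f(1)[of z] f(1)[of x] neq[OF that] by (auto simp: g_def)
          show "y = z" if "y \<^bold>\<in> X" "z \<^bold>\<in> X" "g y = g z" for y z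
            using that f(2) neq unfolding g_def mem_ins by metis
        qed
        moreover have "subset (diff Y (ins x emp)) X" using Y by (auto simp: subset_def)
        ultimately have "diff Y (ins x emp) = X" using IH by blast
        then have "z \<^bold>\<in> X \<longleftrightarrow> z \<^bold>\<in> Y \<and> z \<noteq> x" for z using mem_diff[of z Y "ins x emp"] by simp
        then show ?thesis using True by (intro ext) auto
      next
        case False
        \<comment> \<open>Here \<open>Y\<close> lies in \<open>X\<close>, and \<open>f\<close> on
          \<open>X\<close> omits \<open>app f x\<close>. The induction hypothesis would make
          \<open>X\<close> equal to a set without \<open>app f x\<close>, although
          \<open>app f x\<close> is in \<open>X\<close>.\<close>
        have "card_le X (diff Y (ins (app f x) emp))"
        proof (rule card_leI[of "app f"])
          show "trm (\<lambda>e. app f (e 0))" by (intro dfn)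
        qed (use f neq in auto)
        moreover have "subset (diff Y (ins (app f x) emp)) X" using Y False by (auto simp: subset_def)
        ultimately have "diff Y (ins (app f x) emp) = X" using IH by blast
        moreover have "app f x \<^bold>\<in> X" using f(1)[of x] Y False by (auto simp: subset_def)
        ultimately show ?thesis using mem_diff[of "app f x" Y "ins (app f x) emp"] by simp
      qed
    qed
  qed
  then show ?thesis using assms(2,3) by blast
qed

lemma suc_not_card_le: "natural n \<Longrightarrow> \<not> card_le (suc n) n"
  using finite_not_card_le_proper[of "suc n" n] finite_natural[OF natural_suc]
  by (metis mem_suc not_mem_self subsetI)

lemma natural_card_le: "natural m \<Longrightarrow> natural n \<Longrightarrow> card_le m n \<Longrightarrow> m \<^bold>\<in> suc n"
proof (rule ccontr)
  assume *: "natural m" "natural n" "card_le m n" "\<not> m \<^bold>\<in> suc n"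
  then have "n \<^bold>\<in> m" using Ord_linear natural_Ord mem_suc by blast
  then have "subset (suc n) m" using Ord_trans natural_Ord[OF *(1)] by (auto simp: subset_def)
  then have "card_le (suc n) n" using *(3) card_le_subset card_le_trans by blast
  then show False using suc_not_card_le *(2) by blast
qed

lemma natural_card_eq: "natural m \<Longrightarrow> natural n \<Longrightarrow> card_eq m n \<Longrightarrow> m = n"
  using natural_card_le[of m n] natural_card_le[of n m] card_eq_le card_eq_sym
    Ord_asym[OF natural_Ord] mem_suc by metis

lemma omega_infinite: "\<not> finite_set omega"
proof
  assume "finite_set omega"
  then obtain n where n: "natural n" "card_eq omega n" unfolding finite_set_def by blast
  have "subset (suc n) omega" using natural_in[OF n(1)] n(1) by (auto simp: subset_def)
  then have "card_le (suc n) n" using n(2) card_le_subset card_le_trans card_eq_le by blast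
  then show False using suc_not_card_le n(1) by blast
qed

lemma finite_Ord: "Ord \<alpha> \<Longrightarrow> finite_set \<alpha> \<Longrightarrow> natural \<alpha>"
  using not_natural_Ord finite_subset omega_infinite by blast

lemma infinite_minus_finite: "\<not> finite_set A \<Longrightarrow> finite_set X \<Longrightarrow> \<exists>a. a \<^bold>\<in> A \<and> \<not> a \<^bold>\<in> X"
  using finite_subset subsetI by metis

text \<open>Only the existence of an injection is carried through the induction, so picking a fresh
  point at each step is no use of choice.\<close>

lemma infinite_card_le:
  assumes "\<not> finite_set A" "finite_set X"
  shows "card_le X A"
proof (rule finite_induct[OF assms(2)], intro dfn)
  show "card_le emp A" by (rule card_leI[of "\<lambda>x. x"]) (intro dfn, auto)
  fix x X assume X: "finite_set X" "card_le X A" "\<not> x \<^bold>\<in> X"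
  then obtain f where "injection f X A" unfolding card_le_def by blast
  note f = injection_app[OF this]
  have t: "trm (\<lambda>e. app f (e 0))" by (intro dfn)
  obtain a where a: "a \<^bold>\<in> A" "\<not> a \<^bold>\<in> Rep X (app f)"
    using infinite_minus_finite[OF assms(1) finite_Rep[OF X(1) t]] by blast
  have a': "app f z \<noteq> a" if "z \<^bold>\<in> X" for z using a(2) that mem_Rep[OF t] by blast
  define g where "g = (\<lambda>z. if z = x then a else app f z)"
  show "card_le (ins x X) A"
  proof (rule card_leI[of g])
    show "trm (\<lambda>e. g (e 0))" unfolding g_def by (intro dfn)
    show "g z \<^bold>\<in> A" if "z \<^bold>\<in> ins x X" for z using that f a by (auto simp: g_def)
    show "y = z" if "y \<^bold>\<in> ins x X" "z \<^bold>\<in> ins x X" "g y = g z" for y z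
      using that f(2) a' unfolding g_def mem_ins by metis
  qed
qed

lemma finite_max:
  assumes "finite_set D" "\<And>x. x \<^bold>\<in> D \<Longrightarrow> Ord x" "D \<noteq> emp"
  shows "\<exists>m. m \<^bold>\<in> D \<and> (\<forall>x. x \<^bold>\<in> D \<longrightarrow> x = m \<or> x \<^bold>\<in> m)"
proof -
  have "(\<forall>x. x \<^bold>\<in> D \<longrightarrow> Ord x) \<and> D \<noteq> emp \<longrightarrow> (\<exists>m. m \<^bold>\<in> D \<and> (\<forall>x. x \<^bold>\<in> D \<longrightarrow> x = m \<or> x \<^bold>\<in> m))"
  proof (rule finite_induct[OF assms(1)], intro dfn)
    fix x X assume IH: "(\<forall>x. x \<^bold>\<in> X \<longrightarrow> Ord x) \<and> X \<noteq> emp \<longrightarrow> (\<exists>m. m \<^bold>\<in> X \<and> (\<forall>x. x \<^bold>\<in> X \<longrightarrow> x = m \<or> x \<^bold>\<in> m))"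
    show "(\<forall>y. y \<^bold>\<in> ins x X \<longrightarrow> Ord y) \<and> ins x X \<noteq> emp \<longrightarrow> (\<exists>m. m \<^bold>\<in> ins x X \<and> (\<forall>y. y \<^bold>\<in> ins x X \<longrightarrow> y = m \<or> y \<^bold>\<in> m))"
    proof (intro impI, elim conjE)
      assume o: "\<forall>y. y \<^bold>\<in> ins x X \<longrightarrow> Ord y"
      show "\<exists>m. m \<^bold>\<in> ins x X \<and> (\<forall>y. y \<^bold>\<in> ins x X \<longrightarrow> y = m \<or> y \<^bold>\<in> m)"
      proof (cases "X = emp")
        case True then show ?thesis by auto
      next
        case False
        then obtain m where m: "m \<^bold>\<in> X" "\<forall>x. x \<^bold>\<in> X \<longrightarrow> x = m \<or> x \<^bold>\<in> m" using IH o by auto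
        have "Ord m" "Ord x" using o m by auto
        then consider "x \<^bold>\<in> m \<or> x = m" | "m \<^bold>\<in> x" using Ord_linear by blast
        then show ?thesis
        proof cases
          case 1 then show ?thesis using m by auto
        next
          case 2
          have "\<forall>y. y \<^bold>\<in> ins x X \<longrightarrow> y = x \<or> y \<^bold>\<in> x"
            using m(2) 2 Ord_trans[OF \<open>Ord x\<close>] unfolding mem_ins by blast
          then show ?thesis by auto
        qed
      qed
    qed
  qed simp
  then show ?thesis using assms by blast
qed

text \<open>A definable selection from nonempty finite subsets of a linearly ordered set. Infinite
  subsets may lack a least point, and then the value is the default.\<close>

definition lst :: "'v \<Rightarrow> 'v \<Rightarrow> 'v" where
  "lst R D = the_v (\<lambda>x. x \<^bold>\<in> D \<and> (\<forall>y. y \<^bold>\<in> D \<longrightarrow> pr x y \<^bold>\<in> R))"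

lemma trm_lst [dfn]: "trm s \<Longrightarrow> trm t \<Longrightarrow> trm (\<lambda>e. lst (s e) (t e))"
  by (rule trm2) (unfold lst_def, intro dfn)

lemma linear_orderD:
  assumes "linear_order R A"
  shows "x \<^bold>\<in> A \<Longrightarrow> pr x x \<^bold>\<in> R" "pr x y \<^bold>\<in> R \<Longrightarrow> pr y x \<^bold>\<in> R \<Longrightarrow> x = y"
    "pr x y \<^bold>\<in> R \<Longrightarrow> pr y z \<^bold>\<in> R \<Longrightarrow> pr x z \<^bold>\<in> R"
    "x \<^bold>\<in> A \<Longrightarrow> y \<^bold>\<in> A \<Longrightarrow> pr x y \<^bold>\<in> R \<or> pr y x \<^bold>\<in> R"
  using assms unfolding linear_order_def related_iff by blast+

lemma lst_least:
  assumes "linear_order R A" "finite_set D" "subset D A" "D \<noteq> emp"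
  shows "lst R D \<^bold>\<in> D" "y \<^bold>\<in> D \<Longrightarrow> pr (lst R D) y \<^bold>\<in> R"
proof -
  note R = linear_orderD[OF assms(1)]
  have "subset D A \<and> D \<noteq> emp \<longrightarrow> (\<exists>x. x \<^bold>\<in> D \<and> (\<forall>y. y \<^bold>\<in> D \<longrightarrow> pr x y \<^bold>\<in> R))"
  proof (rule finite_induct[OF assms(2)], intro dfn)
    fix x X assume IH: "subset X A \<and> X \<noteq> emp \<longrightarrow> (\<exists>x. x \<^bold>\<in> X \<and> (\<forall>y. y \<^bold>\<in> X \<longrightarrow> pr x y \<^bold>\<in> R))"
    show "subset (ins x X) A \<and> ins x X \<noteq> emp \<longrightarrow>
        (\<exists>z. z \<^bold>\<in> ins x X \<and> (\<forall>y. y \<^bold>\<in> ins x X \<longrightarrow> pr z y \<^bold>\<in> R))"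
    proof (intro impI, elim conjE)
      assume s: "subset (ins x X) A"
      then have x: "x \<^bold>\<in> A" by (simp add: subset_def)
      show "\<exists>z. z \<^bold>\<in> ins x X \<and> (\<forall>y. y \<^bold>\<in> ins x X \<longrightarrow> pr z y \<^bold>\<in> R)"
      proof (cases "X = emp")
        case True then show ?thesis using R(1)[OF x] by auto
      next
        case False
        then obtain m where m: "m \<^bold>\<in> X" "\<forall>y. y \<^bold>\<in> X \<longrightarrow> pr m y \<^bold>\<in> R" using IH s by (auto simp: subset_def)
        then have "m \<^bold>\<in> A" using s by (auto simp: subset_def)
        then consider "pr m x \<^bold>\<in> R" | "pr x m \<^bold>\<in> R" using R(4)[OF x] by blast
        then show ?thesis
        proof cases
          case 1 then show ?thesis using m by auto
        next
          case 2
          then have "\<forall>y. y \<^bold>\<in> ins x X \<longrightarrow> pr x y \<^bold>\<in> R"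
            using m(2) R(1)[OF x] R(3) unfolding mem_ins by blast
          then show ?thesis by auto
        qed
      qed
    qed
  qed simp
  then obtain x where x: "x \<^bold>\<in> D" "\<forall>y. y \<^bold>\<in> D \<longrightarrow> pr x y \<^bold>\<in> R" using assms by blast
  have "lst R D = x" unfolding lst_def by (rule the_v_eq) (use x R(2) in blast)+
  then show "lst R D \<^bold>\<in> D" "y \<^bold>\<in> D \<Longrightarrow> pr (lst R D) y \<^bold>\<in> R" using x by auto
qed

end

section \<open>A uniform coding of finite subsets of infinite ordinals\<close>

context set_language
begin

text \<open>The history of the recursion below \<alpha>, singled out as the only solution of its own
  recursion equation, so that the recursion is a definable term.\<close>

definition recf :: "('v \<Rightarrow> 'v \<Rightarrow> 'v) \<Rightarrow> 'v \<Rightarrow> 'v" where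
  "recf G \<alpha> = the_v (\<lambda>h. h = lam \<alpha> (\<lambda>\<xi>. G \<xi> (lam \<xi> (app h))))"

definition recur :: "('v \<Rightarrow> 'v \<Rightarrow> 'v) \<Rightarrow> 'v \<Rightarrow> 'v" where
  "recur G \<alpha> = G \<alpha> (recf G \<alpha>)"

lemma trm_recur:
  assumes "trm (\<lambda>e. G (e 0) (e 1))" "trm s"
  shows "trm (\<lambda>e. recur G (s e))"
  by (rule trm1[OF _ assms(2)]) (unfold recur_def recf_def, intro dfn trm2[OF assms(1)])

definition fo :: "'v \<Rightarrow> bool" where
  "fo D \<longleftrightarrow> finite_set D \<and> (\<forall>x. x \<^bold>\<in> D \<longrightarrow> Ord x)"

text \<open>Finite sets of ordinals are ordered by the largest element of their symmetric difference.\<close>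

definition lt :: "'v \<Rightarrow> 'v \<Rightarrow> bool" where
  "lt D E \<longleftrightarrow> (\<exists>x. x \<^bold>\<in> E \<and> \<not> x \<^bold>\<in> D \<and> (\<forall>y. Ord y \<and> x \<^bold>\<in> y \<longrightarrow> (y \<^bold>\<in> D \<longleftrightarrow> y \<^bold>\<in> E)))"

lemma dfn_fo [dfn]: "trm s \<Longrightarrow> dfn (\<lambda>e. fo (s e))"
  by (rule dfn1) (unfold fo_def, intro dfn)

lemma dfn_lt [dfn]: "trm s \<Longrightarrow> trm t \<Longrightarrow> dfn (\<lambda>e. lt (s e) (t e))"
  by (rule dfn2) (unfold lt_def, intro dfn)

text \<open>The history \<open>u\<close> holds the pairs listed so far; the next value is the least
  finite set of ordinals not yet listed. In effect \<open>en \<alpha>\<close> is the set of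
  exponents in the base 2 normal form of \<alpha>.\<close>

definition en_step :: "'v \<Rightarrow> 'v \<Rightarrow> 'v" where
  "en_step \<alpha> u = the_v (\<lambda>D. fo D \<and> \<not> (\<exists>\<xi>. pr \<xi> D \<^bold>\<in> u) \<and>
     (\<forall>E. fo E \<and> \<not> (\<exists>\<xi>. pr \<xi> E \<^bold>\<in> u) \<longrightarrow> \<not> lt E D))"

definition en :: "'v \<Rightarrow> 'v" where "en = recur en_step"

definition idx :: "'v \<Rightarrow> 'v" where "idx D = the_v (\<lambda>\<alpha>. Ord \<alpha> \<and> en \<alpha> = D)"

lemma trm_en [dfn]: "trm s \<Longrightarrow> trm (\<lambda>e. en (s e))"
  unfolding en_def by (rule trm_recur) (unfold en_step_def, intro dfn)

lemma trm_idx [dfn]: "trm s \<Longrightarrow> trm (\<lambda>e. idx (s e))"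
  by (rule trm1) (unfold idx_def, intro dfn)

definition fin :: "'v \<Rightarrow> 'v" where "fin X = Sep (Pw X) finite_set"

lemma trm_fin [dfn]: "trm s \<Longrightarrow> trm (\<lambda>e. fin (s e))"
  by (rule trm1) (unfold fin_def, intro dfn)

text \<open>
  The injection \<open>code \<alpha>\<close> of the finite subsets of \<open>\<alpha>\<close> into \<open>\<alpha>\<close> is defined by recursion. If \<open>\<alpha>\<close> is
  closed, the index of a set in the enumeration \<open>en\<close> serves as its code. Otherwise \<open>emb \<alpha>\<close> embeds
  \<open>\<alpha>\<close> into the finite subsets of a smaller infinite ordinal \<open>base \<alpha>\<close>, for which codes are available.
\<close>

definition closed :: "'v \<Rightarrow> bool" where
  "closed \<alpha> \<longleftrightarrow> (\<forall>\<beta>. \<alpha> \<noteq> suc \<beta>) \<and> (\<forall>\<xi>. Ord \<xi> \<and> subset (en \<xi>) \<alpha> \<longrightarrow> \<xi> \<^bold>\<in> \<alpha>)"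

text \<open>In terms of base 2 normal forms, \<open>closed\<close> says that \<alpha> = 2^\<alpha>.
  For \<alpha> not a successor, \<open>base \<alpha>\<close> is the least \<beta> with \<alpha>
  below 2^\<beta>, so all ordinals below \<alpha> have their exponents in \<beta>.\<close>

definition base :: "'v \<Rightarrow> 'v" where
  "base \<alpha> = (if \<exists>\<beta>. \<alpha> = suc \<beta> then the_v (\<lambda>\<beta>. \<alpha> = suc \<beta>)
     else the_v (\<lambda>\<beta>. Ord \<beta> \<and> subset (en \<alpha>) \<beta> \<and> (\<forall>\<gamma>. \<gamma> \<^bold>\<in> \<beta> \<longrightarrow> \<not> subset (en \<alpha>) \<gamma>)))"

text \<open>For a successor, singletons represent the elements of the predecessor, which leaves the
  empty set for the predecessor itself.\<close>

definition emb :: "'v \<Rightarrow> 'v \<Rightarrow> 'v" where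
  "emb \<alpha> \<eta> = (if \<exists>\<beta>. \<alpha> = suc \<beta> then if \<alpha> = suc \<eta> then emp else ins \<eta> emp else en \<eta>)"

lemma dfn_closed [dfn]: "trm s \<Longrightarrow> dfn (\<lambda>e. closed (s e))"
  by (rule dfn1) (unfold closed_def, intro dfn)

lemma trm_base [dfn]: "trm s \<Longrightarrow> trm (\<lambda>e. base (s e))"
  by (rule trm1) (unfold base_def, intro dfn)

lemma trm_emb [dfn]: "trm s \<Longrightarrow> trm t \<Longrightarrow> trm (\<lambda>e. emb (s e) (t e))"
  by (rule trm2) (unfold emb_def, intro dfn)

text \<open>The codes of the base are used twice: first to turn each
  \<open>emb \<alpha> \<eta>\<close> into one element of \<open>base \<alpha>\<close>, then to code
  the finite set of these elements. The value is stored as a set function on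
  \<open>fin \<alpha>\<close>, so that the history can supply it later.\<close>

definition code_step :: "'v \<Rightarrow> 'v \<Rightarrow> 'v" where
  "code_step \<alpha> u = lam (fin \<alpha>) (\<lambda>D. if closed \<alpha> then idx D
     else app (app u (base \<alpha>)) (Rep D (\<lambda>\<eta>. app (app u (base \<alpha>)) (emb \<alpha> \<eta>))))"

definition code :: "'v \<Rightarrow> 'v \<Rightarrow> 'v" where "code \<alpha> D = app (recur code_step \<alpha>) D"

lemma trm_code_step: "trm (\<lambda>e. code_step (e 0) (e 1))"
  unfolding code_step_def by (intro dfn)

lemma trm_code [dfn]: "trm s \<Longrightarrow> trm t \<Longrightarrow> trm (\<lambda>e. code (s e) (t e))"
  by (rule trm2) (unfold code_def, intro dfn trm_recur trm_code_step)

text \<open>A pairing function on \<alpha>: the Kuratowski pair with each set formation followed by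
  \<open>code \<alpha>\<close>.\<close>

definition pcode :: "'v \<Rightarrow> 'v \<Rightarrow> 'v \<Rightarrow> 'v" where
  "pcode \<alpha> x y = code \<alpha> (ins (code \<alpha> (ins x emp)) (ins (code \<alpha> (ins x (ins y emp))) emp))"

lemma trm_pcode [dfn]: "trm s \<Longrightarrow> trm t \<Longrightarrow> trm u \<Longrightarrow> trm (\<lambda>e. pcode (s e) (t e) (u e))"
  by (rule trm3) (unfold pcode_def, intro dfn)

end

context ZF_model
begin

section \<open>Transfinite recursion\<close>

lemma lam_cong: "(\<And>x. x \<^bold>\<in> X \<Longrightarrow> F x = F' x) \<Longrightarrow> lam X F = lam X F'"
  unfolding lam_def Rep_def by (rule arg_cong[where f = coll]) (auto simp: fun_eq_iff)

lemma recf_eq: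
  assumes G: "trm (\<lambda>e. G (e 0) (e 1))" and \<alpha>: "Ord \<alpha>"
  shows "recf G \<alpha> = lam \<alpha> (recur G)"
proof (rule Ord_induct[OF \<alpha>])
  have t: "trm (\<lambda>e. recur G (e 0))" by (intro trm_recur[OF G] dfn)
  have d: "trm (\<lambda>e. recf G (e 0))" unfolding recf_def by (intro dfn trm2[OF G])
  show "dfn (\<lambda>e. recf G (e 0) = lam (e 0) (recur G))" by (intro dfn d trm_recur[OF G])
  fix \<alpha> assume \<alpha>: "Ord \<alpha>" and IH: "\<And>\<beta>. \<beta> \<^bold>\<in> \<alpha> \<Longrightarrow> recf G \<beta> = lam \<beta> (recur G)"
  let ?h = "lam \<alpha> (recur G)"
  show "recf G \<alpha> = ?h"
    unfolding recf_def
  proof (rule the_v_eq)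
    show "?h = lam \<alpha> (\<lambda>\<xi>. G \<xi> (lam \<xi> (app ?h)))"
    proof (rule lam_cong)
      fix \<xi> assume \<xi>: "\<xi> \<^bold>\<in> \<alpha>"
      have "lam \<xi> (app ?h) = lam \<xi> (recur G)"
        by (rule lam_cong) (use \<xi> Ord_trans[OF \<alpha>] app_lam[OF t] in blast)
      then show "recur G \<xi> = G \<xi> (lam \<xi> (app ?h))" using IH[OF \<xi>] by (simp add: recur_def)
    qed
    \<comment> \<open>Uniqueness: another solution \<open>h\<close> agrees with
      \<open>recur G\<close> below \<alpha>, by a second induction on the argument.\<close>
    fix h assume h: "h = lam \<alpha> (\<lambda>\<xi>. G \<xi> (lam \<xi> (app h)))"
    have t2: "trm (\<lambda>e. G (e 0) (lam (e 0) (app h)))" by (intro dfn trm2[OF G])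
    have app_h: "app h \<xi> = G \<xi> (lam \<xi> (app h))" if "\<xi> \<^bold>\<in> \<alpha>" for \<xi>
      by (subst h) (rule app_lam[OF t2 that])
    have "\<xi> \<^bold>\<in> \<alpha> \<longrightarrow> app h \<xi> = recur G \<xi>" if "Ord \<xi>" for \<xi>
    proof (rule Ord_induct[OF that])
      show "dfn (\<lambda>e. e 0 \<^bold>\<in> \<alpha> \<longrightarrow> app h (e 0) = recur G (e 0))" by (intro dfn trm_recur[OF G])
      fix \<xi> assume IH2: "\<And>\<eta>. \<eta> \<^bold>\<in> \<xi> \<Longrightarrow> \<eta> \<^bold>\<in> \<alpha> \<longrightarrow> app h \<eta> = recur G \<eta>"
      show "\<xi> \<^bold>\<in> \<alpha> \<longrightarrow> app h \<xi> = recur G \<xi>"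
      proof
        assume \<xi>: "\<xi> \<^bold>\<in> \<alpha>"
        have "lam \<xi> (app h) = lam \<xi> (recur G)"
          by (rule lam_cong) (use IH2 Ord_trans[OF \<alpha> _ \<xi>] in blast)
        then show "app h \<xi> = recur G \<xi>" using app_h[OF \<xi>] IH[OF \<xi>] by (simp add: recur_def)
      qed
    qed
    then have "lam \<alpha> (\<lambda>\<xi>. G \<xi> (lam \<xi> (app h))) = ?h"
      by (intro lam_cong) (use app_h Ord_in[OF \<alpha>] in metis)
    then show "h = ?h" using h by simp
  qed
qed

lemma recur_eq: "trm (\<lambda>e. G (e 0) (e 1)) \<Longrightarrow> Ord \<alpha> \<Longrightarrow> recur G \<alpha> = G \<alpha> (lam \<alpha> (recur G))"
  using recf_eq unfolding recur_def[of G \<alpha>] by simp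

section \<open>Well-ordering of the finite sets of ordinals\<close>

lemma lt_linear:
  assumes "fo D" "fo E" "D \<noteq> E"
  shows "lt D E \<or> lt E D"
proof -
  let ?S = "un (diff D E) (diff E D)"
  have "finite_set ?S"
    using assms(1,2) finite_un[of D E] unfolding fo_def
    by (auto intro!: finite_subset[of "un D E" ?S] subsetI)
  moreover have "?S \<noteq> emp"
  proof
    assume "?S = emp"
    then have "\<not> z \<^bold>\<in> ?S" for z by simp
    then have "D = E" by (intro ext) (simp, blast)
    then show False using assms(3) by blast
  qed
  moreover have "\<And>x. x \<^bold>\<in> ?S \<Longrightarrow> Ord x" using assms unfolding fo_def by auto
  ultimately obtain m where m: "m \<^bold>\<in> ?S" "\<And>x. x \<^bold>\<in> ?S \<Longrightarrow> x = m \<or> x \<^bold>\<in> m" "Ord m"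
    using finite_max[of ?S] by blast
  have "y \<^bold>\<in> D \<longleftrightarrow> y \<^bold>\<in> E" if "Ord y" "m \<^bold>\<in> y" for y
    using m(2)[of y] that Ord_asym[OF that] by auto
  then show ?thesis using m(1) unfolding lt_def by simp blast
qed

lemma lt_irrefl: "\<not> lt D D"
  unfolding lt_def by blast

text \<open>Above the deciding point \<open>x\<close> the two sets agree, and \<open>x\<close>
  itself lies in \<delta>. So everything below a subset of \<delta> is again a subset of \<delta>;
  in particular, predecessors form a set.\<close>

lemma lt_subset:
  assumes "lt E D" "fo E" "subset D \<delta>" "Ord \<delta>"
  shows "subset E \<delta>"
proof (rule subsetI)
  obtain x where x: "x \<^bold>\<in> D" "\<And>z. Ord z \<Longrightarrow> x \<^bold>\<in> z \<Longrightarrow> z \<^bold>\<in> E \<longleftrightarrow> z \<^bold>\<in> D"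
    using assms(1) unfolding lt_def by blast
  have x\<delta>: "x \<^bold>\<in> \<delta>" using x(1) assms(3) subsetD by blast
  fix y assume y: "y \<^bold>\<in> E"
  then have "Ord y" using assms(2) unfolding fo_def by blast
  then consider "y = x" | "y \<^bold>\<in> x" | "x \<^bold>\<in> y" using Ord_linear Ord_in[OF assms(4) x\<delta>] by blast
  then show "y \<^bold>\<in> \<delta>"
  proof cases
    case 3 then show ?thesis using x(2)[OF \<open>Ord y\<close>] y assms(3) subsetD by blast
  qed (use x\<delta> Ord_trans[OF assms(4)] in auto)
qed

lemma fo_bounded: "fo D \<Longrightarrow> \<exists>\<alpha>. Ord \<alpha> \<and> subset D \<alpha>"
proof -
  assume D: "fo D"
  have t: "trm (\<lambda>e. suc (e 0))" by (intro dfn)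
  have "Ord (Uni (Rep D suc))"
    by (rule Ord_Uni) (use D in \<open>auto simp: mem_Rep[OF t] fo_def\<close>)
  moreover have "subset D (Uni (Rep D suc))"
    by (rule subsetI) (auto simp: mem_Rep[OF t])
  ultimately show ?thesis by blast
qed

text \<open>Well-foundedness of \<open>lt\<close>, by induction on a common bound \<alpha> of the
  members of \<open>S\<close>.\<close>

lemma lt_least_set:
  assumes "Ord \<alpha>"
  shows "\<forall>S. (\<forall>D. D \<^bold>\<in> S \<longrightarrow> fo D \<and> subset D \<alpha>) \<and> (\<exists>D. D \<^bold>\<in> S) \<longrightarrow>
    (\<exists>D. D \<^bold>\<in> S \<and> (\<forall>E. E \<^bold>\<in> S \<longrightarrow> \<not> lt E D))"
proof (rule Ord_induct[OF assms], intro dfn, intro allI impI, elim conjE)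
  fix \<alpha> S
  assume \<alpha>: "Ord \<alpha>" and IH: "\<And>\<beta>. \<beta> \<^bold>\<in> \<alpha> \<Longrightarrow> \<forall>S. (\<forall>D. D \<^bold>\<in> S \<longrightarrow> fo D \<and> subset D \<beta>) \<and> (\<exists>D. D \<^bold>\<in> S) \<longrightarrow>
      (\<exists>D. D \<^bold>\<in> S \<and> (\<forall>E. E \<^bold>\<in> S \<longrightarrow> \<not> lt E D))"
    and S: "\<forall>D. D \<^bold>\<in> S \<longrightarrow> fo D \<and> subset D \<alpha>" and ne: "\<exists>D. D \<^bold>\<in> S"
  show "\<exists>D. D \<^bold>\<in> S \<and> (\<forall>E. E \<^bold>\<in> S \<longrightarrow> \<not> lt E D)"
  proof (cases "\<exists>\<beta> D. \<beta> \<^bold>\<in> \<alpha> \<and> D \<^bold>\<in> S \<and> subset D \<beta>")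
    \<comment> \<open>A least set among the members within \<beta> is least in all of
      \<open>S\<close>, since by \<open>lt_subset\<close> its predecessors stay within
      \<beta>.\<close>
    case True
    then obtain \<beta> D0 where \<beta>: "\<beta> \<^bold>\<in> \<alpha>" "D0 \<^bold>\<in> S" "subset D0 \<beta>" by blast
    have d: "dfn (\<lambda>e. subset (e 0) \<beta>)" by (intro dfn)
    let ?S = "Sep S (\<lambda>D. subset D \<beta>)"
    note m = mem_Sep[OF d]
    have "\<exists>D. D \<^bold>\<in> ?S \<and> (\<forall>E. E \<^bold>\<in> ?S \<longrightarrow> \<not> lt E D)"
      using IH[OF \<beta>(1), rule_format, of ?S] \<beta> S m by blast
    then obtain D where D: "D \<^bold>\<in> S" "subset D \<beta>" "\<And>E. E \<^bold>\<in> S \<Longrightarrow> subset E \<beta> \<Longrightarrow> \<not> lt E D"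
      unfolding m by blast
    have "\<not> lt E D" if "E \<^bold>\<in> S" for E
      using D(3)[OF that] lt_subset[OF _ _ D(2) Ord_in[OF \<alpha> \<beta>(1)]] S that by blast
    then show ?thesis using D(1) by blast
  next
    case F: False
    show ?thesis
    proof (cases "emp \<^bold>\<in> S")
      case True
      have "\<not> lt E emp" for E unfolding lt_def by simp
      then show ?thesis using True by blast
    next
      case False
      \<comment> \<open>A nonempty member that fits into no smaller bound has the predecessor of
        \<alpha> as its maximum, so \<alpha> is a successor and all members share their
        maximum.\<close>
      have top: "\<exists>m. m \<^bold>\<in> D \<and> \<alpha> = suc m" if D: "D \<^bold>\<in> S" for D
      proof -
        have "fo D" "subset D \<alpha>" "D \<noteq> emp" using S D False by auto
        then obtain m where m: "m \<^bold>\<in> D" "\<And>x. x \<^bold>\<in> D \<Longrightarrow> x = m \<or> x \<^bold>\<in> m"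
          using finite_max[of D] unfolding fo_def by blast
        have "m \<^bold>\<in> \<alpha>" using m(1) \<open>subset D \<alpha>\<close> subsetD by blast
        then have "suc m \<^bold>\<in> \<alpha> \<or> suc m = \<alpha>"
          using Ord_linear[of \<alpha> "suc m"] \<alpha> Ord_in[OF \<alpha>] Ord_asym Ord_suc by (metis mem_suc not_mem_self)
        moreover have "subset D (suc m)" using m(2) by (auto intro: subsetI)
        ultimately show ?thesis using F D m(1) by blast
      qed
      then obtain \<delta> where \<delta>: "\<alpha> = suc \<delta>" using ne by blast
      have in\<delta>: "\<delta> \<^bold>\<in> D" if "D \<^bold>\<in> S" for D using top[OF that] \<delta> by auto
      \<comment> \<open>Removing the common maximum \<delta> does not affect comparisons and lowers
        the bound to \<delta>.\<close>
      let ?m = "\<lambda>D. diff D (ins \<delta> emp)"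
      have t: "trm (\<lambda>e. ?m (e 0))" by (intro dfn)
      have *: "fo (?m D) \<and> subset (?m D) \<delta>" if "D \<^bold>\<in> S" for D
      proof
        have D: "fo D" "subset D \<alpha>" using S that by auto
        moreover have "subset (?m D) D" by (auto intro: subsetI)
        ultimately show "fo (?m D)" unfolding fo_def using finite_subset[of D "?m D"] by simp
        show "subset (?m D) \<delta>" by (rule subsetI) (use D(2) \<delta> in \<open>auto dest: subsetD\<close>)
      qed
      have "\<delta> \<^bold>\<in> \<alpha>" using \<delta> by simp
      have "\<exists>D. D \<^bold>\<in> Rep S ?m \<and> (\<forall>E. E \<^bold>\<in> Rep S ?m \<longrightarrow> \<not> lt E D)"
        by (rule IH[OF \<open>\<delta> \<^bold>\<in> \<alpha>\<close>, rule_format]) (use ne * in \<open>auto simp: mem_Rep[OF t]\<close>)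
      then obtain D where D: "D \<^bold>\<in> S" "\<And>E. E \<^bold>\<in> S \<Longrightarrow> \<not> lt (?m E) (?m D)"
        unfolding mem_Rep[OF t] by blast
      have "\<not> lt E D" if E: "E \<^bold>\<in> S" for E
      proof
        assume "lt E D"
        then obtain x where x: "x \<^bold>\<in> D" "\<not> x \<^bold>\<in> E" "\<forall>y. Ord y \<and> x \<^bold>\<in> y \<longrightarrow> (y \<^bold>\<in> E \<longleftrightarrow> y \<^bold>\<in> D)"
          unfolding lt_def by blast
        have "x \<noteq> \<delta>" using x(2) in\<delta>[OF E] by blast
        then have "lt (?m E) (?m D)" unfolding lt_def using x by auto
        then show False using D(2)[OF E] by blast
      qed
      then show ?thesis using D(1) by blast
    qed
  qed
qed

lemma lt_least:
  assumes P: "dfn (\<lambda>e. P (e 0))" and "fo D0" "P D0"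
  shows "\<exists>D. fo D \<and> P D \<and> (\<forall>E. fo E \<and> P E \<longrightarrow> \<not> lt E D)"
proof -
  obtain \<alpha> where \<alpha>: "Ord \<alpha>" "subset D0 \<alpha>" using fo_bounded assms(2) by blast
  have d: "dfn (\<lambda>e. fo (e 0) \<and> P (e 0))" by (intro dfn P)
  let ?S = "Sep (Pw \<alpha>) (\<lambda>D. fo D \<and> P D)"
  have m: "D \<^bold>\<in> ?S \<longleftrightarrow> subset D \<alpha> \<and> fo D \<and> P D" for D unfolding mem_Sep[OF d] by simp
  have "\<exists>D. D \<^bold>\<in> ?S \<and> (\<forall>E. E \<^bold>\<in> ?S \<longrightarrow> \<not> lt E D)"
    by (rule lt_least_set[OF \<alpha>(1), rule_format]) (use \<alpha>(2) assms m in blast)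
  then obtain D where D: "subset D \<alpha>" "fo D" "P D" "\<And>E. subset E \<alpha> \<Longrightarrow> fo E \<Longrightarrow> P E \<Longrightarrow> \<not> lt E D"
    unfolding m by blast
  then show ?thesis using lt_subset[OF _ _ D(1) \<alpha>(1)] by blast
qed

section \<open>The enumeration of all finite sets of ordinals\<close>

lemma en_spec:
  assumes "Ord \<alpha>"
  shows "fo (en \<alpha>) \<and> \<not> (\<exists>\<xi>. \<xi> \<^bold>\<in> \<alpha> \<and> en \<alpha> = en \<xi>) \<and>
    (\<forall>E. fo E \<and> \<not> (\<exists>\<xi>. \<xi> \<^bold>\<in> \<alpha> \<and> E = en \<xi>) \<longrightarrow> \<not> lt E (en \<alpha>))"
proof -
  have t: "trm (\<lambda>e. en (e 0))" by (intro dfn)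
  have G: "trm (\<lambda>e. en_step (e 0) (e 1))" unfolding en_step_def by (intro dfn)
  let ?P = "\<lambda>D. \<not> (\<exists>\<xi>. \<xi> \<^bold>\<in> \<alpha> \<and> D = en \<xi>)"
  have P: "dfn (\<lambda>e. ?P (e 0))" by (intro dfn)
  have *: "en \<alpha> = the_v (\<lambda>D. fo D \<and> ?P D \<and> (\<forall>E. fo E \<and> ?P E \<longrightarrow> \<not> lt E D))"
    unfolding en_def
    by (subst recur_eq[OF G assms]) (simp only: en_step_def en_def[symmetric] pr_mem_lam[OF t])
  \<comment> \<open>The listing never runs out: an ordinal outside all sets listed so far gives an
    unlisted singleton.\<close>
  obtain \<beta> where \<beta>: "Ord \<beta>" "\<not> \<beta> \<^bold>\<in> Uni (Rep \<alpha> en)" using Ord_proper_class by blast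
  have "fo (ins \<beta> emp)" using \<beta>(1) by (simp add: fo_def)
  moreover have "?P (ins \<beta> emp)" using \<beta>(2) unfolding mem_Uni mem_Rep[OF t] by (metis mem_ins)
  ultimately obtain D where D: "fo D \<and> ?P D \<and> (\<forall>E. fo E \<and> ?P E \<longrightarrow> \<not> lt E D)"
    using lt_least[OF P] by blast
  have "\<exists>!D. fo D \<and> ?P D \<and> (\<forall>E. fo E \<and> ?P E \<longrightarrow> \<not> lt E D)"
    by (rule ex1I[of _ D]) (use D lt_linear in blast)+
  from the_vI[OF this] show ?thesis unfolding *[symmetric] .
qed

lemma fo_en: "Ord \<alpha> \<Longrightarrow> fo (en \<alpha>)"
  using en_spec by blast

lemma en_lt: "Ord \<beta> \<Longrightarrow> \<alpha> \<^bold>\<in> \<beta> \<Longrightarrow> lt (en \<alpha>) (en \<beta>)"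
proof -
  assume *: "Ord \<beta>" "\<alpha> \<^bold>\<in> \<beta>"
  then have \<alpha>: "Ord \<alpha>" using Ord_in by blast
  have "\<not> (\<exists>\<xi>. \<xi> \<^bold>\<in> \<alpha> \<and> en \<beta> = en \<xi>)" using en_spec[OF *(1)] Ord_trans[OF *(1)] *(2) by blast
  then have "\<not> lt (en \<beta>) (en \<alpha>)" using en_spec[OF \<alpha>] en_spec[OF *(1)] by blast
  moreover have "en \<beta> \<noteq> en \<alpha>" using en_spec[OF *(1)] *(2) by blast
  ultimately show ?thesis using lt_linear fo_en * \<alpha> by blast
qed

lemma en_inj: "Ord \<alpha> \<Longrightarrow> Ord \<beta> \<Longrightarrow> en \<alpha> = en \<beta> \<Longrightarrow> \<alpha> = \<beta>"
  using Ord_linear en_lt lt_irrefl by metis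

lemma idx_en: "Ord \<alpha> \<Longrightarrow> idx (en \<alpha>) = \<alpha>"
  unfolding idx_def by (rule the_v_eq) (use en_inj in auto)

text \<open>If \<open>D\<close> were never listed, every \<open>en \<alpha>\<close> would lie below
  \<open>D\<close> and hence within one bound \<delta>; then \<open>idx\<close> would map a power
  set onto all ordinals.\<close>

lemma en_surj:
  assumes "fo D"
  shows "\<exists>\<alpha>. Ord \<alpha> \<and> en \<alpha> = D"
proof (rule ccontr)
  assume *: "\<nexists>\<alpha>. Ord \<alpha> \<and> en \<alpha> = D"
  obtain \<delta> where \<delta>: "Ord \<delta>" "subset D \<delta>" using fo_bounded assms by blast
  have t: "trm (\<lambda>e. idx (e 0))" by (intro dfn)
  have "\<alpha> \<^bold>\<in> Rep (Pw \<delta>) idx" if "Ord \<alpha>" for \<alpha>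
  proof -
    have "\<not> lt D (en \<alpha>)" using en_spec[OF that] * assms Ord_in[OF that] by metis
    then have "lt (en \<alpha>) D" using lt_linear[OF assms fo_en[OF that]] * that by metis
    then have "en \<alpha> \<^bold>\<in> Pw \<delta>" using lt_subset fo_en[OF that] \<delta> by simp
    then show ?thesis unfolding mem_Rep[OF t] using idx_en[OF that] by metis
  qed
  then show False using Ord_proper_class by blast
qed

lemma idx_props:
  assumes "fo D"
  shows "Ord (idx D)" "en (idx D) = D"
  using en_surj[OF assms] idx_en by auto

section \<open>Codes below infinite ordinals\<close>

lemma mem_fin [simp]: "D \<^bold>\<in> fin X \<longleftrightarrow> subset D X \<and> finite_set D"
proof -
  have "dfn (\<lambda>e. finite_set (e 0))" by (intro dfn)
  then show ?thesis unfolding fin_def by (simp add: mem_Sep)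
qed

lemma fin_fo: "Ord \<alpha> \<Longrightarrow> D \<^bold>\<in> fin \<alpha> \<Longrightarrow> fo D"
  unfolding fo_def using Ord_in subsetD by auto

lemma base_suc:
  assumes "Ord \<alpha>" "\<alpha> = suc \<beta>"
  shows "base \<alpha> = \<beta>" "emb \<alpha> \<eta> = (if \<eta> = \<beta> then emp else ins \<eta> emp)"
proof -
  have "the_v (\<lambda>\<gamma>. \<alpha> = suc \<gamma>) = \<beta>" by (rule the_v_eq) (use assms in auto)
  then show "base \<alpha> = \<beta>" unfolding base_def using assms by auto
  show "emb \<alpha> \<eta> = (if \<eta> = \<beta> then emp else ins \<eta> emp)" unfolding emb_def using assms by auto
qed

text \<open>The failure of closure puts \<open>en \<alpha>\<close> inside \<alpha>. Being finite, it
  is bounded below the limit \<alpha>, and everything enumerated earlier obeys the same bound by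
  \<open>lt_subset\<close>.\<close>

lemma base_limit:
  assumes \<alpha>: "Ord \<alpha>" "\<not> natural \<alpha>" "\<not> closed \<alpha>" and lim: "\<And>\<beta>. \<alpha> \<noteq> suc \<beta>"
  shows "base \<alpha> \<^bold>\<in> \<alpha>" "\<not> natural (base \<alpha>)" "\<eta> \<^bold>\<in> \<alpha> \<Longrightarrow> en \<eta> \<^bold>\<in> fin (base \<alpha>)"
proof -
  obtain \<xi> where \<xi>: "Ord \<xi>" "subset (en \<xi>) \<alpha>" "\<not> \<xi> \<^bold>\<in> \<alpha>"
    using \<alpha>(3) lim unfolding closed_def by blast
  \<comment> \<open>The witness \<xi> is at least \<alpha>, so \<open>en \<alpha>\<close> equals
    \<open>en \<xi>\<close> or precedes it.\<close>
  have sub: "subset (en \<alpha>) \<alpha>"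
    using Ord_linear[OF \<alpha>(1) \<xi>(1)] \<xi> lt_subset[OF en_lt[OF \<xi>(1)] fo_en[OF \<alpha>(1)] \<xi>(2) \<alpha>(1)] by blast
  have "\<exists>\<beta>. \<beta> \<^bold>\<in> \<alpha> \<and> subset (en \<alpha>) \<beta>"
  proof (cases "en \<alpha> = emp")
    case True
    have "emp \<^bold>\<in> \<alpha>" using not_natural_Ord[OF \<alpha>(1,2)] subsetD by simp
    then show ?thesis using True by (auto intro: subsetI)
  next
    case False
    obtain m where m: "m \<^bold>\<in> en \<alpha>" "\<And>x. x \<^bold>\<in> en \<alpha> \<Longrightarrow> x = m \<or> x \<^bold>\<in> m"
      using finite_max[OF _ _ False] fo_en[OF \<alpha>(1)] unfolding fo_def by blast
    have "m \<^bold>\<in> \<alpha>" using m(1) sub subsetD by blast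
    then have "suc m \<^bold>\<in> \<alpha>"
      using Ord_linear[of \<alpha> "suc m"] lim[of m] \<alpha>(1) Ord_in Ord_asym Ord_suc by (metis mem_suc not_mem_self)
    moreover have "subset (en \<alpha>) (suc m)" using m(2) by (auto intro: subsetI)
    ultimately show ?thesis by blast
  qed
  then obtain \<beta>1 where \<beta>1: "\<beta>1 \<^bold>\<in> \<alpha>" "subset (en \<alpha>) \<beta>1" by blast
  have d: "dfn (\<lambda>e. subset (en \<alpha>) (e 0))" by (intro dfn)
  obtain \<beta> where \<beta>: "Ord \<beta>" "subset (en \<alpha>) \<beta>" "\<And>\<gamma>. \<gamma> \<^bold>\<in> \<beta> \<Longrightarrow> \<not> subset (en \<alpha>) \<gamma>"
    "\<beta> = \<beta>1 \<or> \<beta> \<^bold>\<in> \<beta>1"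
    using Ord_least[OF d Ord_in[OF \<alpha>(1) \<beta>1(1)] \<beta>1(2)] by blast
  have "the_v (\<lambda>\<beta>. Ord \<beta> \<and> subset (en \<alpha>) \<beta> \<and> (\<forall>\<gamma>. \<gamma> \<^bold>\<in> \<beta> \<longrightarrow> \<not> subset (en \<alpha>) \<gamma>)) = \<beta>"
    by (rule the_v_eq) (use \<beta> Ord_linear in blast)+
  then have b: "base \<alpha> = \<beta>" unfolding base_def using lim by auto
  have b\<alpha>: "\<beta> \<^bold>\<in> \<alpha>" using \<beta>(4) \<beta>1(1) Ord_trans[OF \<alpha>(1)] by blast
  then show "base \<alpha> \<^bold>\<in> \<alpha>" using b by simp
  have fin: "en \<eta> \<^bold>\<in> fin \<beta>" if "\<eta> \<^bold>\<in> \<alpha>" for \<eta>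
    using lt_subset[OF en_lt[OF \<alpha>(1) that] fo_en \<beta>(2,1)] fo_en Ord_in[OF \<alpha>(1) that]
    unfolding fo_def by simp
  then show "\<eta> \<^bold>\<in> \<alpha> \<Longrightarrow> en \<eta> \<^bold>\<in> fin (base \<alpha>)" using b by simp
  \<comment> \<open>With a finite base, \<open>en\<close> would embed the infinite \<alpha> into a
    finite power set.\<close>
  show "\<not> natural (base \<alpha>)"
  proof
    assume "natural (base \<alpha>)"
    then have "finite_set (Pw \<beta>)" using b finite_Pw finite_natural by simp
    moreover have "card_le \<alpha> (Pw \<beta>)"
    proof (rule card_leI[of en])
      show "trm (\<lambda>e. en (e 0))" by (intro dfn)
      show "en \<eta> \<^bold>\<in> Pw \<beta>" if "\<eta> \<^bold>\<in> \<alpha>" for \<eta> using fin[OF that] by simp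
    qed (use en_inj Ord_in[OF \<alpha>(1)] in blast)
    ultimately show False using finite_card_le finite_Ord \<alpha> by blast
  qed
qed

lemma base_emb:
  assumes "Ord \<alpha>" "\<not> natural \<alpha>" "\<not> closed \<alpha>"
  shows "base \<alpha> \<^bold>\<in> \<alpha> \<and> \<not> natural (base \<alpha>) \<and> (\<forall>\<eta>. \<eta> \<^bold>\<in> \<alpha> \<longrightarrow> emb \<alpha> \<eta> \<^bold>\<in> fin (base \<alpha>)) \<and>
    (\<forall>\<eta> \<xi>. \<eta> \<^bold>\<in> \<alpha> \<and> \<xi> \<^bold>\<in> \<alpha> \<and> emb \<alpha> \<eta> = emb \<alpha> \<xi> \<longrightarrow> \<eta> = \<xi>)"
proof (cases "\<exists>\<beta>. \<alpha> = suc \<beta>")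
  case True
  then obtain \<beta> where \<beta>: "\<alpha> = suc \<beta>" by blast
  note b = base_suc[OF assms(1) \<beta>]
  have ne: "ins x emp \<noteq> emp" for x
    using mem_ins[of x x emp] mem_emp by metis
  have "base \<alpha> \<^bold>\<in> \<alpha>" unfolding b by (simp add: \<beta>)
  moreover have "\<not> natural (base \<alpha>)" unfolding b using assms(2) \<beta> natural_suc by blast
  moreover have "emb \<alpha> \<eta> \<^bold>\<in> fin (base \<alpha>)" if "\<eta> \<^bold>\<in> \<alpha>" for \<eta>
  proof -
    have "\<eta> = \<beta> \<or> \<eta> \<^bold>\<in> \<beta>" using that \<beta> by simp
    then show ?thesis unfolding b by (auto intro: subsetI)
  qed
  moreover have "\<eta> = \<xi>" if "emb \<alpha> \<eta> = emb \<alpha> \<xi>" for \<eta> \<xi>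
    using that ne[of \<eta>] ne[of \<xi>] ins_ins_eq(1)[of \<eta> \<xi>] unfolding b by (auto split: if_splits)
  ultimately show ?thesis by blast
next
  case False
  then have e: "emb \<alpha> \<eta> = en \<eta>" for \<eta> unfolding emb_def by simp
  have "\<alpha> \<noteq> suc \<beta>" for \<beta> using False by blast
  note l = base_limit[OF assms this]
  show ?thesis unfolding e using l en_inj Ord_in[OF assms(1)] by blast
qed

lemma code_props:
  assumes "Ord \<alpha>"
  shows "\<not> natural \<alpha> \<longrightarrow> (\<forall>D. D \<^bold>\<in> fin \<alpha> \<longrightarrow> code \<alpha> D \<^bold>\<in> \<alpha>) \<and>
    (\<forall>D E. D \<^bold>\<in> fin \<alpha> \<and> E \<^bold>\<in> fin \<alpha> \<and> code \<alpha> D = code \<alpha> E \<longrightarrow> D = E)"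
proof (rule Ord_induct[OF assms], intro dfn, intro impI)
  fix \<alpha>
  assume \<alpha>: "Ord \<alpha>" "\<not> natural \<alpha>" and IH: "\<And>\<beta>. \<beta> \<^bold>\<in> \<alpha> \<Longrightarrow> \<not> natural \<beta> \<longrightarrow> (\<forall>D. D \<^bold>\<in> fin \<beta> \<longrightarrow> code \<beta> D \<^bold>\<in> \<beta>) \<and>
    (\<forall>D E. D \<^bold>\<in> fin \<beta> \<and> E \<^bold>\<in> fin \<beta> \<and> code \<beta> D = code \<beta> E \<longrightarrow> D = E)"
  have t: "trm (\<lambda>e. recur code_step (e 0))" by (intro trm_recur trm_code_step dfn)
  let ?F = "\<lambda>D. if closed \<alpha> then idx D
     else app (app (lam \<alpha> (recur code_step)) (base \<alpha>)) (Rep D (\<lambda>\<eta>. app (app (lam \<alpha> (recur code_step)) (base \<alpha>)) (emb \<alpha> \<eta>)))"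
  have tF: "trm (\<lambda>e. ?F (e 0))" by (intro dfn trm_recur trm_code_step)
  have code: "code \<alpha> D = ?F D" if "D \<^bold>\<in> fin \<alpha>" for D
    unfolding code_def by (subst recur_eq[OF trm_code_step \<alpha>(1)], subst code_step_def)
      (rule app_lam[OF tF that])
  show "(\<forall>D. D \<^bold>\<in> fin \<alpha> \<longrightarrow> code \<alpha> D \<^bold>\<in> \<alpha>) \<and>
    (\<forall>D E. D \<^bold>\<in> fin \<alpha> \<and> E \<^bold>\<in> fin \<alpha> \<and> code \<alpha> D = code \<alpha> E \<longrightarrow> D = E)"
  proof (cases "closed \<alpha>")
    case True
    then have c: "code \<alpha> D = idx D" if "D \<^bold>\<in> fin \<alpha>" for D using code[OF that] by simp
    have "idx D \<^bold>\<in> \<alpha>" if "D \<^bold>\<in> fin \<alpha>" for D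
      using idx_props[OF fin_fo[OF \<alpha>(1) that]] True that unfolding closed_def by (metis mem_fin)
    moreover have "D = E" if "D \<^bold>\<in> fin \<alpha>" "E \<^bold>\<in> fin \<alpha>" "idx D = idx E" for D E
      using idx_props(2)[OF fin_fo[OF \<alpha>(1)]] that by metis
    ultimately show ?thesis using c by metis
  next
    case False
    let ?\<beta> = "base \<alpha>"
    have b: "?\<beta> \<^bold>\<in> \<alpha>" "\<not> natural ?\<beta>" and e: "\<And>\<eta>. \<eta> \<^bold>\<in> \<alpha> \<Longrightarrow> emb \<alpha> \<eta> \<^bold>\<in> fin ?\<beta>"
      "\<And>\<eta> \<xi>. \<eta> \<^bold>\<in> \<alpha> \<Longrightarrow> \<xi> \<^bold>\<in> \<alpha> \<Longrightarrow> emb \<alpha> \<eta> = emb \<alpha> \<xi> \<Longrightarrow> \<eta> = \<xi>"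
      using base_emb[OF \<alpha> False] by blast+
    have I: "\<And>D. D \<^bold>\<in> fin ?\<beta> \<Longrightarrow> code ?\<beta> D \<^bold>\<in> ?\<beta>"
      "\<And>D E. D \<^bold>\<in> fin ?\<beta> \<Longrightarrow> E \<^bold>\<in> fin ?\<beta> \<Longrightarrow> code ?\<beta> D = code ?\<beta> E \<Longrightarrow> D = E"
      using IH[OF b(1)] b(2) by blast+
    let ?k = "\<lambda>D. Rep D (\<lambda>\<eta>. code ?\<beta> (emb \<alpha> \<eta>))"
    have tk: "trm (\<lambda>e. code ?\<beta> (emb \<alpha> (e 0)))" by (intro dfn)
    note mk = mem_Rep[OF tk]
    have c: "code \<alpha> D = code ?\<beta> (?k D)" if "D \<^bold>\<in> fin \<alpha>" for D
      using code[OF that] False by (simp add: app_lam[OF t b(1)] code_def[symmetric])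
    have k: "?k D \<^bold>\<in> fin ?\<beta>" if D: "D \<^bold>\<in> fin \<alpha>" for D
    proof -
      have "subset (?k D) ?\<beta>"
        by (rule subsetI) (use D e(1) I(1) subsetD[of D \<alpha>] in \<open>auto simp: mk\<close>)
      then show ?thesis using D finite_Rep[OF _ tk] by simp
    qed
    have kinj: "subset D E" if D: "D \<^bold>\<in> fin \<alpha>" and E: "E \<^bold>\<in> fin \<alpha>" and eq: "?k D = ?k E" for D E
    proof (rule subsetI)
      fix x assume x: "x \<^bold>\<in> D"
      then have "code ?\<beta> (emb \<alpha> x) \<^bold>\<in> ?k E" unfolding eq[symmetric] mk by blast
      then obtain y where y: "y \<^bold>\<in> E" "code ?\<beta> (emb \<alpha> x) = code ?\<beta> (emb \<alpha> y)" unfolding mk by blast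
      have "x \<^bold>\<in> \<alpha>" "y \<^bold>\<in> \<alpha>" using x y(1) D E subsetD by auto
      then have "x = y" using I(2) e y(2) by blast
      then show "x \<^bold>\<in> E" using y(1) by simp
    qed
    have "code ?\<beta> (?k D) \<^bold>\<in> \<alpha>" if "D \<^bold>\<in> fin \<alpha>" for D
      using I(1)[OF k[OF that]] Ord_trans[OF \<alpha>(1) _ b(1)] by blast
    moreover have "D = E" if "D \<^bold>\<in> fin \<alpha>" "E \<^bold>\<in> fin \<alpha>" "code ?\<beta> (?k D) = code ?\<beta> (?k E)" for D E
    proof -
      have "?k D = ?k E" using I(2) k that by blast
      then have "subset D E" "subset E D" using kinj that by metis+
      then show ?thesis by (intro ext) (blast dest: subsetD)
    qed
    ultimately show ?thesis using c by metis
  qed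
qed

lemma code_in: "Ord \<alpha> \<Longrightarrow> \<not> natural \<alpha> \<Longrightarrow> finite_set D \<Longrightarrow> subset D \<alpha> \<Longrightarrow> code \<alpha> D \<^bold>\<in> \<alpha>"
  using code_props by simp

lemma code_inj: "Ord \<alpha> \<Longrightarrow> \<not> natural \<alpha> \<Longrightarrow> finite_set D \<Longrightarrow> subset D \<alpha> \<Longrightarrow> finite_set E \<Longrightarrow> subset E \<alpha> \<Longrightarrow>
    code \<alpha> D = code \<alpha> E \<Longrightarrow> D = E"
  using code_props by simp

lemma pcode_props:
  assumes \<alpha>: "Ord \<alpha>" "\<not> natural \<alpha>" and x: "x \<^bold>\<in> \<alpha>" "y \<^bold>\<in> \<alpha>"
  shows "pcode \<alpha> x y \<^bold>\<in> \<alpha>"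
    "x' \<^bold>\<in> \<alpha> \<Longrightarrow> y' \<^bold>\<in> \<alpha> \<Longrightarrow> pcode \<alpha> x y = pcode \<alpha> x' y' \<Longrightarrow> x = x' \<and> y = y'"
proof -
  have s: "subset (ins u emp) \<alpha>" "subset (ins u (ins v emp)) \<alpha>" "finite_set (ins u emp)"
    "finite_set (ins u (ins v emp))" if "u \<^bold>\<in> \<alpha>" "v \<^bold>\<in> \<alpha>" for u v
    using that by (auto intro: subsetI)
  have c: "code \<alpha> (ins u emp) \<^bold>\<in> \<alpha>" "code \<alpha> (ins u (ins v emp)) \<^bold>\<in> \<alpha>" if "u \<^bold>\<in> \<alpha>" "v \<^bold>\<in> \<alpha>" for u v
    using code_in[OF \<alpha>] s[OF that] by blast+
  show "pcode \<alpha> x y \<^bold>\<in> \<alpha>" unfolding pcode_def by (rule code_in[OF \<alpha> s(4,2)]) (use c x in blast)+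
  assume x': "x' \<^bold>\<in> \<alpha>" "y' \<^bold>\<in> \<alpha>" and eq: "pcode \<alpha> x y = pcode \<alpha> x' y'"
  have c1: "code \<alpha> (ins u emp) = code \<alpha> (ins u' emp) \<longleftrightarrow> u = u'"
    "code \<alpha> (ins u (ins v emp)) = code \<alpha> (ins u' emp) \<longleftrightarrow> u = u' \<and> v = u'"
    "code \<alpha> (ins u' emp) = code \<alpha> (ins u (ins v emp)) \<longleftrightarrow> u = u' \<and> v = u'"
    "code \<alpha> (ins u (ins v emp)) = code \<alpha> (ins u' (ins v' emp)) \<longleftrightarrow> u = u' \<and> v = v' \<or> u = v' \<and> v = u'"
    if "u \<^bold>\<in> \<alpha>" "v \<^bold>\<in> \<alpha>" "u' \<^bold>\<in> \<alpha>" "v' \<^bold>\<in> \<alpha>" for u v u' v'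
    using code_inj[OF \<alpha>] s that ins_ins_eq by metis+
  show "x = x' \<and> y = y'"
    using eq unfolding pcode_def c1(4)[OF c[OF x] c[OF x']] using c1[OF x x'] c1[OF x' x] by metis
qed

end

section \<open>Permutations with small support as finitary partitions\<close>

context set_language
begin

definition card :: "'v \<Rightarrow> 'v" where "card X = the_v (\<lambda>m. natural m \<and> card_eq X m)"

lemma trm_card [dfn]: "trm s \<Longrightarrow> trm (\<lambda>e. card (s e))"
  by (rule trm1) (unfold card_def, intro dfn)

definition below :: "'v \<Rightarrow> 'v \<Rightarrow> 'v \<Rightarrow> 'v" where
  "below R D x = Sep D (\<lambda>d. pr d x \<^bold>\<in> R \<and> d \<noteq> x)"

definition rank :: "'v \<Rightarrow> 'v \<Rightarrow> 'v \<Rightarrow> 'v" where "rank R D x = card (below R D x)"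

lemma trm_rank [dfn]: "trm s \<Longrightarrow> trm t \<Longrightarrow> trm u \<Longrightarrow> trm (\<lambda>e. rank (s e) (t e) (u e))"
  by (rule trm3) (unfold rank_def below_def, intro dfn)

definition moved :: "'v \<Rightarrow> 'v \<Rightarrow> 'v" where "moved A f = Sep A (\<lambda>x. app f x \<noteq> x)"

lemma trm_moved [dfn]: "trm s \<Longrightarrow> trm t \<Longrightarrow> trm (\<lambda>e. moved (s e) (t e))"
  by (rule trm2) (unfold moved_def, intro dfn)

definition Sn :: "'v \<Rightarrow> 'v \<Rightarrow> 'v" where
  "Sn n A = coll (\<lambda>f. bijection f A A \<and> card_le (moved A f) n)"

definition Pf :: "'v \<Rightarrow> 'v" where
  "Pf A = coll (\<lambda>P. partition P A \<and> (\<forall>b. b \<^bold>\<in> P \<longrightarrow> finite_set b))"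

text \<open>Points not covered by the family \<open>B\<close> become singletons, so that
  \<open>B\<close> can be recovered from the partition as far as its blocks with two or more points
  are concerned.\<close>

definition completion :: "'v \<Rightarrow> 'v \<Rightarrow> 'v" where
  "completion A B = un B (Rep (diff A (Uni B)) (\<lambda>x. ins x emp))"

lemma trm_completion [dfn]: "trm s \<Longrightarrow> trm t \<Longrightarrow> trm (\<lambda>e. completion (s e) (t e))"
  by (rule trm2) (unfold completion_def, intro dfn)

end

context ZF_model
begin

section \<open>Ranks, permutations with small support, finitary partitions\<close>

lemma card_finite: "finite_set X \<Longrightarrow> natural (card X) \<and> card_eq X (card X)"
proof -
  assume "finite_set X"
  then obtain m where m: "natural m" "card_eq X m" unfolding finite_set_def by blast
  have "card X = m" unfolding card_def
    by (rule the_v_eq) (use m natural_card_eq card_eq_sym card_eq_trans in blast)+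
  then show ?thesis using m by simp
qed

lemma mem_below [simp]: "d \<^bold>\<in> below R D x \<longleftrightarrow> d \<^bold>\<in> D \<and> pr d x \<^bold>\<in> R \<and> d \<noteq> x"
proof -
  have "dfn (\<lambda>e. pr (e 0) x \<^bold>\<in> R \<and> e 0 \<noteq> x)" by (intro dfn)
  then show ?thesis unfolding below_def by (simp add: mem_Sep)
qed

lemma finite_below: "finite_set D \<Longrightarrow> finite_set (below R D x)"
  by (rule finite_subset[of D]) (auto intro: subsetI)

text \<open>Membership in \<open>suc n\<close> means being at most \<open>n\<close>; this bound is
  why patterns are relations on \<open>suc n\<close>.\<close>

lemma rank_le:
  assumes "natural n" "card_le D n"
  shows "rank R D x \<^bold>\<in> suc n"
proof -
  have "finite_set D" using assms finite_card_le finite_natural by blast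
  from card_finite[OF finite_below[OF this]] have c: "natural (rank R D x)" "card_eq (below R D x) (rank R D x)"
    unfolding rank_def by blast+
  have "card_le (rank R D x) (below R D x)" using c(2) card_eq_sym card_eq_le by blast
  moreover have "card_le (below R D x) D" by (rule card_le_subset) (auto intro: subsetI)
  ultimately show ?thesis using natural_card_le[OF c(1) assms(1)] assms(2) card_le_trans by blast
qed

text \<open>By transitivity the points below \<open>x\<close> lie below \<open>y\<close>, and
  \<open>x\<close> is an additional one; equal ranks would contradict pigeonhole.\<close>

lemma rank_less:
  assumes "linear_order R A" "finite_set D" "x \<^bold>\<in> D" "pr x y \<^bold>\<in> R" "x \<noteq> y"
  shows "rank R D x \<noteq> rank R D y"
proof
  note R = linear_orderD[OF assms(1)]
  assume "rank R D x = rank R D y"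
  then have "card_eq (below R D x) (below R D y)"
    using card_finite[OF finite_below[OF assms(2)]] card_eq_sym card_eq_trans unfolding rank_def by metis
  then have le: "card_le (below R D y) (below R D x)" using card_eq_sym card_eq_le by blast
  have "subset (below R D x) (below R D y)"
    by (rule subsetI) (use R(2,3) assms(4,5) in \<open>simp; blast\<close>)
  then have eq: "below R D x = below R D y"
    using finite_not_card_le_proper[OF finite_below[OF assms(2)] _ le] by blast
  have "x \<^bold>\<in> below R D y" using assms by simp
  then show False unfolding eq[symmetric] by simp
qed

lemma rank_inj:
  assumes "linear_order R A" "finite_set D" "subset D A" "x \<^bold>\<in> D" "y \<^bold>\<in> D" "rank R D x = rank R D y"
  shows "x = y"
  using rank_less[OF assms(1,2)] linear_orderD(4)[OF assms(1)] assms(3-6) subsetD by metis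

lemma mem_moved [simp]: "x \<^bold>\<in> moved A f \<longleftrightarrow> x \<^bold>\<in> A \<and> app f x \<noteq> x"
proof -
  have "dfn (\<lambda>e. app f (e 0) \<noteq> e 0)" by (intro dfn)
  then show ?thesis unfolding moved_def by (simp add: mem_Sep)
qed

lemma is_moved_iff:
  assumes "is_function f A A"
  shows "is_moved D f A \<longleftrightarrow> D = moved A f"
proof -
  have "(\<exists>y. related f x y \<and> y \<noteq> x) \<longleftrightarrow> app f x \<noteq> x" if "x \<^bold>\<in> A" for x
    unfolding related_iff pr_mem_function[OF assms] using that by blast
  then show ?thesis unfolding is_moved_def set_eq_iff[of D] mem_moved by blast
qed

lemma function_subset: "is_function f X Y \<Longrightarrow> f \<^bold>\<in> Pw (Times X Y)"
  unfolding is_function_def relation_between_def is_pair_iff by (auto simp: subset_def)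

lemma bijection_function: "bijection f X Y \<Longrightarrow> is_function f X Y"
  unfolding bijection_def injection_def by blast

lemma function_eqI:
  assumes "is_function f X Y" "is_function g X Y" "\<And>x. x \<^bold>\<in> X \<Longrightarrow> app f x = app g x"
  shows "f = g"
  using function_eq_lam[OF assms(1)] function_eq_lam[OF assms(2)] lam_cong[OF assms(3)] by simp

lemma mem_Sn: "f \<^bold>\<in> Sn n A \<longleftrightarrow> bijection f A A \<and> card_le (moved A f) n"
  unfolding Sn_def
proof (rule coll_bounded, intro dfn)
  show "\<exists>B. \<forall>f. bijection f A A \<and> card_le (moved A f) n \<longrightarrow> f \<^bold>\<in> B"
    using function_subset bijection_function by blast
qed

lemma is_S_le_Sn: "is_S_le (Sn n A) n A"
proof -
  have "bijection f A A \<and> card_le (moved A f) n \<longleftrightarrow> bijection f A A \<and> (\<exists>D. is_moved D f A \<and> card_le D n)" for f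
    using is_moved_iff[OF bijection_function] by metis
  then show ?thesis unfolding is_S_le_def mem_Sn by blast
qed

lemma mem_Pf: "P \<^bold>\<in> Pf A \<longleftrightarrow> partition P A \<and> (\<forall>b. b \<^bold>\<in> P \<longrightarrow> finite_set b)"
  unfolding Pf_def
proof (rule coll_bounded, intro dfn)
  have "P \<^bold>\<in> Pw (Pw A)" if "partition P A" for P
    using that unfolding partition_def by (auto intro: subsetI)
  then show "\<exists>B. \<forall>P. partition P A \<and> (\<forall>b. b \<^bold>\<in> P \<longrightarrow> finite_set b) \<longrightarrow> P \<^bold>\<in> B" by blast
qed

lemma is_Part_fin_Pf: "is_Part_fin (Pf A) A"
  unfolding is_Part_fin_def mem_Pf by blast

lemma mem_completion:
  "b \<^bold>\<in> completion A B \<longleftrightarrow> b \<^bold>\<in> B \<or> (\<exists>x. x \<^bold>\<in> A \<and> \<not> x \<^bold>\<in> Uni B \<and> b = ins x emp)"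
proof -
  have "trm (\<lambda>e. ins (e 0) emp)" by (intro dfn)
  from mem_Rep[OF this] show ?thesis unfolding completion_def by simp
qed

lemma completion_in_Pf:
  assumes "\<And>b. b \<^bold>\<in> B \<Longrightarrow> finite_set b \<and> subset b A \<and> (\<exists>x. x \<^bold>\<in> b)"
    "\<And>b c x. b \<^bold>\<in> B \<Longrightarrow> c \<^bold>\<in> B \<Longrightarrow> x \<^bold>\<in> b \<Longrightarrow> x \<^bold>\<in> c \<Longrightarrow> b = c"
  shows "completion A B \<^bold>\<in> Pf A"
  unfolding mem_Pf partition_def
proof (intro conjI allI impI)
  fix b assume b: "b \<^bold>\<in> completion A B"
  then show "finite_set b" using assms(1) finite_ins finite_emp unfolding mem_completion by blast
  show "\<not> is_empty b" using b assms(1) mem_ins unfolding mem_completion is_empty_def by blast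
  show "subset b A"
  proof (cases "b \<^bold>\<in> B")
    case False
    then obtain x where "x \<^bold>\<in> A" "b = ins x emp" using b unfolding mem_completion by blast
    then show ?thesis by (simp add: subset_def)
  qed (use assms(1) in blast)
next
  have sing: "b = ins x emp \<and> \<not> x \<^bold>\<in> Uni B" if b: "b \<^bold>\<in> completion A B" "x \<^bold>\<in> b" and nb: "\<not> b \<^bold>\<in> B" for b x
  proof -
    obtain y where "\<not> y \<^bold>\<in> Uni B" "b = ins y emp" using b(1) nb unfolding mem_completion by blast
    then show ?thesis using b(2) by (simp del: mem_Uni)
  qed
  fix b c x assume *: "b \<^bold>\<in> completion A B \<and> c \<^bold>\<in> completion A B \<and> x \<^bold>\<in> b \<and> x \<^bold>\<in> c"
  show "b = c"
  proof (cases "x \<^bold>\<in> Uni B")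
    case True
    then have "b \<^bold>\<in> B" "c \<^bold>\<in> B" using sing * by blast+
    then show ?thesis using assms(2) * by blast
  next
    case False
    then have "\<not> b \<^bold>\<in> B" "\<not> c \<^bold>\<in> B" using * unfolding mem_Uni by blast+
    then have "b = ins x emp" "c = ins x emp" using sing * by blast+
    then show ?thesis by simp
  qed
next
  fix x assume x: "x \<^bold>\<in> A"
  show "\<exists>b. b \<^bold>\<in> completion A B \<and> x \<^bold>\<in> b"
  proof (cases "x \<^bold>\<in> Uni B")
    case True
    then show ?thesis unfolding mem_completion mem_Uni by blast
  next
    case False
    then have "ins x emp \<^bold>\<in> completion A B" using x unfolding mem_completion by blast
    then show ?thesis using mem_ins by blast
  qed
qed

lemma completion_block:
  assumes "b \<^bold>\<in> completion A B" "x \<^bold>\<in> b" "y \<^bold>\<in> b" "x \<noteq> y"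
  shows "b \<^bold>\<in> B"
  using assms unfolding mem_completion by auto

lemma emp_neq_suc [simp]: "emp \<noteq> suc x" "suc x \<noteq> emp"
  using mem_suc[of x x] mem_emp by metis+

end

text \<open>
  The room for the encoding of permutations: \<open>q\<close> embeds \<open>n + 1\<close> copies of a finite set of
  codewords into \<open>A\<close>. At least one copy is disjoint from the support of a given permutation.
\<close>

locale encoding = ZF_model mem for mem :: "'v \<Rightarrow> 'v \<Rightarrow> bool" (infix \<open>\<^bold>\<in>\<close> 50) +
  fixes A R n q :: 'v
  assumes lin: "linear_order R A" and nat: "natural n"
    and q: "injection q (Times (suc n) (Times (suc (suc (suc (suc emp)))) (Pw (Times (suc n) (suc n))))) A"
begin

text \<open>Four kinds of codewords: tag 0 carries the pattern, tags 1 and 2 give the two marker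
  points of each copy, and tag 3 gives the companion that completes the block naming the
  pattern.\<close>

abbreviation "tags \<equiv> suc (suc (suc (suc emp)))"
abbreviation "patterns \<equiv> Pw (Times (suc n) (suc n))"

definition cell :: "'v \<Rightarrow> 'v \<Rightarrow> 'v \<Rightarrow> 'v" where "cell i t p = app q (pr i (pr t p))"

definition avoids :: "'v \<Rightarrow> 'v \<Rightarrow> bool" where
  "avoids D i \<longleftrightarrow> (\<forall>t p. t \<^bold>\<in> tags \<and> p \<^bold>\<in> patterns \<longrightarrow> \<not> cell i t p \<^bold>\<in> D)"

text \<open>The least suitable index, rather than an arbitrary one, keeps the selection
  definable.\<close>

definition copy :: "'v \<Rightarrow> 'v" where
  "copy D = the_v (\<lambda>i. i \<^bold>\<in> suc n \<and> avoids D i \<and> (\<forall>j. j \<^bold>\<in> i \<longrightarrow> \<not> avoids D j))"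

text \<open>Recording ranks instead of points makes one finite stock of patterns serve all supports,
  so a single codeword can name a pattern.\<close>

definition pattern :: "'v \<Rightarrow> 'v" where
  "pattern f = Sep (Times (suc n) (suc n))
     (\<lambda>p. \<exists>x. x \<^bold>\<in> moved A f \<and> p = pr (rank R (moved A f) x) (rank R (moved A f) (app f x)))"

text \<open>With two points from every copy, the copy avoided by the support contributes both to the
  symmetric difference. So the first block is nontrivial even for the identity, and it meets the
  marker, which the second block does not.\<close>

definition marker :: 'v where
  "marker = un (Rep (suc n) (\<lambda>i. cell i (suc emp) emp)) (Rep (suc n) (\<lambda>i. cell i (suc (suc emp)) emp))"

definition block1 :: "'v \<Rightarrow> 'v" where
  "block1 f = un (diff (moved A f) marker) (diff marker (moved A f))"

definition block2 :: "'v \<Rightarrow> 'v" where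
  "block2 f = ins (cell (copy (moved A f)) (suc (suc (suc emp))) emp)
     (ins (cell (copy (moved A f)) emp (pattern f)) emp)"

definition encode :: "'v \<Rightarrow> 'v" where
  "encode f = completion A (ins (block1 f) (ins (block2 f) emp))"

lemma trm_cell [dfn]: "trm s \<Longrightarrow> trm t \<Longrightarrow> trm u \<Longrightarrow> trm (\<lambda>e. cell (s e) (t e) (u e))"
  unfolding cell_def by (intro dfn)

lemma dfn_avoids [dfn]: "trm s \<Longrightarrow> trm t \<Longrightarrow> dfn (\<lambda>e. avoids (s e) (t e))"
  by (rule dfn2) (unfold avoids_def, intro dfn)

lemma trm_encode: "trm s \<Longrightarrow> trm (\<lambda>e. encode (s e))"
  by (rule trm1) (unfold encode_def block1_def block2_def copy_def pattern_def, intro dfn)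

lemma cell_in: "i \<^bold>\<in> suc n \<Longrightarrow> t \<^bold>\<in> tags \<Longrightarrow> p \<^bold>\<in> patterns \<Longrightarrow> cell i t p \<^bold>\<in> A"
  unfolding cell_def by (rule injection_app(1)[OF q]) (simp del: mem_suc mem_Pw)

lemma cell_inj:
  assumes "i \<^bold>\<in> suc n" "t \<^bold>\<in> tags" "p \<^bold>\<in> patterns" "i' \<^bold>\<in> suc n" "t' \<^bold>\<in> tags" "p' \<^bold>\<in> patterns"
    "cell i t p = cell i' t' p'"
  shows "i = i' \<and> t = t' \<and> p = p'"
proof -
  have "pr i (pr t p) = pr i' (pr t' p')"
    by (rule injection_app(2)[OF q _ _ assms(7)[unfolded cell_def]])
      (use assms(1-6) in \<open>simp_all del: mem_suc mem_Pw\<close>)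
  then show ?thesis by simp
qed

lemma emp_pattern: "emp \<^bold>\<in> patterns"
  by (auto intro: subsetI)

text \<open>If all \<open>n\<close> + 1 disjoint copies met \<open>D\<close>, the least hit in each
  copy would give an injection of \<open>suc n\<close> into a set of size at most
  \<open>n\<close>.\<close>

lemma ex_avoids:
  assumes D: "card_le D n" "subset D A"
  shows "\<exists>i. i \<^bold>\<in> suc n \<and> avoids D i"
proof (rule ccontr)
  assume *: "\<nexists>i. i \<^bold>\<in> suc n \<and> avoids D i"
  have fin: "finite_set D" using D(1) nat finite_card_le finite_natural by blast
  have d: "dfn (\<lambda>e. \<exists>t p. t \<^bold>\<in> tags \<and> p \<^bold>\<in> patterns \<and> e 0 = cell i t p)" for i by (intro dfn)
  let ?H = "\<lambda>i. Sep D (\<lambda>x. \<exists>t p. t \<^bold>\<in> tags \<and> p \<^bold>\<in> patterns \<and> x = cell i t p)"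
  note m = mem_Sep[OF d]
  have H: "lst R (?H i) \<^bold>\<in> ?H i" if i: "i \<^bold>\<in> suc n" for i
  proof (rule lst_least(1)[OF lin])
    have sub: "subset (?H i) D" by (rule subsetI) (simp only: m)
    show "finite_set (?H i)" using fin sub by (rule finite_subset)
    show "subset (?H i) A" using sub D(2) unfolding subset_def by blast
    obtain x where "x \<^bold>\<in> ?H i" using * i unfolding avoids_def m by blast
    then show "?H i \<noteq> emp" using mem_emp by metis
  qed
  have "card_le (suc n) D"
  proof (rule card_leI[of "\<lambda>i. lst R (?H i)"])
    show "trm (\<lambda>e. lst R (?H (e 0)))" by (intro dfn)
    show "lst R (?H i) \<^bold>\<in> D" if "i \<^bold>\<in> suc n" for i using H[OF that] unfolding m by blast
    show "i = j" if ij: "i \<^bold>\<in> suc n" "j \<^bold>\<in> suc n" "lst R (?H i) = lst R (?H j)" for i j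
    proof -
      obtain t p where tp: "t \<^bold>\<in> tags" "p \<^bold>\<in> patterns" "lst R (?H i) = cell i t p"
        using H[OF ij(1)] unfolding m by blast
      obtain t' p' where tp': "t' \<^bold>\<in> tags" "p' \<^bold>\<in> patterns" "lst R (?H j) = cell j t' p'"
        using H[OF ij(2)] unfolding m by blast
      show ?thesis using cell_inj[OF ij(1) tp(1,2) ij(2) tp'(1,2)] ij(3) tp(3) tp'(3) by metis
    qed
  qed
  then show False using D(1) card_le_trans suc_not_card_le nat by blast
qed

lemma copy_props:
  assumes D: "card_le D n" "subset D A"
  shows "copy D \<^bold>\<in> suc n \<and> avoids D (copy D)"
proof -
  obtain i where i: "i \<^bold>\<in> suc n" "avoids D i" using ex_avoids[OF D] by blast
  have d: "dfn (\<lambda>e. avoids D (e 0))" by (intro dfn)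
  have o: "Ord (suc n)" using natural_Ord nat by simp
  obtain j where j: "Ord j" "avoids D j" "\<forall>k. k \<^bold>\<in> j \<longrightarrow> \<not> avoids D k" "j = i \<or> j \<^bold>\<in> i"
    using Ord_least[OF d Ord_in[OF o i(1)] i(2)] by blast
  have jn: "j \<^bold>\<in> suc n" using j(4) i(1) Ord_trans[OF o] by blast
  have "copy D = j" unfolding copy_def
    by (rule the_v_eq) (use j(1-3) jn Ord_linear Ord_in[OF o] in blast)+
  then show ?thesis using j jn by simp
qed

lemma Sn_props:
  assumes "f \<^bold>\<in> Sn n A"
  shows "bijection f A A" "card_le (moved A f) n" "subset (moved A f) A" "finite_set (moved A f)"
    "x \<^bold>\<in> moved A f \<Longrightarrow> app f x \<^bold>\<in> moved A f"
proof -
  show f: "bijection f A A" and c: "card_le (moved A f) n" using assms unfolding mem_Sn by blast+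
  show "subset (moved A f) A" by (auto intro: subsetI)
  show "finite_set (moved A f)" using c finite_card_le finite_natural nat by blast
  show "x \<^bold>\<in> moved A f \<Longrightarrow> app f x \<^bold>\<in> moved A f"
    using bijection_app(1,2)[OF f] unfolding mem_moved by blast
qed

lemma pattern_pattern: "pattern f \<^bold>\<in> patterns"
proof -
  have d: "dfn (\<lambda>e. \<exists>x. x \<^bold>\<in> moved A f \<and> e 0 = pr (rank R (moved A f) x) (rank R (moved A f) (app f x)))"
    by (intro dfn)
  show ?thesis unfolding mem_Pw pattern_def by (rule subsetI) (simp only: mem_Sep[OF d])
qed

lemma mem_pattern:
  assumes "f \<^bold>\<in> Sn n A"
  shows "p \<^bold>\<in> pattern f \<longleftrightarrow>
    (\<exists>x. x \<^bold>\<in> moved A f \<and> p = pr (rank R (moved A f) x) (rank R (moved A f) (app f x)))"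
proof -
  have d: "dfn (\<lambda>e. \<exists>x. x \<^bold>\<in> moved A f \<and> e 0 = pr (rank R (moved A f) x) (rank R (moved A f) (app f x)))"
    by (intro dfn)
  show ?thesis unfolding pattern_def mem_Sep[OF d] mem_Times
    using rank_le[OF nat Sn_props(2)[OF assms]] by blast
qed

lemma mem_marker: "x \<^bold>\<in> marker \<longleftrightarrow>
    (\<exists>i. i \<^bold>\<in> suc n \<and> (x = cell i (suc emp) emp \<or> x = cell i (suc (suc emp)) emp))"
proof -
  have t: "trm (\<lambda>e. cell (e 0) (suc emp) emp)" "trm (\<lambda>e. cell (e 0) (suc (suc emp)) emp)" by (intro dfn)+
  show ?thesis unfolding marker_def mem_un mem_Rep[OF t(1)] mem_Rep[OF t(2)] by blast
qed

lemma tags: "emp \<^bold>\<in> tags" "suc emp \<^bold>\<in> tags" "suc (suc emp) \<^bold>\<in> tags" "suc (suc (suc emp)) \<^bold>\<in> tags"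
  by simp_all

text \<open>All that the decoding needs: both blocks have two points, they are disjoint, and meeting
  the marker tells the first from the second.\<close>

lemma blocks:
  assumes "f \<^bold>\<in> Sn n A"
  shows "\<exists>x y. x \<^bold>\<in> block1 f \<and> y \<^bold>\<in> block1 f \<and> x \<noteq> y \<and> x \<^bold>\<in> marker"
    "\<exists>x y. x \<^bold>\<in> block2 f \<and> y \<^bold>\<in> block2 f \<and> x \<noteq> y"
    "x \<^bold>\<in> block2 f \<Longrightarrow> \<not> x \<^bold>\<in> marker" "x \<^bold>\<in> block2 f \<Longrightarrow> \<not> x \<^bold>\<in> block1 f"
    "finite_set (block1 f)" "finite_set (block2 f)" "subset (block1 f) A" "subset (block2 f) A"
proof -
  note f = Sn_props[OF assms]
  let ?i = "copy (moved A f)"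
  have i: "?i \<^bold>\<in> suc n" and av: "avoids (moved A f) ?i" using copy_props[OF f(2,3)] by blast+
  have cell_av: "\<not> cell ?i t p \<^bold>\<in> moved A f" if "t \<^bold>\<in> tags" "p \<^bold>\<in> patterns" for t p
    using av that unfolding avoids_def by blast
  have cell_iff: "cell i t p = cell j s r \<longleftrightarrow> i = j \<and> t = s \<and> p = r"
    if "i \<^bold>\<in> suc n" "t \<^bold>\<in> tags" "p \<^bold>\<in> patterns" "j \<^bold>\<in> suc n" "s \<^bold>\<in> tags" "r \<^bold>\<in> patterns" for i t p j s r
    using cell_inj[OF that] by blast
  have marker_A: "subset marker A"
    using cell_in tags emp_pattern by (auto simp: subset_def mem_marker simp del: mem_suc mem_Pw)
  have b1: "cell ?i (suc emp) emp \<^bold>\<in> block1 f" "cell ?i (suc (suc emp)) emp \<^bold>\<in> block1 f"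
    unfolding block1_def mem_un mem_diff mem_marker
    using cell_av[OF _ emp_pattern] tags i by blast+
  have "cell ?i (suc emp) emp \<noteq> cell ?i (suc (suc emp)) emp"
    using cell_iff[OF i tags(2) emp_pattern i tags(3) emp_pattern] by simp
  then show "\<exists>x y. x \<^bold>\<in> block1 f \<and> y \<^bold>\<in> block1 f \<and> x \<noteq> y \<and> x \<^bold>\<in> marker"
    using b1 i unfolding mem_marker by blast
  have "cell ?i (suc (suc (suc emp))) emp \<noteq> cell ?i emp (pattern f)"
    using cell_iff[OF i tags(4) emp_pattern i tags(1) pattern_pattern] by simp
  then show "\<exists>x y. x \<^bold>\<in> block2 f \<and> y \<^bold>\<in> block2 f \<and> x \<noteq> y"
    unfolding block2_def mem_ins by blast
  have c: "cell ?i emp (pattern f) \<noteq> cell j (suc emp) emp" "cell ?i emp (pattern f) \<noteq> cell j (suc (suc emp)) emp"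
    "cell ?i (suc (suc (suc emp))) emp \<noteq> cell j (suc emp) emp"
    "cell ?i (suc (suc (suc emp))) emp \<noteq> cell j (suc (suc emp)) emp" if "j \<^bold>\<in> suc n" for j
    using cell_iff[OF i _ _ that] tags emp_pattern pattern_pattern emp_neq_suc suc_inj by metis+
  show m: "\<not> x \<^bold>\<in> marker" if "x \<^bold>\<in> block2 f" for x
    using that c unfolding block2_def mem_ins mem_marker using mem_emp by metis
  have nm: "\<not> x \<^bold>\<in> moved A f" if "x \<^bold>\<in> block2 f" for x
    using that cell_av tags emp_pattern pattern_pattern unfolding block2_def mem_ins using mem_emp by metis
  show "\<not> x \<^bold>\<in> block1 f" if "x \<^bold>\<in> block2 f" for x
    using m[OF that] nm[OF that] unfolding block1_def by simp
  have "finite_set marker"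
    unfolding marker_def by (intro finite_un finite_Rep finite_natural natural_suc nat dfn)
  then have "finite_set (un (moved A f) marker)" using f(4) finite_un by blast
  then show "finite_set (block1 f)"
    by (rule finite_subset) (auto intro!: subsetI simp: block1_def)
  show "finite_set (block2 f)" unfolding block2_def by simp
  show "subset (block1 f) A" using marker_A by (auto simp: subset_def block1_def)
  show "subset (block2 f) A"
    unfolding block2_def using cell_in[OF i] tags emp_pattern pattern_pattern
    by (auto simp: subset_def simp del: mem_suc mem_Pw)
qed

lemma blocks_encode: "block1 f \<^bold>\<in> encode f" "block2 f \<^bold>\<in> encode f"
  unfolding encode_def mem_completion mem_ins by blast+

lemma encode_in: "f \<^bold>\<in> Sn n A \<Longrightarrow> encode f \<^bold>\<in> Pf A"
  unfolding encode_def
proof (rule completion_in_Pf)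
  assume f: "f \<^bold>\<in> Sn n A"
  note b = blocks[OF f]
  fix b assume "b \<^bold>\<in> ins (block1 f) (ins (block2 f) emp)"
  then have *: "b = block1 f \<or> b = block2 f" by simp
  then show "finite_set b \<and> subset b A \<and> (\<exists>x. x \<^bold>\<in> b)" using b(1,2,5-8) by blast
  fix c x assume "c \<^bold>\<in> ins (block1 f) (ins (block2 f) emp)"
  then have "c = block1 f \<or> c = block2 f" by simp
  then show "x \<^bold>\<in> b \<Longrightarrow> x \<^bold>\<in> c \<Longrightarrow> b = c" using * b(4) by blast
qed

lemma encode_inj:
  assumes f: "f \<^bold>\<in> Sn n A" and g: "g \<^bold>\<in> Sn n A" and eq: "encode f = encode g"
  shows "f = g"
proof -
  note bf = blocks[OF f] and bg = blocks[OF g]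
  note pf = Sn_props[OF f] and pg = Sn_props[OF g]
  have "block1 f \<^bold>\<in> encode g" "block2 f \<^bold>\<in> encode g"
    using blocks_encode[of f] unfolding eq by blast+
  \<comment> \<open>All blocks of \<open>encode g\<close> other than its two special ones are
    singletons.\<close>
  then have "block1 f \<^bold>\<in> ins (block1 g) (ins (block2 g) emp)" "block2 f \<^bold>\<in> ins (block1 g) (ins (block2 g) emp)"
    unfolding encode_def using completion_block bf(1,2) by blast+
  then have *: "block1 f = block1 g \<or> block1 f = block2 g" "block2 f = block1 g \<or> block2 f = block2 g"
    by simp_all
  \<comment> \<open>The marker rules out that the roles of the two blocks are exchanged.\<close>
  have b1: "block1 f = block1 g" using *(1) bf(1) bg(3) by metis
  have b2: "block2 f = block2 g" using *(2) bg(1) bf(3) by metis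
  \<comment> \<open>A second symmetric difference with the marker restores the support.\<close>
  have "x \<^bold>\<in> moved A f \<longleftrightarrow> (x \<^bold>\<in> marker \<longleftrightarrow> \<not> x \<^bold>\<in> block1 f)" for x
    unfolding block1_def mem_un mem_diff by blast
  moreover have "x \<^bold>\<in> moved A g \<longleftrightarrow> (x \<^bold>\<in> marker \<longleftrightarrow> \<not> x \<^bold>\<in> block1 g)" for x
    unfolding block1_def mem_un mem_diff by blast
  ultimately have D: "moved A f = moved A g" using b1 by (intro ext) metis
  have i: "copy (moved A f) \<^bold>\<in> suc n" using copy_props[OF pf(2,3)] by blast
  \<comment> \<open>Equal pairs could also match crosswise, but the tags 0 and 3 differ.\<close>
  have "cell (copy (moved A f)) emp (pattern f) = cell (copy (moved A f)) emp (pattern g)"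
    using b2 unfolding block2_def D[symmetric] ins_ins_eq
    using cell_inj[OF i tags(4) emp_pattern i tags(1) pattern_pattern] emp_neq_suc by metis
  then have pat: "pattern f = pattern g"
    using cell_inj[OF i tags(1) pattern_pattern i tags(1) pattern_pattern] by blast
  show "f = g"
  proof (rule function_eqI)
    show "is_function f A A" "is_function g A A" using pf(1) pg(1) bijection_function by blast+
    fix x assume x: "x \<^bold>\<in> A"
    show "app f x = app g x"
    proof (cases "x \<^bold>\<in> moved A f")
      case False
      moreover have "\<not> x \<^bold>\<in> moved A g" using False D by simp
      ultimately show ?thesis using x by simp
    next
      case True
      \<comment> \<open>The common pattern gives a \<open>y\<close> whose rank is that of
        \<open>x\<close> and whose value under \<open>g\<close> has the rank of
        \<open>app f x\<close>. Ranks being injective on the common support, \<open>y\<close> is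
        \<open>x\<close> and the values agree.\<close>
      let ?r = "rank R (moved A f)"
      have "pr (?r x) (?r (app f x)) \<^bold>\<in> pattern g"
        unfolding pat[symmetric] mem_pattern[OF f] using True by blast
      then obtain y where y: "y \<^bold>\<in> moved A g" "?r x = ?r y" "?r (app f x) = ?r (app g y)"
        unfolding mem_pattern[OF g] D by auto
      have "x = y" using rank_inj[OF lin pf(4,3) True _ y(2)] y(1) D by simp
      then show ?thesis
        using rank_inj[OF lin pf(4,3) pf(5)[OF True] _ y(3)] pg(5)[OF y(1)] D by simp
    qed
  qed
qed

text \<open>The partition into singletons has no block with two points, unlike every code. It is the
  missed value that the pigeonhole step requires.\<close>

lemma discrete_not_encode:
  "completion A emp \<^bold>\<in> Pf A" "f \<^bold>\<in> Sn n A \<Longrightarrow> encode f \<noteq> completion A emp"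
proof -
  show "completion A emp \<^bold>\<in> Pf A" by (rule completion_in_Pf) auto
  assume "f \<^bold>\<in> Sn n A"
  from blocks(1)[OF this] obtain x y where xy: "x \<^bold>\<in> block1 f" "y \<^bold>\<in> block1 f" "x \<noteq> y" by blast
  show "encode f \<noteq> completion A emp"
  proof
    assume "encode f = completion A emp"
    then have "block1 f \<^bold>\<in> completion A emp" using blocks_encode(1)[of f] by simp
    from completion_block[OF this xy] show False by simp
  qed
qed

end

section \<open>A bijection embeds the ordinals\<close>

locale collision = encoding mem A R n q for mem :: "'v \<Rightarrow> 'v \<Rightarrow> bool" (infix \<open>\<^bold>\<in>\<close> 50) and A R n q +
  fixes b :: 'v
  assumes b: "bijection b (Sn n A) (Pf A)"
begin

definition decode :: "'v \<Rightarrow> 'v" where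
  "decode P = the_v (\<lambda>f. f \<^bold>\<in> Sn n A \<and> app b f = P)"

definition inside :: "'v \<Rightarrow> 'v" where
  "inside W = Sep (Sn n A) (\<lambda>f. subset (moved A f) W)"

definition escape :: "'v \<Rightarrow> 'v" where
  "escape W = ins (decode (completion A emp)) (Rep (inside W) (\<lambda>f. decode (encode f)))"

definition new_fin :: "'v \<Rightarrow> 'v" where
  "new_fin W = lst R (diff (Uni (Rep (escape W) (moved A))) W)"

definition img :: "'v \<Rightarrow> 'v \<Rightarrow> 'v" where "img \<alpha> u = Rep \<alpha> (app u)"

text \<open>Two points labelled (\<xi>, 0) and (\<xi>, 1) through the pairing on \<alpha>; for
  distinct \<xi> these pairs are disjoint.\<close>

definition duo :: "'v \<Rightarrow> 'v \<Rightarrow> 'v \<Rightarrow> 'v" where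
  "duo \<alpha> u \<xi> = ins (app u (pcode \<alpha> \<xi> emp)) (ins (app u (pcode \<alpha> \<xi> (suc emp))) emp)"

text \<open>The embedding of subsets of \<alpha> into finitary partitions: \<open>Y\<close> consists
  of those \<xi> whose pair is a block.\<close>

definition part :: "'v \<Rightarrow> 'v \<Rightarrow> 'v \<Rightarrow> 'v" where
  "part \<alpha> u Y = completion A (Rep Y (duo \<alpha> u))"

text \<open>Points are replaced by their indices under \<open>u\<close>. Fixed points are left out,
  which makes the set finite and \<open>code \<alpha>\<close> applicable.\<close>

definition graph :: "'v \<Rightarrow> 'v \<Rightarrow> 'v \<Rightarrow> 'v" where
  "graph \<alpha> u f = Sep \<alpha> (\<lambda>p. \<exists>\<xi> \<eta>. \<xi> \<^bold>\<in> \<alpha> \<and> \<eta> \<^bold>\<in> \<alpha> \<and> p = pcode \<alpha> \<xi> \<eta> \<and>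
     app u \<xi> \<noteq> app u \<eta> \<and> app f (app u \<xi>) = app u \<eta>)"

text \<open>Sending \<open>Y\<close> to the code of its permutation is defined only when that
  permutation is supported in the image of \<open>u\<close>, and it is injective there. The diagonal
  set of this partial map must lie outside its domain.\<close>

definition diag :: "'v \<Rightarrow> 'v \<Rightarrow> 'v" where
  "diag \<alpha> u = Sep \<alpha> (\<lambda>\<zeta>. \<exists>Y. subset Y \<alpha> \<and> subset (moved A (decode (part \<alpha> u Y))) (img \<alpha> u) \<and>
     code \<alpha> (graph \<alpha> u (decode (part \<alpha> u Y))) = \<zeta> \<and> \<not> \<zeta> \<^bold>\<in> Y)"

definition new_inf :: "'v \<Rightarrow> 'v \<Rightarrow> 'v" where
  "new_inf \<alpha> u = lst R (diff (moved A (decode (part \<alpha> u (diag \<alpha> u)))) (img \<alpha> u))"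

definition step :: "'v \<Rightarrow> 'v \<Rightarrow> 'v" where
  "step \<alpha> u = (if natural \<alpha> then new_fin (img \<alpha> u) else new_inf \<alpha> u)"

lemma trm_decode [dfn]: "trm s \<Longrightarrow> trm (\<lambda>e. decode (s e))"
  by (rule trm1) (unfold decode_def, intro dfn)

lemma trm_inside [dfn]: "trm s \<Longrightarrow> trm (\<lambda>e. inside (s e))"
  by (rule trm1) (unfold inside_def, intro dfn)

lemma trm_img [dfn]: "trm s \<Longrightarrow> trm t \<Longrightarrow> trm (\<lambda>e. img (s e) (t e))"
  by (rule trm2) (unfold img_def, intro dfn)

lemma trm_duo [dfn]: "trm s \<Longrightarrow> trm t \<Longrightarrow> trm r \<Longrightarrow> trm (\<lambda>e. duo (s e) (t e) (r e))"
  by (rule trm3) (unfold duo_def, intro dfn)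

lemma trm_part [dfn]: "trm s \<Longrightarrow> trm t \<Longrightarrow> trm r \<Longrightarrow> trm (\<lambda>e. part (s e) (t e) (r e))"
  by (rule trm3) (unfold part_def, intro dfn)

lemma trm_graph [dfn]: "trm s \<Longrightarrow> trm t \<Longrightarrow> trm r \<Longrightarrow> trm (\<lambda>e. graph (s e) (t e) (r e))"
  by (rule trm3) (unfold graph_def, intro dfn)

lemma trm_diag [dfn]: "trm s \<Longrightarrow> trm t \<Longrightarrow> trm (\<lambda>e. diag (s e) (t e))"
  by (rule trm2) (unfold diag_def, intro dfn)

lemma trm_step: "trm (\<lambda>e. step (e 0) (e 1))"
  unfolding step_def new_fin_def new_inf_def escape_def by (intro dfn trm_encode)

lemma decode_props:
  assumes "P \<^bold>\<in> Pf A"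
  shows "decode P \<^bold>\<in> Sn n A" "app b (decode P) = P"
proof -
  obtain f where f: "f \<^bold>\<in> Sn n A" "app b f = P" using bijection_app(3)[OF b assms] by blast
  have "decode P = f" unfolding decode_def
    by (rule the_v_eq) (use f bijection_app(2)[OF b] in blast)+
  then show "decode P \<^bold>\<in> Sn n A" "app b (decode P) = P" using f by simp_all
qed

lemma decode_inj: "P \<^bold>\<in> Pf A \<Longrightarrow> Q \<^bold>\<in> Pf A \<Longrightarrow> decode P = decode Q \<Longrightarrow> P = Q"
  using decode_props(2) by metis

lemma mem_inside: "f \<^bold>\<in> inside W \<longleftrightarrow> f \<^bold>\<in> Sn n A \<and> subset (moved A f) W"
proof -
  have d: "dfn (\<lambda>e. subset (moved A (e 0)) W)" by (intro dfn)
  show ?thesis unfolding inside_def mem_Sep[OF d] by blast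
qed

section \<open>Permutations with prescribed support and the step at a finite ordinal\<close>

lemma Sn_eqI:
  assumes "f \<^bold>\<in> Sn n A" "g \<^bold>\<in> Sn n A" "\<And>x. x \<^bold>\<in> moved A f \<Longrightarrow> app f x = app g x"
    "\<And>x. x \<^bold>\<in> moved A g \<Longrightarrow> app f x = app g x"
  shows "f = g"
proof (rule function_eqI)
  show "is_function f A A" "is_function g A A" using Sn_props(1) assms bijection_function by blast+
  fix x assume "x \<^bold>\<in> A"
  then show "app f x = app g x" using assms(3,4)[of x] by (cases "app f x = x"; cases "app g x = x") auto
qed

text \<open>A permutation maps its support to itself, so one supported in \<open>W\<close> is
  determined by its part in \<open>W\<close> times \<open>W\<close>.\<close>

lemma finite_inside:
  assumes "finite_set W"
  shows "finite_set (inside W)"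
proof (rule finite_card_le)
  show "finite_set (Pw (Times W W))" using assms finite_Pw finite_Times by blast
  have d: "dfn (\<lambda>e. e 0 \<^bold>\<in> f)" for f by (intro dfn)
  have m: "p \<^bold>\<in> Sep (Times W W) (\<lambda>p. p \<^bold>\<in> f) \<longleftrightarrow> p \<^bold>\<in> Times W W \<and> p \<^bold>\<in> f" for f p
    by (rule mem_Sep[OF d])
  have agree: "app f x = app g x"
    if f: "f \<^bold>\<in> inside W" and g: "g \<^bold>\<in> inside W" and eq: "Sep (Times W W) (\<lambda>p. p \<^bold>\<in> f) = Sep (Times W W) (\<lambda>p. p \<^bold>\<in> g)"
      and x: "x \<^bold>\<in> moved A f" for f g x
  proof -
    have fS: "f \<^bold>\<in> Sn n A" "subset (moved A f) W" and gS: "g \<^bold>\<in> Sn n A" using f g unfolding mem_inside by blast+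
    have "x \<^bold>\<in> W" "app f x \<^bold>\<in> W" using x Sn_props(5)[OF fS(1) x] fS(2) subsetD by blast+
    moreover have "x \<^bold>\<in> A" using x by simp
    moreover note ff = pr_mem_function[OF bijection_function[OF Sn_props(1)[OF fS(1)]]]
    ultimately have "pr x (app f x) \<^bold>\<in> Sep (Times W W) (\<lambda>p. p \<^bold>\<in> f)" unfolding m mem_Times by blast
    then have "pr x (app f x) \<^bold>\<in> g" unfolding eq m by blast
    then show ?thesis unfolding pr_mem_function[OF bijection_function[OF Sn_props(1)[OF gS]]] by simp
  qed
  show "card_le (inside W) (Pw (Times W W))"
  proof (rule card_leI[of "\<lambda>f. Sep (Times W W) (\<lambda>p. p \<^bold>\<in> f)"])
    show "trm (\<lambda>e. Sep (Times W W) (\<lambda>p. p \<^bold>\<in> e 0))" by (intro dfn)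
    show "Sep (Times W W) (\<lambda>p. p \<^bold>\<in> f) \<^bold>\<in> Pw (Times W W)" for f
      unfolding mem_Pw by (rule subsetI) (simp only: m)
    show "f = g" if fg: "f \<^bold>\<in> inside W" "g \<^bold>\<in> inside W"
      "Sep (Times W W) (\<lambda>p. p \<^bold>\<in> f) = Sep (Times W W) (\<lambda>p. p \<^bold>\<in> g)" for f g
    proof (rule Sn_eqI)
      show "f \<^bold>\<in> Sn n A" "g \<^bold>\<in> Sn n A" using fg(1,2) unfolding mem_inside by blast+
      show "app f x = app g x" if "x \<^bold>\<in> moved A f" for x by (rule agree[OF fg that])
      show "app f x = app g x" if "x \<^bold>\<in> moved A g" for x
        by (rule agree[OF fg(2,1) fg(3)[symmetric] that, symmetric])
    qed
  qed
qed

lemma lst_new: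
  assumes "finite_set U" "subset U A" "\<not> subset U W"
  shows "lst R (diff U W) \<^bold>\<in> A \<and> \<not> lst R (diff U W) \<^bold>\<in> W"
proof -
  have s: "subset (diff U W) U" by (rule subsetI) simp
  have "subset (diff U W) A" using s assms(2) unfolding subset_def by blast
  moreover have "diff U W \<noteq> emp"
  proof
    assume "diff U W = emp"
    then have "\<not> z \<^bold>\<in> diff U W" for z by simp
    then show False using assms(3) unfolding subset_def by simp
  qed
  ultimately have "lst R (diff U W) \<^bold>\<in> diff U W"
    using lst_least(1)[OF lin finite_subset[OF assms(1) s]] by blast
  then show ?thesis using assms(2) subsetD by simp
qed

text \<open>
  The map \<open>decode \<circ> encode\<close> is injective on \<open>Sn n A\<close> and omits a point, so by pigeonhole it cannot
  preserve the finite set of permutations supported in \<open>W\<close>.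
\<close>

lemma new_fin_props:
  assumes W: "finite_set W"
  shows "new_fin W \<^bold>\<in> A \<and> \<not> new_fin W \<^bold>\<in> W"
  unfolding new_fin_def
proof (rule lst_new)
  let ?x = "decode (completion A emp)"
  have t: "trm (\<lambda>e. decode (encode (e 0)))" "trm (\<lambda>e. moved A (e 0))" by (intro dfn trm_encode)+
  have mem_escape: "f \<^bold>\<in> escape W \<longleftrightarrow> f = ?x \<or> (\<exists>g. g \<^bold>\<in> inside W \<and> f = decode (encode g))" for f
    unfolding escape_def mem_ins mem_Rep[OF t(1)] by blast
  have esc: "f \<^bold>\<in> Sn n A" if "f \<^bold>\<in> escape W" for f
    using that decode_props(1)[OF discrete_not_encode(1)] decode_props(1)[OF encode_in]
    unfolding mem_escape mem_inside by blast
  have fin: "finite_set (escape W)" unfolding escape_def by (intro finite_ins finite_Rep finite_inside W t)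
  show "finite_set (Uni (Rep (escape W) (moved A)))"
  proof (rule finite_Uni[OF finite_Rep[OF fin t(2)]])
    fix y assume "y \<^bold>\<in> Rep (escape W) (moved A)"
    then obtain f where "f \<^bold>\<in> escape W" "y = moved A f" unfolding mem_Rep[OF t(2)] by blast
    then show "finite_set y" using Sn_props(4)[OF esc] by simp
  qed
  show "subset (Uni (Rep (escape W) (moved A))) A"
  proof (rule subsetI)
    fix x assume "x \<^bold>\<in> Uni (Rep (escape W) (moved A))"
    then obtain y where "y \<^bold>\<in> Rep (escape W) (moved A)" "x \<^bold>\<in> y" unfolding mem_Uni by blast
    then show "x \<^bold>\<in> A" unfolding mem_Rep[OF t(2)] by auto
  qed
  show "\<not> subset (Uni (Rep (escape W) (moved A))) W"
  proof
    assume *: "subset (Uni (Rep (escape W) (moved A))) W"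
    have ins: "f \<^bold>\<in> inside W" if f: "f \<^bold>\<in> escape W" for f
    proof -
      have "subset (moved A f) W"
      proof (rule subsetI)
        fix x assume x: "x \<^bold>\<in> moved A f"
        have "moved A f \<^bold>\<in> Rep (escape W) (moved A)" unfolding mem_Rep[OF t(2)] using f by blast
        then have "x \<^bold>\<in> Uni (Rep (escape W) (moved A))" unfolding mem_Uni using x by blast
        then show "x \<^bold>\<in> W" using * subsetD by blast
      qed
      then show ?thesis unfolding mem_inside using esc[OF f] by blast
    qed
    have "card_le (inside W) (diff (inside W) (ins ?x emp))"
    proof (rule card_leI[OF t(1)])
      show "decode (encode f) \<^bold>\<in> diff (inside W) (ins ?x emp)" if f: "f \<^bold>\<in> inside W" for f
      proof -
        have fS: "f \<^bold>\<in> Sn n A" using f unfolding mem_inside by blast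
        have "decode (encode f) \<noteq> ?x"
          using decode_inj[OF encode_in[OF fS] discrete_not_encode(1)] discrete_not_encode(2)[OF fS] by blast
        moreover have "decode (encode f) \<^bold>\<in> inside W" using ins f unfolding mem_escape by blast
        ultimately show ?thesis by simp
      qed
      show "f = g" if fg: "f \<^bold>\<in> inside W" "g \<^bold>\<in> inside W" "decode (encode f) = decode (encode g)" for f g
      proof -
        have "f \<^bold>\<in> Sn n A" "g \<^bold>\<in> Sn n A" using fg unfolding mem_inside by blast+
        then show ?thesis using decode_inj[OF encode_in encode_in fg(3)] encode_inj by blast
      qed
    qed
    moreover have "subset (diff (inside W) (ins ?x emp)) (inside W)" by (rule subsetI) simp
    ultimately have eq: "diff (inside W) (ins ?x emp) = inside W"
      using finite_not_card_le_proper finite_inside[OF W] by blast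
    have "?x \<^bold>\<in> inside W" using ins mem_escape by blast
    then have "?x \<^bold>\<in> diff (inside W) (ins ?x emp)" unfolding eq .
    then show False by simp
  qed
qed

section \<open>The step at an infinite ordinal\<close>

context
  fixes \<alpha> u
  assumes \<alpha>: "Ord \<alpha>" "\<not> natural \<alpha>"
    and u: "\<And>\<xi>. \<xi> \<^bold>\<in> \<alpha> \<Longrightarrow> app u \<xi> \<^bold>\<in> A"
    and u_inj: "\<And>\<xi> \<eta>. \<xi> \<^bold>\<in> \<alpha> \<Longrightarrow> \<eta> \<^bold>\<in> \<alpha> \<Longrightarrow> app u \<xi> = app u \<eta> \<Longrightarrow> \<xi> = \<eta>"
begin

lemma numerals_in: "emp \<^bold>\<in> \<alpha>" "suc emp \<^bold>\<in> \<alpha>"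
  using not_natural_Ord[OF \<alpha>] subsetD natural_emp natural_suc by (metis mem_omega)+

lemma app_pcode:
  assumes "\<xi> \<^bold>\<in> \<alpha>" "\<eta> \<^bold>\<in> \<alpha>"
  shows "app u (pcode \<alpha> \<xi> \<eta>) \<^bold>\<in> A"
    "\<xi>' \<^bold>\<in> \<alpha> \<Longrightarrow> \<eta>' \<^bold>\<in> \<alpha> \<Longrightarrow> app u (pcode \<alpha> \<xi> \<eta>) = app u (pcode \<alpha> \<xi>' \<eta>') \<Longrightarrow> \<xi> = \<xi>' \<and> \<eta> = \<eta>'"
proof -
  show "app u (pcode \<alpha> \<xi> \<eta>) \<^bold>\<in> A" using u pcode_props(1)[OF \<alpha> assms] by blast
  assume *: "\<xi>' \<^bold>\<in> \<alpha>" "\<eta>' \<^bold>\<in> \<alpha>" "app u (pcode \<alpha> \<xi> \<eta>) = app u (pcode \<alpha> \<xi>' \<eta>')"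
  have "pcode \<alpha> \<xi> \<eta> = pcode \<alpha> \<xi>' \<eta>'"
    using u_inj[OF pcode_props(1)[OF \<alpha> assms] pcode_props(1)[OF \<alpha> *(1,2)] *(3)] .
  then show "\<xi> = \<xi>' \<and> \<eta> = \<eta>'" using pcode_props(2)[OF \<alpha> assms *(1,2)] by blast
qed

lemma mem_duo: "x \<^bold>\<in> duo \<alpha> u \<xi> \<longleftrightarrow> x = app u (pcode \<alpha> \<xi> emp) \<or> x = app u (pcode \<alpha> \<xi> (suc emp))"
  unfolding duo_def by simp

lemma duo_disjoint:
  assumes "\<xi> \<^bold>\<in> \<alpha>" "\<eta> \<^bold>\<in> \<alpha>" "x \<^bold>\<in> duo \<alpha> u \<xi>" "x \<^bold>\<in> duo \<alpha> u \<eta>"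
  shows "\<xi> = \<eta>"
  using assms(3,4) app_pcode(2)[OF assms(1) _ assms(2)] numerals_in unfolding mem_duo by metis

lemma mem_Rep_duo: "c \<^bold>\<in> Rep Y (duo \<alpha> u) \<longleftrightarrow> (\<exists>\<xi>. \<xi> \<^bold>\<in> Y \<and> c = duo \<alpha> u \<xi>)"
proof (rule mem_Rep)
  show "trm (\<lambda>e. duo \<alpha> u (e 0))" by (intro dfn)
qed

lemma part_in:
  assumes Y: "subset Y \<alpha>"
  shows "part \<alpha> u Y \<^bold>\<in> Pf A"
  unfolding part_def
proof (rule completion_in_Pf)
  fix b assume "b \<^bold>\<in> Rep Y (duo \<alpha> u)"
  then obtain \<xi> where \<xi>: "\<xi> \<^bold>\<in> \<alpha>" "b = duo \<alpha> u \<xi>" using Y subsetD unfolding mem_Rep_duo by blast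
  have "finite_set b" unfolding \<xi>(2) duo_def by simp
  moreover have "subset b A" unfolding \<xi>(2) subset_def mem_duo
    using app_pcode(1)[OF \<xi>(1)] numerals_in by blast
  ultimately show "finite_set b \<and> subset b A \<and> (\<exists>x. x \<^bold>\<in> b)" unfolding \<xi>(2) mem_duo by blast
next
  fix b c x assume *: "b \<^bold>\<in> Rep Y (duo \<alpha> u)" "c \<^bold>\<in> Rep Y (duo \<alpha> u)" "x \<^bold>\<in> b" "x \<^bold>\<in> c"
  then show "b = c" using duo_disjoint Y subsetD unfolding mem_Rep_duo by metis
qed

text \<open>A pair is not a singleton, so as a block of the other partition it must come from some
  \<eta> in \<open>Z\<close>; disjointness of the pairs gives \<eta> = \<xi>.\<close>

lemma part_subset:
  assumes Y: "subset Y \<alpha>" and Z: "subset Z \<alpha>" and eq: "part \<alpha> u Y = part \<alpha> u Z"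
  shows "subset Y Z"
proof (rule subsetI)
  fix \<xi> assume \<xi>: "\<xi> \<^bold>\<in> Y"
  then have \<xi>\<alpha>: "\<xi> \<^bold>\<in> \<alpha>" using Y subsetD by blast
  have "duo \<alpha> u \<xi> \<^bold>\<in> part \<alpha> u Y" unfolding part_def mem_completion mem_Rep_duo using \<xi> by blast
  then have c: "duo \<alpha> u \<xi> \<^bold>\<in> completion A (Rep Z (duo \<alpha> u))" unfolding eq unfolding part_def .
  have "app u (pcode \<alpha> \<xi> emp) \<noteq> app u (pcode \<alpha> \<xi> (suc emp))"
    using app_pcode(2)[OF \<xi>\<alpha> _ \<xi>\<alpha>] numerals_in emp_neq_suc by metis
  from completion_block[OF c _ _ this] obtain \<eta> where \<eta>: "\<eta> \<^bold>\<in> Z" "duo \<alpha> u \<xi> = duo \<alpha> u \<eta>"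
    unfolding mem_duo mem_Rep_duo by blast
  have "app u (pcode \<alpha> \<xi> emp) \<^bold>\<in> duo \<alpha> u \<xi>" unfolding mem_duo by blast
  then have "\<xi> = \<eta>" using duo_disjoint[OF \<xi>\<alpha>] \<eta> Z subsetD by metis
  then show "\<xi> \<^bold>\<in> Z" using \<eta>(1) by simp
qed

lemma part_inj:
  assumes "subset Y \<alpha>" "subset Z \<alpha>" "part \<alpha> u Y = part \<alpha> u Z"
  shows "Y = Z"
  using part_subset[OF assms] part_subset[OF assms(2,1) assms(3)[symmetric]]
  by (intro ext) (blast dest: subsetD)

lemma mem_img: "x \<^bold>\<in> img \<alpha> u \<longleftrightarrow> (\<exists>\<xi>. \<xi> \<^bold>\<in> \<alpha> \<and> x = app u \<xi>)"
  unfolding img_def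
proof (rule mem_Rep)
  show "trm (\<lambda>e. app u (e 0))" by (intro dfn)
qed

lemma mem_graph:
  "p \<^bold>\<in> graph \<alpha> u f \<longleftrightarrow> (\<exists>\<xi> \<eta>. \<xi> \<^bold>\<in> \<alpha> \<and> \<eta> \<^bold>\<in> \<alpha> \<and> p = pcode \<alpha> \<xi> \<eta> \<and>
     app u \<xi> \<noteq> app u \<eta> \<and> app f (app u \<xi>) = app u \<eta>)"
proof -
  have d: "dfn (\<lambda>e. \<exists>\<xi> \<eta>. \<xi> \<^bold>\<in> \<alpha> \<and> \<eta> \<^bold>\<in> \<alpha> \<and> e 0 = pcode \<alpha> \<xi> \<eta> \<and>
     app u \<xi> \<noteq> app u \<eta> \<and> app f (app u \<xi>) = app u \<eta>)" by (intro dfn)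
  show ?thesis unfolding graph_def mem_Sep[OF d] using pcode_props(1)[OF \<alpha>] by blast
qed

lemma graph_subset: "subset (graph \<alpha> u f) \<alpha>"
  unfolding subset_def mem_graph using pcode_props(1)[OF \<alpha>] by blast

lemma finite_graph:
  assumes "f \<^bold>\<in> Sn n A"
  shows "finite_set (graph \<alpha> u f)"
proof -
  \<comment> \<open>The inverse of \<open>u\<close> as a definable term, which exhibits the graph as
    an image of the finite support.\<close>
  define inv where "inv = (\<lambda>x. the_v (\<lambda>\<xi>. \<xi> \<^bold>\<in> \<alpha> \<and> app u \<xi> = x))"
  have inv: "inv (app u \<xi>) = \<xi>" if "\<xi> \<^bold>\<in> \<alpha>" for \<xi>
    unfolding inv_def by (rule the_v_eq) (use that u_inj in blast)+
  show ?thesis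
  proof (rule finite_image[OF Sn_props(4)[OF assms]])
    show "trm (\<lambda>e. pcode \<alpha> (inv (e 0)) (inv (app f (e 0))))" unfolding inv_def by (intro dfn)
    fix p assume "p \<^bold>\<in> graph \<alpha> u f"
    then obtain \<xi> \<eta> where p: "\<xi> \<^bold>\<in> \<alpha>" "\<eta> \<^bold>\<in> \<alpha>" "p = pcode \<alpha> \<xi> \<eta>" "app u \<xi> \<noteq> app u \<eta>"
      "app f (app u \<xi>) = app u \<eta>" unfolding mem_graph by blast
    have "app u \<xi> \<^bold>\<in> moved A f" using p u by simp
    moreover have "p = pcode \<alpha> (inv (app u \<xi>)) (inv (app f (app u \<xi>)))" using p inv by simp
    ultimately show "\<exists>x. x \<^bold>\<in> moved A f \<and> p = pcode \<alpha> (inv x) (inv (app f x))" by blast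
  qed
qed

lemma graph_agree:
  assumes f: "f \<^bold>\<in> inside (img \<alpha> u)" and eq: "graph \<alpha> u f = graph \<alpha> u g" and x: "x \<^bold>\<in> moved A f"
  shows "app f x = app g x"
proof -
  have fS: "f \<^bold>\<in> Sn n A" "subset (moved A f) (img \<alpha> u)" using f unfolding mem_inside by blast+
  have "x \<^bold>\<in> img \<alpha> u" "app f x \<^bold>\<in> img \<alpha> u" using fS x Sn_props(5) subsetD by blast+
  then obtain \<xi> \<eta> where p: "\<xi> \<^bold>\<in> \<alpha>" "\<eta> \<^bold>\<in> \<alpha>" "x = app u \<xi>" "app f x = app u \<eta>"
    unfolding mem_img by blast
  have "app u \<xi> \<noteq> app u \<eta>" using x p(3,4) by auto
  then have "pcode \<alpha> \<xi> \<eta> \<^bold>\<in> graph \<alpha> u g" unfolding eq[symmetric] mem_graph using p by blast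
  then obtain \<xi>' \<eta>' where p': "\<xi>' \<^bold>\<in> \<alpha>" "\<eta>' \<^bold>\<in> \<alpha>" "pcode \<alpha> \<xi> \<eta> = pcode \<alpha> \<xi>' \<eta>'"
    "app g (app u \<xi>') = app u \<eta>'" unfolding mem_graph by blast
  have "\<xi> = \<xi>' \<and> \<eta> = \<eta>'" by (rule pcode_props(2)[OF \<alpha> p(1,2) p'(1-3)])
  then show ?thesis using p p' by simp
qed

lemma graph_inj:
  assumes "f \<^bold>\<in> inside (img \<alpha> u)" "g \<^bold>\<in> inside (img \<alpha> u)" "graph \<alpha> u f = graph \<alpha> u g"
  shows "f = g"
proof (rule Sn_eqI)
  show "f \<^bold>\<in> Sn n A" "g \<^bold>\<in> Sn n A" using assms(1,2) unfolding mem_inside by blast+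
  show "app f x = app g x" if "x \<^bold>\<in> moved A f" for x by (rule graph_agree[OF assms(1,3) that])
  show "app f x = app g x" if "x \<^bold>\<in> moved A g" for x
    by (rule graph_agree[OF assms(2) assms(3)[symmetric] that, symmetric])
qed

lemma mem_diag:
  "\<zeta> \<^bold>\<in> diag \<alpha> u \<longleftrightarrow> \<zeta> \<^bold>\<in> \<alpha> \<and> (\<exists>Y. subset Y \<alpha> \<and> subset (moved A (decode (part \<alpha> u Y))) (img \<alpha> u) \<and>
     code \<alpha> (graph \<alpha> u (decode (part \<alpha> u Y))) = \<zeta> \<and> \<not> \<zeta> \<^bold>\<in> Y)"
  unfolding diag_def
proof (rule mem_Sep)
  show "dfn (\<lambda>e. \<exists>Y. subset Y \<alpha> \<and> subset (moved A (decode (part \<alpha> u Y))) (img \<alpha> u) \<and>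
     code \<alpha> (graph \<alpha> u (decode (part \<alpha> u Y))) = e 0 \<and> \<not> e 0 \<^bold>\<in> Y)" by (intro dfn)
qed

text \<open>Cantor's diagonal argument, with \<open>code \<alpha> \<circ> graph \<alpha> u\<close> embedding the permutations supported
  in the image of \<open>u\<close> into \<open>\<alpha>\<close>.\<close>

lemma diag_escapes: "\<not> subset (moved A (decode (part \<alpha> u (diag \<alpha> u)))) (img \<alpha> u)"
proof
  let ?Y = "diag \<alpha> u"
  let ?f = "\<lambda>Z. decode (part \<alpha> u Z)"
  let ?c = "\<lambda>Z. code \<alpha> (graph \<alpha> u (?f Z))"
  assume supp: "subset (moved A (?f ?Y)) (img \<alpha> u)"
  have Y: "subset ?Y \<alpha>" by (rule subsetI) (rule mem_diag[THEN iffD1, THEN conjunct1])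
  have fS: "?f Z \<^bold>\<in> Sn n A" if "subset Z \<alpha>" for Z
    by (rule decode_props(1)[OF part_in[OF that]])
  have c: "?c ?Y \<^bold>\<in> \<alpha>" by (rule code_in[OF \<alpha> finite_graph[OF fS[OF Y]] graph_subset])
  \<comment> \<open>If the code were outside the diagonal set, that set would itself be the witness
    that puts the code in.\<close>
  have cY: "?c ?Y \<^bold>\<in> ?Y"
  proof (rule ccontr)
    assume n: "\<not> ?c ?Y \<^bold>\<in> ?Y"
    have "?c ?Y \<^bold>\<in> ?Y" by (rule mem_diag[THEN iffD2]) (intro conjI exI[of _ ?Y] c Y supp refl n)
    with n show False by (rule notE)
  qed
  \<comment> \<open>Membership supplies a \<open>Z\<close> that omits the code but has the same one;
    injectivity of all the maps composed forces \<open>Z\<close> to be the diagonal set.\<close>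
  obtain Z where Z: "subset Z \<alpha>" "subset (moved A (?f Z)) (img \<alpha> u)" "?c Z = ?c ?Y" "\<not> ?c ?Y \<^bold>\<in> Z"
    using mem_diag[THEN iffD1, OF cY, THEN conjunct2] by (elim conjE exE) (rule that)
  have "graph \<alpha> u (?f Z) = graph \<alpha> u (?f ?Y)"
    by (rule code_inj[OF \<alpha> finite_graph[OF fS[OF Z(1)]] graph_subset finite_graph[OF fS[OF Y]] graph_subset Z(3)])
  then have "?f Z = ?f ?Y"
    by (rule graph_inj[rotated 2]) (intro mem_inside[THEN iffD2] conjI fS Z Y supp)+
  then have "part \<alpha> u Z = part \<alpha> u ?Y" by (rule decode_inj[OF part_in[OF Z(1)] part_in[OF Y]])
  then have "Z = ?Y" by (rule part_inj[OF Z(1) Y])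
  then show False using Z(4) cY by (simp only: not_True_eq_False)
qed

lemma new_inf_props: "new_inf \<alpha> u \<^bold>\<in> A \<and> \<not> new_inf \<alpha> u \<^bold>\<in> img \<alpha> u"
  unfolding new_inf_def
proof (rule lst_new[OF _ _ diag_escapes])
  have "subset (diag \<alpha> u) \<alpha>" by (rule subsetI) (simp only: mem_diag)
  then have "decode (part \<alpha> u (diag \<alpha> u)) \<^bold>\<in> Sn n A" using decode_props(1) part_in by blast
  then show "finite_set (moved A (decode (part \<alpha> u (diag \<alpha> u))))"
    "subset (moved A (decode (part \<alpha> u (diag \<alpha> u)))) A" using Sn_props(3,4) by blast+
qed

end

lemma step_props:
  assumes "Ord \<alpha>" "\<And>\<xi>. \<xi> \<^bold>\<in> \<alpha> \<Longrightarrow> app u \<xi> \<^bold>\<in> A"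
    "\<And>\<xi> \<eta>. \<xi> \<^bold>\<in> \<alpha> \<Longrightarrow> \<eta> \<^bold>\<in> \<alpha> \<Longrightarrow> app u \<xi> = app u \<eta> \<Longrightarrow> \<xi> = \<eta>"
  shows "step \<alpha> u \<^bold>\<in> A \<and> \<not> step \<alpha> u \<^bold>\<in> img \<alpha> u"
proof (cases "natural \<alpha>")
  case True
  have "trm (\<lambda>e. app u (e 0))" by (intro dfn)
  then have "finite_set (img \<alpha> u)" unfolding img_def by (rule finite_Rep[OF finite_natural[OF True]])
  from new_fin_props[OF this] show ?thesis unfolding step_def if_P[OF True] .
next
  case False
  show ?thesis unfolding step_def if_not_P[OF False]
    by (rule new_inf_props[OF assms(1) False assms(2,3)])
qed

definition enum :: "'v \<Rightarrow> 'v" where "enum = recur step"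

lemma trm_enum [dfn]: "trm s \<Longrightarrow> trm (\<lambda>e. enum (s e))"
  unfolding enum_def by (rule trm_recur[OF trm_step])

text \<open>By the induction hypothesis the values below \<alpha> are distinct points of
  \<open>A\<close>, as \<open>step_props\<close> demands of a history.\<close>

lemma enum_new:
  assumes "Ord \<alpha>"
  shows "enum \<alpha> \<^bold>\<in> A \<and> (\<forall>\<xi>. \<xi> \<^bold>\<in> \<alpha> \<longrightarrow> enum \<xi> \<noteq> enum \<alpha>)"
proof (rule Ord_induct[OF assms], intro dfn)
  fix \<alpha> assume \<alpha>: "Ord \<alpha>"
    and IH: "\<And>\<beta>. \<beta> \<^bold>\<in> \<alpha> \<Longrightarrow> enum \<beta> \<^bold>\<in> A \<and> (\<forall>\<xi>. \<xi> \<^bold>\<in> \<beta> \<longrightarrow> enum \<xi> \<noteq> enum \<beta>)"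
  have t: "trm (\<lambda>e. enum (e 0))" by (intro dfn)
  have t2: "trm (\<lambda>e. app (lam \<alpha> enum) (e 0))" by (intro dfn)
  have a: "app (lam \<alpha> enum) \<xi> = enum \<xi>" if "\<xi> \<^bold>\<in> \<alpha>" for \<xi> by (rule app_lam[OF t that])
  have eq: "enum \<alpha> = step \<alpha> (lam \<alpha> enum)" unfolding enum_def by (rule recur_eq[OF trm_step \<alpha>])
  have "step \<alpha> (lam \<alpha> enum) \<^bold>\<in> A \<and> \<not> step \<alpha> (lam \<alpha> enum) \<^bold>\<in> img \<alpha> (lam \<alpha> enum)"
  proof (rule step_props[OF \<alpha>])
    show "app (lam \<alpha> enum) \<xi> \<^bold>\<in> A" if "\<xi> \<^bold>\<in> \<alpha>" for \<xi> using IH[OF that] a[OF that] by simp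
    show "\<xi> = \<eta>" if "\<xi> \<^bold>\<in> \<alpha>" "\<eta> \<^bold>\<in> \<alpha>" "app (lam \<alpha> enum) \<xi> = app (lam \<alpha> enum) \<eta>" for \<xi> \<eta>
      using that(3) IH[OF that(1)] IH[OF that(2)] Ord_linear[OF Ord_in[OF \<alpha> that(1)] Ord_in[OF \<alpha> that(2)]]
      unfolding a[OF that(1)] a[OF that(2)] by metis
  qed
  then have "enum \<alpha> \<^bold>\<in> A" "\<not> enum \<alpha> \<^bold>\<in> img \<alpha> (lam \<alpha> enum)" unfolding eq by blast+
  moreover have "enum \<xi> \<^bold>\<in> img \<alpha> (lam \<alpha> enum)" if "\<xi> \<^bold>\<in> \<alpha>" for \<xi>
    unfolding img_def mem_Rep[OF t2] using a[OF that] that by metis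
  ultimately show "enum \<alpha> \<^bold>\<in> A \<and> (\<forall>\<xi>. \<xi> \<^bold>\<in> \<alpha> \<longrightarrow> enum \<xi> \<noteq> enum \<alpha>)" by metis
qed

text \<open>Replacement along the inverse of \<open>enum\<close> would gather all ordinals into the
  image of the set \<open>A\<close>.\<close>

lemma contradiction: False
proof -
  define g where "g = (\<lambda>a. the_v (\<lambda>\<alpha>. Ord \<alpha> \<and> enum \<alpha> = a))"
  have t: "trm (\<lambda>e. g (e 0))" unfolding g_def by (intro dfn)
  have "\<alpha> \<^bold>\<in> Rep A g" if \<alpha>: "Ord \<alpha>" for \<alpha>
  proof -
    have "g (enum \<alpha>) = \<alpha>" unfolding g_def
    proof (rule the_v_eq)
      show "\<beta> = \<alpha>" if "Ord \<beta> \<and> enum \<beta> = enum \<alpha>" for \<beta>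
        using that enum_new \<alpha> Ord_linear by metis
    qed (use \<alpha> in blast)
    then show ?thesis unfolding mem_Rep[OF t] using enum_new[OF \<alpha>] by metis
  qed
  then show False using Ord_proper_class by blast
qed

end

context encoding
begin

lemma card_less_Sn_Pf: "card_less (Sn n A) (Pf A)"
proof -
  have "card_le (Sn n A) (Pf A)"
    by (rule card_leI[of encode]) (intro trm_encode dfn, auto intro: encode_in encode_inj)
  moreover have "\<not> card_eq (Sn n A) (Pf A)"
  proof
    assume "card_eq (Sn n A) (Pf A)"
    then obtain b where "bijection b (Sn n A) (Pf A)" unfolding card_eq_def by blast
    then interpret collision mem A R n q b by unfold_locales
    show False by (rule contradiction)
  qed
  ultimately show ?thesis unfolding card_less_def by blast
qed

end

theorem theorem2p6:
  fixes mem :: "'v \<Rightarrow> 'v \<Rightarrow> bool" and n A :: 'v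
  assumes "ZF_model mem"
    and "set_language.natural mem n"
    and "\<not> set_language.finite_set mem A"
    and "\<exists>R. set_language.linear_order mem R A"
  shows "\<exists>S Q. set_language.is_S_le mem S n A \<and> set_language.is_Part_fin mem Q A \<and>
           set_language.card_less mem S Q"
proof -
  interpret ZF_model mem by (rule assms(1))
  obtain R where R: "linear_order R A" using assms(4) by blast
  have n: "finite_set (suc n)" by (intro finite_natural natural_suc assms(2))
  have "finite_set (suc (suc (suc (suc emp))))" by (intro finite_natural natural_suc natural_emp)
  \<comment> \<open>Here the infinitude of \<open>A\<close> enters: \<open>A\<close> has room for
    the finite stock of all codewords, in \<open>n\<close> + 1 copies.\<close>
  have "card_le (Times (suc n) (Times (suc (suc (suc (suc emp)))) (Pw (Times (suc n) (suc n))))) A"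
    by (intro infinite_card_le[OF assms(3)] n finite_Times finite_Pw) fact
  then obtain q where q: "injection q (Times (suc n) (Times (suc (suc (suc (suc emp)))) (Pw (Times (suc n) (suc n))))) A"
    unfolding card_le_def by blast
  interpret encoding mem A R n q by unfold_locales (use R q assms(2) in blast)+
  show ?thesis using is_S_le_Sn is_Part_fin_Pf card_less_Sn_Pf by blast
qed

end
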